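(* Let $\sigma$ be the standard semicircular law on $\mathbb{R}$. Let $\mu$ be a compactly supported Borel probability measure on $\mathbb{R}$ which is centered, i.e. $\int x\,d\mu(x)=0$, and let $\nu$ be another compactly supported Borel probability measure on $\mathbb{R}$. Then $$W_2(\mu,\nu)^2\le 2H(\mu,\sigma)+2H(\nu,\sigma).$$ Equality occurs if and only if there is $s>0$ such that $\mu$ is a semicircular distribution with variance $s^2$ and $\nu$ is a semicircular distribution with variance $s^{-2}$.
   Context: $W_2$ is the usual quadratic Wasserstein distance between probability measures on $\mathbb{R}$: $W_2(\mu,\nu)^2=\inf_\pi\int|x-y|^2\,d\pi(x,y)$ over couplings $\pi$ of $\mu$ and $\nu$. The standard semicircular law $\sigma$ has density $\frac{1}{2\pi}\sqrt{4-x^2}$ on $[-2,2]$. A semicircular distribution with variance $s^2>0$ is a law with density $\frac{1}{2\pi s^2}\sqrt{4s^2-(x-m)^2}$ on $[m-2s,m+2s]$ for some mean $m\in\mathbb{R}$. The free entropy of a Borel probability measure $\mu$ on $\mathbb{R}$ is $$\chi(\mu)=\iint\log|t-s|\,d\mu(s)\,d\mu(t)+\tfrac34+\tfrac12\log(2\pi)\in[-\infty,\infty),$$ and the free entropy relative to $\sigma$ is $$H(\mu,\sigma)=\tfrac12\int x^2\,d\mu(x)-\chi(\mu)+\tfrac12\log(2\pi)\in[0,+\infty].$$ *)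

theory Defs
  imports "HOL-Probability.Probability"
begin

definition compactly_supported :: "'a::topological_space measure \<Rightarrow> bool" where
  "compactly_supported \<mu> \<longleftrightarrow> (\<exists>K. compact K \<and> (AE x in \<mu>. x \<in> K))"


definition couplings :: "'a measure \<Rightarrow> 'b measure \<Rightarrow> ('a \<times> 'b) measure set" where
  "couplings \<mu> \<nu> =
     {\<pi>. prob_space \<pi> \<and> sets \<pi> = sets (\<mu> \<Otimes>\<^sub>M \<nu>) \<and> distr \<pi> \<mu> fst = \<mu> \<and> distr \<pi> \<nu> snd = \<nu>}"

definition quadratic_cost :: "real measure \<Rightarrow> real measure \<Rightarrow> ennreal" where
  "quadratic_cost \<mu> \<nu> = (INF \<pi>\<in>couplings \<mu> \<nu>. \<integral>\<^sup>+ p. ennreal (\<bar>fst p - snd p\<bar>\<^sup>2) \<partial>\<pi>)"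

(* The square root of the cost, taken in [0, \<infinity>]; see wasserstein2_squared. *)
definition wasserstein2 :: "real measure \<Rightarrow> real measure \<Rightarrow> ennreal" where
  "wasserstein2 \<mu> \<nu> =
     (if quadratic_cost \<mu> \<nu> = \<infinity> then \<infinity> else ennreal (sqrt (enn2real (quadratic_cost \<mu> \<nu>))))"

lemma wasserstein2_squared: "(wasserstein2 \<mu> \<nu>)\<^sup>2 = quadratic_cost \<mu> \<nu>"
proof (cases "quadratic_cost \<mu> \<nu>")
  case (real r)
  then show ?thesis
    by (simp add: wasserstein2_def ennreal_power)
next
  case top
  then show ?thesis
    by (simp add: wasserstein2_def)
qed


definition semicircular_density :: "real \<Rightarrow> real \<Rightarrow> real \<Rightarrow> real" where
  "semicircular_density m s x =
     indicator {m - 2 * s .. m + 2 * s} x * (1 / (2 * pi * s\<^sup>2)) * sqrt (4 * s\<^sup>2 - (x - m)\<^sup>2)"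

definition semicircular_law :: "real \<Rightarrow> real \<Rightarrow> real measure" where
  "semicircular_law m s = density lborel (\<lambda>x. ennreal (semicircular_density m s x))"

definition semicircular_with_variance :: "real measure \<Rightarrow> real \<Rightarrow> bool" where
  "semicircular_with_variance \<mu> v \<longleftrightarrow> (\<exists>m s. 0 < s \<and> v = s\<^sup>2 \<and> \<mu> = semicircular_law m s)"


(* Integral of an extended-real-valued function as the difference of the integrals of its
   positive and negative parts (e2ennreal truncates negative values to 0). It has its usual
   meaning whenever one of the two parts is finite; in the remaining case the conventions for
   subtraction on ereal give \<infinity>. *)
definition ereal_integral :: "'a measure \<Rightarrow> ('a \<Rightarrow> ereal) \<Rightarrow> ereal" where
  "ereal_integral M f =
     enn2ereal (\<integral>\<^sup>+ x. e2ennreal (f x) \<partial>M) - enn2ereal (\<integral>\<^sup>+ x. e2ennreal (- f x) \<partial>M)"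

lemma ereal_integral_eq_integral:
  assumes "integrable M f"
  shows "ereal_integral M (\<lambda>x. ereal (f x)) = ereal (\<integral>x. f x \<partial>M)"
proof -
  have fin: "(\<integral>\<^sup>+ x. ennreal (f x) \<partial>M) \<noteq> \<infinity>" "(\<integral>\<^sup>+ x. ennreal (- f x) \<partial>M) \<noteq> \<infinity>"
    using assms by (auto simp: real_integrable_def)
  obtain a b where ab: "0 \<le> a" "0 \<le> b"
    "(\<integral>\<^sup>+ x. ennreal (f x) \<partial>M) = ennreal a" "(\<integral>\<^sup>+ x. ennreal (- f x) \<partial>M) = ennreal b"
    using fin by (metis ennreal_cases infinity_ennreal_def)
  have "(\<integral>x. f x \<partial>M) = a - b"
    using real_lebesgue_integral_def[OF assms] ab by simp
  moreover have "ereal_integral M (\<lambda>x. ereal (f x)) = ereal (a - b)"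
    using ab by (simp add: ereal_integral_def e2ennreal_ereal)
  ultimately show ?thesis
    by simp
qed

(* The library sets ln 0 = 0, whereas here the logarithm of 0 is -\<infinity>: atoms of \<mu> must
   give free entropy -\<infinity>. *)
definition log_dist :: "real \<Rightarrow> real \<Rightarrow> ereal" where
  "log_dist s t = (if s = t then -\<infinity> else ereal (ln \<bar>t - s\<bar>))"

definition log_energy :: "real measure \<Rightarrow> ereal" where
  "log_energy \<mu> = ereal_integral (\<mu> \<Otimes>\<^sub>M \<mu>) (\<lambda>(s, t). log_dist s t)"

definition free_entropy :: "real measure \<Rightarrow> ereal" where
  "free_entropy \<mu> = log_energy \<mu> + ereal (3 / 4) + ereal (ln (2 * pi) / 2)"

definition second_moment :: "real measure \<Rightarrow> ereal" where
  "second_moment \<mu> = enn2ereal (\<integral>\<^sup>+ x. ennreal (x\<^sup>2) \<partial>\<mu>)"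

(* H(\<mu>, \<sigma>), the free entropy of \<mu> relative to the standard semicircular law
   \<sigma> = semicircular_law 0 1. The reference law enters only through the potential x^2 / 2
   and the additive constant. *)
definition free_entropy_rel_semicircular :: "real measure \<Rightarrow> ereal" where
  "free_entropy_rel_semicircular \<mu> =
     ereal (1 / 2) * second_moment \<mu> - free_entropy \<mu> + ereal (ln (2 * pi) / 2)"

end

(* With quantile functions X and Y of mu and nu on a common atomless reference space, write
   x = X u - X w and y = Y u - Y w for independent u, w. As mu is centred, the statement says that
   the mean E(X, Y) of the pair cost x y / 2 - ln (x y) is at least 3/2.

   A minimiser of E exists by Helly's theorem and Fatou's lemma, because E is invariant under
   translations and under (X, Y) |-> (r X, Y / r). Let h(x, y) = x y / (x + y) and let H be the
   average of h over the second point. Along X + t (H - X), Y + t H the bilinear part of E is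
   constant to first order, so minimality yields that the mean of (H u - H w) / h(u, w) is at most
   1. Symmetrising over triples of points, h being concave and homogeneous, it is at least 1, with
   equality only if x : y is constant. Hence Y is an affine function of X.

   This leaves E(Z, Z), the logarithmic energy in a quadratic field. There the tangent inequality at
   the semicircle quantile S needs only that the mean of z / s is at most half the mean of z s, which
   follows by smoothing the Hilbert transform: at height epsilon it is the real part of the Cauchy
   transform w, where w + 1 / w = x + i epsilon. *)

theory Submission
  imports Defs "HOL-Real_Asymp.Real_Asymp"
begin

text \<open>The pair cost is not jointly convex: its Hessian in (x, y) is indefinite once x y > 2,
  so convexity gives no tangent inequality for X and Y together. On the diagonal the cost z^2 / 2 -
  2 ln z is convex, which is why Y is first forced to be affine in X at a minimiser. The parallel
  sum enters through 1 / h = 1 / x + 1 / y. Moving Y by t H and X by t (H - X) changes the mean of -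
  ln (x y) at the rate 1 - mean (k / h), where k is the increment of H, and h (x + y) = x y balances
  the bilinear part after symmetrising. H is nondecreasing, so the perturbed pair stays a legitimate
  competitor. The cost is nonnegative, so the variational part lives in \<open>ennreal\<close>;
  identities there are arranged without subtraction, and finite terms are cancelled only after
  integration. The value 3/2 is attained at X = Y = S: the bilinear part gives 1, and the
  logarithmic energy -1/4 gives 1/2. The quantile coupling bounds the transport cost from above; for
  semicircular pairs of reciprocal variances a quadratic minorant of the cost gives the matching
  lower bound.\<close>

abbreviation \<sigma> :: "real measure" where
  "\<sigma> \<equiv> semicircular_law 0 1"

abbreviation dint :: "'a measure \<Rightarrow> ('a \<Rightarrow> 'a \<Rightarrow> ennreal) \<Rightarrow> ennreal" where
  "dint M f \<equiv> \<integral>\<^sup>+u. \<integral>\<^sup>+w. f u w \<partial>M \<partial>M"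

lemma dint_cong_AE:
  assumes "AE u in M. AE w in M. f u w = g u w"
  shows "dint M f = dint M g"
  using assms by (intro nn_integral_cong_AE) (auto elim!: eventually_mono intro!: nn_integral_cong_AE)

lemma dint_mono_AE:
  assumes "AE u in M. AE w in M. f u w \<le> g u w"
  shows "dint M f \<le> dint M g"
  using assms by (intro nn_integral_mono_AE) (auto elim!: eventually_mono intro!: nn_integral_mono_AE)

lemma (in sigma_finite_measure) dint_liminf:
  assumes [measurable]: "\<And>n. (\<lambda>(u, w). f n u w) \<in> borel_measurable (M \<Otimes>\<^sub>M M)"
  shows "dint M (\<lambda>u w. liminf (\<lambda>n. f n u w)) \<le> liminf (\<lambda>n. dint M (f n))"
proof -
  have "dint M (\<lambda>u w. liminf (\<lambda>n. f n u w)) \<le> (\<integral>\<^sup>+u. liminf (\<lambda>n. \<integral>\<^sup>+w. f n u w \<partial>M) \<partial>M)"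
    by (intro nn_integral_mono nn_integral_liminf) measurable
  also have "\<dots> \<le> liminf (\<lambda>n. dint M (f n))"
    by (intro nn_integral_liminf) measurable
  finally show ?thesis .
qed

section \<open>Parallel sums and the pair cost\<close>

text \<open>Half of the harmonic mean, with reciprocal \<open>1 / x + 1 / y\<close>. At
  \<open>x + y = 0\<close> division by zero gives 0, the continuous value for cosigned
  arguments.\<close>

definition par :: "real \<Rightarrow> real \<Rightarrow> real" where
  "par x y = x * y / (x + y)"

text \<open>The relation between the increments of two nondecreasing functions over the same pair of
  points. Zero increments are allowed, since the functions may have flat pieces.\<close>

definition cosigned :: "real \<Rightarrow> real \<Rightarrow> bool" where
  "cosigned x y \<longleftrightarrow> (0 \<le> x \<and> 0 \<le> y) \<or> (x \<le> 0 \<and> y \<le> 0)"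

lemma par_minus: "par (- x) (- y) = - par x y"
proof -
  have "- x + - y = - (x + y)" by simp
  then show ?thesis unfolding par_def by (metis minus_divide_right minus_mult_minus)
qed

lemma par_nonneg_le:
  assumes "0 \<le> x" "0 \<le> y"
  shows "0 \<le> par x y" "par x y \<le> x"
proof -
  show "0 \<le> par x y" using assms by (simp add: par_def)
  show "par x y \<le> x"
  proof (cases "x + y = 0")
    case False
    then show ?thesis using assms by (simp add: par_def divide_simps algebra_simps)
  qed (use assms in \<open>simp add: par_def\<close>)
qed

text \<open>The difference is exactly \<open>A * (y' - y) + B * (x' - x)\<close> with both weights
  in [0, 1]. So \<open>par\<close> is nondecreasing and 1-Lipschitz in each argument, which later
  makes \<open>H\<close> well defined and nondecreasing.\<close>

lemma par_diff_bounds_pos: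
  assumes "0 \<le> x" "0 \<le> y" "x \<le> x'" "y \<le> y'"
  shows "par x y \<le> par x' y' \<and> par x' y' - par x y \<le> (x' - x) + (y' - y)"
proof (cases "x + y = 0")
  case True
  then have "x = 0" "y = 0" using assms by auto
  then show ?thesis using par_nonneg_le[of x' y'] assms by (auto simp: par_def)
next
  case False
  define s where "s = x + y"
  define s' where "s' = x' + y'"
  have s: "0 < s" "0 < s'" using False assms unfolding s_def s'_def by auto
  define A where "A = x * x' / (s * s')"
  define B where "B = y * y' / (s * s')"
  have d: "par x' y' - par x y = A * (y' - y) + B * (x' - x)"
  proof -
    have "par x' y' - par x y = (x' * y' * s - x * y * s') / (s * s')"
      using s by (simp add: par_def s_def[symmetric] s'_def[symmetric] field_simps)
    also have "x' * y' * s - x * y * s' = (x * x') * (y' - y) + (y * y') * (x' - x)"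
      unfolding s_def s'_def by algebra
    finally show ?thesis by (simp add: add_divide_distrib A_def B_def)
  qed
  have "0 \<le> A" "A \<le> 1" "0 \<le> B" "B \<le> 1"
    unfolding A_def B_def using s assms by (auto simp: s_def s'_def intro!: mult_mono)
  then have "A * (y' - y) \<le> 1 * (y' - y)" "B * (x' - x) \<le> 1 * (x' - x)"
    "0 \<le> A * (y' - y)" "0 \<le> B * (x' - x)"
    using assms by (intro mult_right_mono mult_nonneg_nonneg; simp)+
  moreover define u v where "u = A * (y' - y)" and "v = B * (x' - x)"
  ultimately have "0 \<le> u" "u \<le> y' - y" "0 \<le> v" "v \<le> x' - x" "par x' y' - par x y = u + v"
    using d by auto
  then show ?thesis by simp
qed

lemma par_diff_bounds:
  assumes "cosigned x y" "cosigned x' y'" "x \<le> x'" "y \<le> y'"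
  shows "par x y \<le> par x' y'" "par x' y' - par x y \<le> (x' - x) + (y' - y)"
proof -
  have "par x y \<le> par x' y' \<and> par x' y' - par x y \<le> (x' - x) + (y' - y)"
  proof (cases "0 \<le> x \<and> 0 \<le> y")
    case True
    then show ?thesis using par_diff_bounds_pos assms by auto
  next
    case False
    then have n: "x \<le> 0" "y \<le> 0" using assms by (auto simp: cosigned_def)
    show ?thesis
    proof (cases "x' \<le> 0 \<and> y' \<le> 0")
      case True
      then show ?thesis
        using par_diff_bounds_pos[of "-x'" "-y'" "-x" "-y"] assms by (simp add: par_minus)
    next
      case False
      then have p: "0 \<le> x'" "0 \<le> y'" using assms by (auto simp: cosigned_def)
      \<comment> \<open>The two pairs lie on opposite sides of 0, where \<open>par\<close> vanishes,
        so each side is bounded on its own.\<close>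
      show ?thesis
        using par_nonneg_le[OF p] par_nonneg_le[of "-x" "-y"] n p assms
        by (auto simp: par_minus)
    qed
  qed
  then show "par x y \<le> par x' y'" "par x' y' - par x y \<le> (x' - x) + (y' - y)" by auto
qed

lemma same_sign_cases:
  fixes a b :: real assumes "0 < a * b" shows "(0 < a \<and> 0 < b) \<or> (a < 0 \<and> b < 0)"
  using assms by (simp add: zero_less_mult_iff)

text \<open>Let \<open>e = \<delta> - \<alpha> - \<beta>\<close> be the defect of superadditivity of
  \<open>par\<close>. The three quotients are \<open>1 + e / \<alpha>\<close>,
  \<open>1 + e / \<beta>\<close> and \<open>1 - e / \<delta>\<close>. The increments may come with
  any signs, so \<open>e\<close> and the bracket
  \<open>1 / \<alpha> + 1 / \<beta> - 1 / \<delta>\<close> can both be negative; their product is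
  the squared determinant times a positive factor.\<close>

lemma par_cyclic_identity:
  fixes x1 x2 y1 y2 :: real
  assumes "0 < x1 * y1" "0 < x2 * y2" "0 < (x1 + x2) * (y1 + y2)"
  defines "\<alpha> \<equiv> par x1 y1" and "\<beta> \<equiv> par x2 y2" and "\<delta> \<equiv> par (x1 + x2) (y1 + y2)"
  obtains r where "(\<delta> - \<beta>) / \<alpha> + (\<delta> - \<alpha>) / \<beta> + (\<alpha> + \<beta>) / \<delta> = 3 + (x1 * y2 - x2 * y1)\<^sup>2 * r" "0 < r"
proof -
  define s1 s2 where "s1 = x1 + y1" and "s2 = x2 + y2"
  define x3 y3 s3 where "x3 = x1 + x2" and "y3 = y1 + y2" and "s3 = s1 + s2"
  have nz: "x1 \<noteq> 0" "y1 \<noteq> 0" "x2 \<noteq> 0" "y2 \<noteq> 0" "x3 \<noteq> 0" "y3 \<noteq> 0"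
    using assms unfolding x3_def y3_def by auto
  have xs: "0 < x1 * s1" "0 < x2 * s2" "0 < x3 * s3" "0 < y1 * s1" "0 < y2 * s2" "0 < y3 * s3"
    using same_sign_cases[OF assms(1)] same_sign_cases[OF assms(2)] same_sign_cases[OF assms(3)]
    unfolding x3_def y3_def s1_def s2_def s3_def by (auto simp: zero_less_mult_iff)
  then have sz: "s1 \<noteq> 0" "s2 \<noteq> 0" "s3 \<noteq> 0" by auto
  have ne: "\<alpha> \<noteq> 0" "\<beta> \<noteq> 0" "\<delta> \<noteq> 0"
    using nz sz assms(3) unfolding \<alpha>_def \<beta>_def \<delta>_def par_def
    by (auto simp: s1_def s2_def s3_def x3_def y3_def ac_simps)
  define e where "e = \<delta> - \<alpha> - \<beta>"
  have al: "\<alpha> = x1 * y1 / s1" "\<beta> = x2 * y2 / s2" "\<delta> = x3 * y3 / s3"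
    unfolding \<alpha>_def \<beta>_def \<delta>_def par_def s1_def s2_def s3_def x3_def y3_def by (auto simp: algebra_simps)
  have e: "e = (x1 * y2 - x2 * y1)\<^sup>2 / (s1 * s2 * s3)"
  proof -
    have "e = (x3 * y3 * s1 * s2 - x1 * y1 * s2 * s3 - x2 * y2 * s1 * s3) / (s1 * s2 * s3)"
      unfolding e_def al using sz by (simp add: field_simps)
    also have "x3 * y3 * s1 * s2 - x1 * y1 * s2 * s3 - x2 * y2 * s1 * s3 = (x1 * y2 - x2 * y1)\<^sup>2"
      unfolding x3_def y3_def s3_def s1_def s2_def by algebra
    finally show ?thesis .
  qed
  \<comment> \<open>The bracket of reciprocals splits into an x-part and a y-part of this form. The
    numerator is a definite quadratic form, so the sign is that of \<open>a * b * (a + b)\<close>,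
    which matches the sign of \<open>s1 * s2 * s3\<close>.\<close>
  define q where "q a b = (a\<^sup>2 + a * b + b\<^sup>2) / (a * b * (a + b))" for a b :: real
  have q: "1 / a + 1 / b - 1 / (a + b) = q a b" if "a \<noteq> 0" "b \<noteq> 0" "a + b \<noteq> 0" for a b :: real
    using that unfolding q_def by (simp add: divide_simps power2_eq_square) algebra
  have inv: "1 / \<alpha> = 1 / x1 + 1 / y1" "1 / \<beta> = 1 / x2 + 1 / y2" "1 / \<delta> = 1 / x3 + 1 / y3"
    unfolding al s3_def using nz sz by (auto simp: s1_def s2_def x3_def y3_def divide_simps)
  have "1 / \<alpha> + 1 / \<beta> - 1 / \<delta> = q x1 x2 + q y1 y2"
    using q[of x1 x2] q[of y1 y2] nz unfolding inv x3_def y3_def by auto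
  moreover have "(\<delta> - \<beta>) / \<alpha> + (\<delta> - \<alpha>) / \<beta> + (\<alpha> + \<beta>) / \<delta> = 3 + e * (1 / \<alpha> + 1 / \<beta> - 1 / \<delta>)"
    unfolding e_def using ne by (simp add: field_simps)
  ultimately have "(\<delta> - \<beta>) / \<alpha> + (\<delta> - \<alpha>) / \<beta> + (\<alpha> + \<beta>) / \<delta>
      = 3 + (x1 * y2 - x2 * y1)\<^sup>2 * ((q x1 x2 + q y1 y2) / (s1 * s2 * s3))"
    by (simp add: e)
  moreover have "0 < (q x1 x2 + q y1 y2) / (s1 * s2 * s3)"
  proof -
    have qq: "0 < q a b / (s1 * s2 * s3)" if "0 < a * s1" "0 < b * s2" "0 < (a + b) * s3" for a b
    proof -
      have ab: "a \<noteq> 0" using that by auto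
      have "0 < (a\<^sup>2 + a * b + b\<^sup>2)"
      proof -
        have "a\<^sup>2 + a * b + b\<^sup>2 = (b + a / 2)\<^sup>2 + 3 / 4 * a\<^sup>2" by (simp add: power2_eq_square algebra_simps)
        then show ?thesis using ab by (simp add: add_nonneg_pos)
      qed
      moreover have "0 < (a * s1) * (b * s2) * ((a + b) * s3)" using that by simp
      ultimately show ?thesis unfolding q_def by (simp add: mult_ac)
    qed
    show ?thesis
      using qq[of x1 x2] qq[of y1 y2] xs unfolding x3_def y3_def add_divide_distrib by (simp add: add_pos_pos)
  qed
  ultimately show ?thesis using that by blast
qed

text \<open>The infinite value for \<open>p \<le> 0\<close> charges points that X or Y fails to
  separate. For \<open>p > 0\<close> the real expression is nonnegative, so \<open>ennreal\<close>
  truncates nothing.\<close>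

definition pair_cost :: "real \<Rightarrow> ennreal" where
  "pair_cost p = (if p \<le> 0 then \<infinity> else ennreal (p / 2 - ln p))"

lemma pair_cost_measurable[measurable]: "pair_cost \<in> borel_measurable borel"
  unfolding pair_cost_def[abs_def] by measurable

text \<open>Leaves \<open>p / 2 - ln p\<close> at least \<open>p / 4 - 1\<close>, so a bound on the
  energy controls the bilinear part and, in the compactness argument, the size of the
  increments.\<close>

lemma ln_le_quarter: "0 < p \<Longrightarrow> ln p \<le> p / 4 + 1" for p :: real
proof -
  assume p: "0 < p"
  have "ln (p / 4) \<le> p / 4 - 1" using p by (intro ln_le_minus_one) auto
  moreover have "ln (4::real) \<le> 2"
  proof -
    have "ln (2::real) \<le> 1" using ln_le_minus_one[of 2] by simp
    moreover have "ln (4::real) = ln 2 + ln 2" using ln_mult[of 2 2] by simp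
    ultimately show ?thesis by simp
  qed
  ultimately show ?thesis using p by (simp add: ln_div)
qed

lemma pair_cost_nonneg: "0 < p \<Longrightarrow> 0 \<le> p / 2 - ln p" for p :: real
proof -
  assume p: "0 < p"
  have "ln (p / 2) \<le> p / 2 - 1" using p by (intro ln_le_minus_one) auto
  moreover have "ln (2::real) \<le> 1" using ln_le_minus_one[of 2] by simp
  ultimately show ?thesis using p by (simp add: ln_div)
qed

text \<open>The expansion of the cost when x moves by \<open>t * (k - x)\<close> and y by
  \<open>t * k\<close>. Negative terms are moved across the equality and \<open>2 * t\<close> is
  added to the logarithms, so that every summand is nonnegative and the identity can be integrated
  term by term in \<open>ennreal\<close>.\<close>

lemma pair_cost_perturb:
  assumes t: "0 < t" "t \<le> 1 / 2" and xy: "0 < x * y" and k: "0 \<le> k * x" "0 \<le> k * y"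
  shows "pair_cost (((1 - t) * x + t * k) * (y + t * k))
      + (ennreal (ln (1 - t + t * (k / x)) + ln (1 + t * (k / y)) + 2 * t) + ennreal (t / 2 * (x * y) + t\<^sup>2 / 2 * (k * x)))
    = pair_cost (x * y) + (ennreal (2 * t) + (ennreal (t / 2) * ennreal (k * (x + y)) + ennreal (t\<^sup>2 / 2 * k\<^sup>2)))"
  (is "pair_cost ?q + (ennreal ?L + ennreal ?R) = _")
    and "0 \<le> ln (1 - t + t * (k / x)) + ln (1 + t * (k / y)) + 2 * t"
proof -
  have nz: "x \<noteq> 0" "y \<noteq> 0" using xy by auto
  have kx: "0 \<le> k / x" "0 \<le> k / y"
    using k by (auto simp: zero_le_mult_iff zero_le_divide_iff)
  have tk: "0 \<le> t * (k / x)" "0 \<le> t * (k / y)" using t kx by (intro mult_nonneg_nonneg; simp)+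
  have a: "0 < 1 - t + t * (k / x)" "1 \<le> 1 + t * (k / y)" using t tk by linarith+
  have q: "?q = x * y * ((1 - t + t * (k / x)) * (1 + t * (k / y)))"
    using nz by (simp add: field_simps)
  have qp: "0 < ?q" unfolding q using a xy by auto
  have lq: "ln ?q = ln (x * y) + (ln (1 - t + t * (k / x)) + ln (1 + t * (k / y)))"
    unfolding q using a xy by (simp add: ln_mult_pos)
  \<comment> \<open>For \<open>t \<le> 1 / 2\<close> this lower bound is at least
    \<open>- 2 * t\<close>, which is what the added \<open>2 * t\<close> compensates.\<close>
  have "- t - 2 * t\<^sup>2 \<le> ln (1 - t)" using t by (intro ln_one_minus_pos_lower_bound) auto
  moreover have "2 * t\<^sup>2 \<le> t" using t by (simp add: power2_eq_square)
  moreover have "ln (1 - t) \<le> ln (1 - t + t * (k / x))" using t a tk by (subst ln_le_cancel_iff) linarith+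
  moreover have "0 \<le> ln (1 + t * (k / y))" using a by (intro ln_ge_zero) auto
  ultimately show L: "0 \<le> ?L" by linarith
  have "0 \<le> t / 2 * (x * y)" "0 \<le> t\<^sup>2 / 2 * (k * x)" using t less_imp_le[OF xy] k(1) by (metis mult_nonneg_nonneg zero_le_divide_iff zero_le_numeral zero_le_power2 less_imp_le)+
  then have R: "0 \<le> ?R" by linarith
  have kxy: "0 \<le> k * (x + y)" using k by (simp add: algebra_simps)
  have id: "(?q / 2 - ln ?q) + (?L + ?R)
    = (x * y / 2 - ln (x * y)) + (2 * t + (t / 2 * (k * (x + y)) + t\<^sup>2 / 2 * k\<^sup>2))"
    unfolding lq by (simp add: power2_eq_square field_simps)
  show "pair_cost ?q + (ennreal ?L + ennreal ?R) = pair_cost (x * y) + (ennreal (2 * t) + (ennreal (t / 2) * ennreal (k * (x + y)) + ennreal (t\<^sup>2 / 2 * k\<^sup>2)))"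
    using qp xy pair_cost_nonneg[OF qp] pair_cost_nonneg[OF xy] L R t kxy id
    by (simp add: pair_cost_def ennreal_plus[symmetric] ennreal_mult'[symmetric] del: ennreal_plus)
qed

section \<open>Perturbation of a minimiser\<close>

text \<open>Without atoms, a nondecreasing function is continuous almost everywhere. Positive mass
  of intervals turns energy bounds into pointwise bounds. The reference space is the whole line
  because that is the domain of the functions in \<open>Helly_selection\<close>.\<close>

locale reference_measure = real_distribution M for M :: "real measure" +
  assumes no_atoms: "emeasure M {x} = 0"
    and interval_pos: "a < b \<Longrightarrow> 0 < emeasure M {a<..<b}"
begin

sublocale pair: pair_sigma_finite M M ..

lemma emeasure_UNIV[simp]: "emeasure M UNIV = 1" and prob_UNIV[simp]: "prob UNIV = 1"
  using emeasure_space_1 prob_space by simp_all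

definition energy :: "(real \<Rightarrow> real) \<Rightarrow> (real \<Rightarrow> real) \<Rightarrow> ennreal" where
  "energy X Y = dint M (\<lambda>u w. pair_cost ((X u - X w) * (Y u - Y w)))"

lemma nn_integral_swap:
  assumes [measurable]: "F \<in> borel_measurable (M \<Otimes>\<^sub>M M)"
  shows "dint M (\<lambda>u w. F (u, w)) = dint M (\<lambda>u w. F (w, u))"
  by (rule pair.Fubini'[symmetric]) simp

lemma nn_integral_swap_inner:
  assumes [measurable]: "F \<in> borel_measurable (M \<Otimes>\<^sub>M M \<Otimes>\<^sub>M M)"
  shows "dint M (\<lambda>u w. \<integral>\<^sup>+z. F (u, z, w) \<partial>M) = dint M (\<lambda>u w. \<integral>\<^sup>+z. F (u, w, z) \<partial>M)"
  by (intro nn_integral_cong nn_integral_swap[where F = "\<lambda>(z, w). F (_, w, z)", simplified split]) measurable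

lemma nn_integral_rotate:
  assumes [measurable]: "F \<in> borel_measurable (M \<Otimes>\<^sub>M M \<Otimes>\<^sub>M M)"
  shows "dint M (\<lambda>u w. \<integral>\<^sup>+z. F (w, z, u) \<partial>M) = dint M (\<lambda>u w. \<integral>\<^sup>+z. F (u, w, z) \<partial>M)"
proof -
  have "dint M (\<lambda>u w. \<integral>\<^sup>+z. F (w, z, u) \<partial>M) = dint M (\<lambda>w u. \<integral>\<^sup>+z. F (w, z, u) \<partial>M)"
    by (rule nn_integral_swap[where F = "\<lambda>(u, w). \<integral>\<^sup>+z. F (w, z, u) \<partial>M", simplified split]) measurable
  also have "\<dots> = dint M (\<lambda>u w. \<integral>\<^sup>+z. F (u, w, z) \<partial>M)"
    by (rule nn_integral_swap_inner) fact
  finally show ?thesis .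
qed

lemma ennreal_add_thrice: "a + a + a = 3 * a" for a :: ennreal
proof -
  have "3 * a = (2 + 1) * a" by simp
  also have "\<dots> = 2 * a + 1 * a" by (rule distrib_right)
  finally show ?thesis by (simp only: mult_2 mult_1)
qed

text \<open>Three of the six orders suffice: the integrands to which this is applied are symmetric
  in their first two points.\<close>

lemma nn_integral_cyclic_sum:
  assumes [measurable]: "F \<in> borel_measurable (M \<Otimes>\<^sub>M M \<Otimes>\<^sub>M M)"
  shows "dint M (\<lambda>u w. \<integral>\<^sup>+z. F (u, w, z) + F (w, z, u) + F (u, z, w) \<partial>M)
    = 3 * (dint M (\<lambda>u w. \<integral>\<^sup>+z. F (u, w, z) \<partial>M))"
proof -
  have "dint M (\<lambda>u w. \<integral>\<^sup>+z. F (u, w, z) + F (w, z, u) + F (u, z, w) \<partial>M)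
    = (dint M (\<lambda>u w. \<integral>\<^sup>+z. F (u, w, z) \<partial>M)) + (dint M (\<lambda>u w. \<integral>\<^sup>+z. F (w, z, u) \<partial>M))
      + (dint M (\<lambda>u w. \<integral>\<^sup>+z. F (u, z, w) \<partial>M))"
    by (simp add: nn_integral_add)
  also have "\<dots> = 3 * (dint M (\<lambda>u w. \<integral>\<^sup>+z. F (u, w, z) \<partial>M))"
    unfolding nn_integral_rotate[OF assms] nn_integral_swap_inner[OF assms] by (rule ennreal_add_thrice)
  finally show ?thesis .
qed

lemma cosigned_mono: "mono X \<Longrightarrow> mono Y \<Longrightarrow> cosigned (X u - X w) (Y u - Y w)" for X Y :: "real \<Rightarrow> real"
  unfolding cosigned_def using monoD[of X u w] monoD[of X w u] monoD[of Y u w] monoD[of Y w u] linear[of u w] by auto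

lemma energy_finite_AE:
  assumes [measurable]: "X \<in> borel_measurable borel" "Y \<in> borel_measurable borel" and "energy X Y < \<infinity>"
  shows "AE u in M. AE w in M. 0 < (X u - X w) * (Y u - Y w)"
proof -
  have "AE u in M. (\<integral>\<^sup>+w. pair_cost ((X u - X w) * (Y u - Y w)) \<partial>M) \<noteq> \<infinity>"
  proof (rule nn_integral_PInf_AE)
    show "(\<lambda>u. \<integral>\<^sup>+w. pair_cost ((X u - X w) * (Y u - Y w)) \<partial>M) \<in> borel_measurable M" by measurable
    show "(dint M (\<lambda>u w. pair_cost ((X u - X w) * (Y u - Y w)))) \<noteq> \<infinity>"
      using assms(3) unfolding energy_def by (metis less_irrefl)
  qed
  then show ?thesis
  proof eventually_elim
    case (elim u)
    then have "AE w in M. pair_cost ((X u - X w) * (Y u - Y w)) \<noteq> \<infinity>"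
      by (intro nn_integral_PInf_AE) measurable
    then show ?case
    proof eventually_elim
      case (elim w)
      then show ?case by (metis pair_cost_def not_less)
    qed
  qed
qed

end

section \<open>The averaged parallel sum as a direction of variation\<close>

locale mono_pair = reference_measure +
  fixes X Y :: "real \<Rightarrow> real"
  assumes monoX: "mono X" and monoY: "mono Y"
begin

lemma measX[measurable]: "X \<in> borel_measurable borel"
  and measY[measurable]: "Y \<in> borel_measurable borel"
  by (rule borel_measurable_mono[OF monoX] borel_measurable_mono[OF monoY])+

definition h :: "real \<Rightarrow> real \<Rightarrow> real" where
  "h u z = par (X u - X z) (Y u - Y z)"

lemma h_measurable'[measurable (raw)]:
  assumes f: "f \<in> borel_measurable N" and g: "g \<in> borel_measurable N"
  shows "(\<lambda>x. h (f x) (g x)) \<in> borel_measurable N"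
proof -
  have [measurable]: "(\<lambda>x. X (f x)) \<in> borel_measurable N" "(\<lambda>x. X (g x)) \<in> borel_measurable N"
    "(\<lambda>x. Y (f x)) \<in> borel_measurable N" "(\<lambda>x. Y (g x)) \<in> borel_measurable N"
    by (rule measurable_compose[OF f measX] measurable_compose[OF g measX] measurable_compose[OF f measY] measurable_compose[OF g measY])+
  show ?thesis unfolding h_def par_def by measurable
qed

lemma h_skew: "h z u = - h u z"
  unfolding h_def using par_minus[of "X u - X z" "Y u - Y z"] by simp

lemma h_bounds:
  assumes "w \<le> u"
  shows "0 \<le> h u z - h w z" "h u z - h w z \<le> (X u - X w) + (Y u - Y w)"
  unfolding h_def
  using par_diff_bounds[OF cosigned_mono[OF monoX monoY, of w z] cosigned_mono[OF monoX monoY, of u z]]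
    monoD[OF monoX assms] monoD[OF monoY assms] by auto

text \<open>The function \<open>h u\<close> itself need not be integrable. Subtracting
  \<open>h 0\<close> makes the integrand bounded, by \<open>h_diff_bound\<close>, and only
  increments of \<open>H\<close> ever enter.\<close>

definition H :: "real \<Rightarrow> real" where
  "H u = (\<integral>z. h u z - h 0 z \<partial>M)"

lemma h_diff_bound: "\<bar>h u z - h w z\<bar> \<le> \<bar>X u - X w\<bar> + \<bar>Y u - Y w\<bar>"
  using h_bounds[of w u z] h_bounds[of u w z] by (cases "w \<le> u") auto

lemma h_diff_integrable: "integrable M (\<lambda>z. h u z - h w z)"
  by (rule integrable_const_bound[where B = "\<bar>X u - X w\<bar> + \<bar>Y u - Y w\<bar>"]) (auto simp: h_diff_bound)

lemma H_diff: "H u - H w = (\<integral>z. h u z - h w z \<partial>M)"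
  unfolding H_def by (subst Bochner_Integration.integral_diff[symmetric]) (auto intro: h_diff_integrable)

lemma H_diff_bounds:
  assumes "w \<le> u"
  shows "0 \<le> H u - H w" "H u - H w \<le> (X u - X w) + (Y u - Y w)"
proof -
  show "0 \<le> H u - H w" unfolding H_diff using h_bounds[OF assms] by (intro Bochner_Integration.integral_nonneg) auto
  have "(\<integral>z. h u z - h w z \<partial>M) \<le> (\<integral>z. (X u - X w) + (Y u - Y w) \<partial>M)"
    using h_bounds[OF assms] by (intro integral_mono h_diff_integrable) auto
  then show "H u - H w \<le> (X u - X w) + (Y u - Y w)"
    unfolding H_diff by simp
qed

lemma monoH: "mono H"
proof (rule monoI)
  show "H u \<le> H w" if "u \<le> w" for u w using H_diff_bounds(1)[OF that] by simp
qed

lemma measH[measurable]: "H \<in> borel_measurable borel"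
  using monoH by (rule borel_measurable_mono)

text \<open>Applied with \<open>c = V u - V w\<close> and \<open>c = 1 / h u w\<close>. Both have
  the sign of \<open>u - w\<close>, as has \<open>h u z - h w z\<close>, so the product is
  nonnegative and the average over z passes into \<open>ennreal\<close>.\<close>

lemma H_diff_nn_integral:
  assumes "w \<le> u \<Longrightarrow> 0 \<le> c" "u \<le> w \<Longrightarrow> c \<le> 0"
  shows "ennreal ((H u - H w) * c) = (\<integral>\<^sup>+z. ennreal ((h u z - h w z) * c) \<partial>M)"
proof -
  have nn: "0 \<le> (h u z - h w z) * c" for z
  proof (cases "w \<le> u")
    case True
    then show ?thesis using h_bounds(1)[of w u z] assms(1) by (intro mult_nonneg_nonneg)
  next
    case False
    then show ?thesis using h_bounds(1)[of u w z] assms(2) by (intro mult_nonpos_nonpos) auto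
  qed
  have "(H u - H w) * c = (\<integral>z. (h u z - h w z) * c \<partial>M)"
    unfolding H_diff by simp
  moreover have "(\<integral>\<^sup>+z. ennreal ((h u z - h w z) * c) \<partial>M) = ennreal (\<integral>z. (h u z - h w z) * c \<partial>M)"
    using nn by (intro nn_integral_eq_integral integrable_mult_left h_diff_integrable) auto
  ultimately show ?thesis by (simp only:)
qed

text \<open>The denominator of \<open>par\<close> clears even when it vanishes, because cosigned
  increments with sum 0 are both 0.\<close>

lemma h_mult_sum: "h u z * ((X u - X z) + (Y u - Y z)) = (X u - X z) * (Y u - Y z)"
proof (cases "(X u - X z) + (Y u - Y z) = 0")
  case True
  then have "X u - X z = 0"
    using cosigned_mono[OF monoX monoY, of u z] by (auto simp: cosigned_def)
  then show ?thesis by (simp add: h_def par_def)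
qed (simp add: h_def par_def)

lemma xy_nonneg: "0 \<le> (X u - X w) * (Y u - Y w)"
  using cosigned_mono[OF monoX monoY, of u w] by (auto simp: cosigned_def intro: mult_nonpos_nonpos)

abbreviation V :: "real \<Rightarrow> real" where "V u \<equiv> X u + Y u"

lemma monoV: "mono V"
  using monoX monoY by (auto simp: mono_def intro: add_mono)

text \<open>The first variation of the bilinear part of the energy vanishes along the perturbation:
  symmetrise the triple integral.\<close>
lemma nn_integral_H_V:
  "dint M (\<lambda>u w. ennreal ((H u - H w) * (V u - V w))) = dint M (\<lambda>u w. ennreal ((X u - X w) * (Y u - Y w)))"
proof -
  define F where "F = (\<lambda>(u, w, z). ennreal ((h u z - h w z) * (V u - V w)))"
  define G where "G = (\<lambda>(u, w, z :: real). ennreal ((X u - X w) * (Y u - Y w)))"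
  have [measurable]: "F \<in> borel_measurable (M \<Otimes>\<^sub>M M \<Otimes>\<^sub>M M)" "G \<in> borel_measurable (M \<Otimes>\<^sub>M M \<Otimes>\<^sub>M M)"
    unfolding F_def G_def by measurable
  have Fnn: "0 \<le> (h u z - h w z) * (V u - V w)" for u w z
  proof (cases "w \<le> u")
    case True
    then show ?thesis using h_bounds(1)[of w u z] monoD[OF monoV, of w u] by (intro mult_nonneg_nonneg) auto
  next
    case False
    then show ?thesis using h_bounds(1)[of u w z] monoD[OF monoV, of u w] by (intro mult_nonpos_nonpos) auto
  qed
  have eq: "F (u, w, z) + F (w, z, u) + F (u, z, w) = G (u, w, z) + G (w, z, u) + G (u, z, w)" for u w z
  proof -
    \<comment> \<open>By skew symmetry, the two occurrences of each of \<open>h u w\<close>,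
      \<open>h w z\<close> and \<open>h u z\<close> merge their factors into a single increment of
      \<open>V\<close>; \<open>h_mult_sum\<close> then turns each product into an increment of X
      times one of Y.\<close>
    have *: "h u z * (V u - V w) - h w z * (V u - V w) + (h w u * (V w - V z) - h z u * (V w - V z))
      + (h u w * (V u - V z) - h z w * (V u - V z))
      = h u w * (V u - V w) + h w z * (V w - V z) + h u z * (V u - V z)"
      unfolding h_skew[of w u] h_skew[of z u] h_skew[of z w] by (simp add: algebra_simps)
    have **: "h u w * (V u - V w) = (X u - X w) * (Y u - Y w)" for u w
      using h_mult_sum[of u w] by (simp add: algebra_simps)
    show ?thesis
      unfolding F_def G_def split
      using * Fnn xy_nonneg unfolding **
      by (simp add: ennreal_plus[symmetric] left_diff_distrib del: ennreal_plus)
  qed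
  have "dint M (\<lambda>u w. \<integral>\<^sup>+z. F (u, w, z) \<partial>M) = dint M (\<lambda>u w. \<integral>\<^sup>+z. G (u, w, z) \<partial>M)"
    using nn_integral_cyclic_sum[of F] nn_integral_cyclic_sum[of G] unfolding eq
    by (simp add: ennreal_mult_cancel_left)
  moreover have "ennreal ((H u - H w) * (V u - V w)) = (\<integral>\<^sup>+z. F (u, w, z) \<partial>M)" for u w
    unfolding F_def split using monoD[OF monoV, of w u] monoD[OF monoV, of u w]
    by (intro H_diff_nn_integral) auto
  ultimately show ?thesis
    by (simp add: G_def)
qed

lemma H_diff_mult:
  shows "0 \<le> (H u - H w) * (X u - X w)" "0 \<le> (H u - H w) * (Y u - Y w)"
    "(H u - H w)\<^sup>2 \<le> (H u - H w) * (V u - V w)"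
    "(H u - H w) * (X u - X w) \<le> (H u - H w) * (V u - V w)"
proof -
  have *: "0 \<le> (H u - H w) * (X u - X w) \<and> 0 \<le> (H u - H w) * (Y u - Y w)
    \<and> (H u - H w)\<^sup>2 \<le> (H u - H w) * (V u - V w)
    \<and> (H u - H w) * (X u - X w) \<le> (H u - H w) * (V u - V w)" if "w \<le> u" for u w
    using H_diff_bounds[OF that] monoD[OF monoX that] monoD[OF monoY that]
    by (auto simp: power2_eq_square intro!: mult_left_mono)
  have sw: "(H u - H w) * (f u - f w) = (H w - H u) * (f w - f u)" for f :: "real \<Rightarrow> real"
    by algebra
  have sw2: "(H u - H w)\<^sup>2 = (H w - H u)\<^sup>2" by (rule power2_commute)
  show "0 \<le> (H u - H w) * (X u - X w)" "0 \<le> (H u - H w) * (Y u - Y w)"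
    "(H u - H w)\<^sup>2 \<le> (H u - H w) * (V u - V w)"
    "(H u - H w) * (X u - X w) \<le> (H u - H w) * (V u - V w)"
    using *[of w u] *[of u w] unfolding sw[of X] sw[of Y] sw[of V] sw2 by (meson linear)+
qed


text \<open>Dividing the energy inequality along the perturbation by the step \<open>t\<close> and letting \<open>t\<close> tend to 0,
  the quadratic terms disappear and Fatou's lemma controls the logarithmic ones.\<close>
lemma minimiser_variation:
  assumes fin: "energy X Y < \<infinity>"
    and min: "\<And>X' Y'. mono X' \<Longrightarrow> mono Y' \<Longrightarrow> energy X Y \<le> energy X' Y'"
    and Bfin: "(dint M (\<lambda>u w. ennreal ((X u - X w) * (Y u - Y w)))) < \<infinity>"
  shows "dint M (\<lambda>u w. ennreal ((H u - H w) / h u w)) \<le> 1"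
proof -
  define B where "B = dint M (\<lambda>u w. ennreal ((X u - X w) * (Y u - Y w)))"
  define L where "L t u w = ln (1 - t + t * ((H u - H w) / (X u - X w))) + ln (1 + t * ((H u - H w) / (Y u - Y w))) + 2 * t" for t u w
  have [measurable]: "(\<lambda>(u, w). L t u w) \<in> borel_measurable (M \<Otimes>\<^sub>M M)" for t
    unfolding L_def by measurable
  have AEpos: "AE u in M. AE w in M. 0 < (X u - X w) * (Y u - Y w)"
    by (rule energy_finite_AE[OF measX measY fin])
  have step: "dint M (\<lambda>u w. ennreal (L t u w)) \<le> ennreal (2 * t) + ennreal (t\<^sup>2 / 2) * B"
    if t: "0 < t" "t \<le> 1 / 2" for t
  proof -
    define Xt where "Xt u = (1 - t) * X u + t * H u" for u
    define Yt where "Yt u = Y u + t * H u" for u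
    have mono: "mono Xt" "mono Yt"
      unfolding Xt_def Yt_def using t monoX monoY monoH
      by (auto simp: mono_def intro!: add_mono mult_left_mono)
    have [measurable]: "Xt \<in> borel_measurable borel" "Yt \<in> borel_measurable borel"
      using mono by (auto intro: borel_measurable_mono)
    define R where "R u w = t / 2 * ((X u - X w) * (Y u - Y w)) + t\<^sup>2 / 2 * ((H u - H w) * (X u - X w))" for u w
    have [measurable]: "(\<lambda>(u, w). R u w) \<in> borel_measurable (M \<Otimes>\<^sub>M M)"
      unfolding R_def by measurable
    have "AE u in M. AE w in M. pair_cost ((Xt u - Xt w) * (Yt u - Yt w)) + (ennreal (L t u w) + ennreal (R u w))
      = pair_cost ((X u - X w) * (Y u - Y w)) + (ennreal (2 * t) + (ennreal (t / 2) * ennreal ((H u - H w) * (V u - V w)) + ennreal (t\<^sup>2 / 2 * (H u - H w)\<^sup>2)))"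
      using AEpos
    proof eventually_elim
      case (elim u)
      then show ?case
      proof eventually_elim
        case (elim w)
        have e: "Xt u - Xt w = (1 - t) * (X u - X w) + t * (H u - H w)" "Yt u - Yt w = (Y u - Y w) + t * (H u - H w)"
          "V u - V w = (X u - X w) + (Y u - Y w)"
          unfolding Xt_def Yt_def by (simp_all add: algebra_simps)
        show ?case
          unfolding e L_def R_def
          by (rule pair_cost_perturb(1)[OF t elim H_diff_mult(1,2)])
      qed
    qed
    then have "dint M (\<lambda>u w. pair_cost ((Xt u - Xt w) * (Yt u - Yt w)) + (ennreal (L t u w) + ennreal (R u w)))
      = dint M (\<lambda>u w. pair_cost ((X u - X w) * (Y u - Y w)) + (ennreal (2 * t) + (ennreal (t / 2) * ennreal ((H u - H w) * (V u - V w)) + ennreal (t\<^sup>2 / 2 * (H u - H w)\<^sup>2))))"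
      by (rule dint_cong_AE)
    then have "energy Xt Yt + ((dint M (\<lambda>u w. ennreal (L t u w))) + (dint M (\<lambda>u w. ennreal (R u w))))
      = energy X Y + (ennreal (2 * t) + (ennreal (t / 2) * B + (dint M (\<lambda>u w. ennreal (t\<^sup>2 / 2 * (H u - H w)\<^sup>2)))))"
      unfolding energy_def B_def nn_integral_H_V[symmetric]
      by (simp add: nn_integral_add nn_integral_cmult)
    moreover have "energy X Y \<le> energy Xt Yt"
      using mono by (rule min)
    ultimately have "energy X Y + ((dint M (\<lambda>u w. ennreal (L t u w))) + (dint M (\<lambda>u w. ennreal (R u w))))
      \<le> energy X Y + (ennreal (2 * t) + (ennreal (t / 2) * B + (dint M (\<lambda>u w. ennreal (t\<^sup>2 / 2 * (H u - H w)\<^sup>2)))))"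
      by (metis add_right_mono)
    then have "(dint M (\<lambda>u w. ennreal (L t u w))) + (dint M (\<lambda>u w. ennreal (R u w)))
      \<le> ennreal (2 * t) + (ennreal (t / 2) * B + (dint M (\<lambda>u w. ennreal (t\<^sup>2 / 2 * (H u - H w)\<^sup>2))))"
      using fin by (subst (asm) ennreal_add_left_cancel_le) auto
    \<comment> \<open>Increments of \<open>H\<close> are dominated by those of \<open>V\<close>, so
      the quadratic remainder is of order \<open>t^2\<close> times the finite
      \<open>B\<close>.\<close>
    moreover have "dint M (\<lambda>u w. ennreal (t\<^sup>2 / 2 * (H u - H w)\<^sup>2)) \<le> ennreal (t\<^sup>2 / 2) * B"
    proof -
      have "dint M (\<lambda>u w. ennreal (t\<^sup>2 / 2 * (H u - H w)\<^sup>2)) \<le> dint M (\<lambda>u w. ennreal (t\<^sup>2 / 2) * ennreal ((H u - H w) * (V u - V w)))"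
        by (intro nn_integral_mono) (auto simp: ennreal_mult'[symmetric] intro!: ennreal_leI mult_left_mono H_diff_mult)
      then show ?thesis by (simp add: nn_integral_cmult nn_integral_H_V B_def)
    qed
    \<comment> \<open>Dropping the nonnegative quadratic part of \<open>R\<close> leaves exactly the
      first-order bilinear term found on the right by \<open>nn_integral_H_V\<close>; the two cancel
      because \<open>B\<close> is finite.\<close>
    moreover have "ennreal (t / 2) * B \<le> dint M (\<lambda>u w. ennreal (R u w))"
    proof -
      have "ennreal (t / 2) * B = dint M (\<lambda>u w. ennreal (t / 2) * ennreal ((X u - X w) * (Y u - Y w)))"
        unfolding B_def by (simp add: nn_integral_cmult)
      also have "\<dots> \<le> dint M (\<lambda>u w. ennreal (R u w))"
        unfolding R_def using t
        by (intro nn_integral_mono) (auto simp: ennreal_mult'[symmetric] intro!: ennreal_leI mult_nonneg_nonneg H_diff_mult)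
      finally show ?thesis .
    qed
    ultimately have "(dint M (\<lambda>u w. ennreal (L t u w))) + ennreal (t / 2) * B
      \<le> ennreal (2 * t) + (ennreal (t / 2) * B + ennreal (t\<^sup>2 / 2) * B)"
      by (meson add_mono order_refl order_trans)
    then have "ennreal (t / 2) * B + (dint M (\<lambda>u w. ennreal (L t u w)))
      \<le> ennreal (t / 2) * B + (ennreal (2 * t) + ennreal (t\<^sup>2 / 2) * B)"
      by (simp add: ac_simps)
    moreover have "ennreal (t / 2) * B \<noteq> \<infinity>"
      using Bfin unfolding B_def[symmetric] by (simp add: ennreal_mult_eq_top_iff less_top)
    ultimately show ?thesis
      by (subst (asm) ennreal_add_left_cancel_le) auto
  qed
  \<comment> \<open>The shift by 2 keeps all steps at most 1/2, as \<open>step\<close>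
    requires.\<close>
  define s where "s n = 1 / (real n + 2)" for n
  have s: "0 < s n" "s n \<le> 1 / 2" for n by (auto simp: s_def field_simps)
  have s0: "s \<longlonglongrightarrow> 0" unfolding s_def by real_asymp
  define Q where "Q n u w = ennreal (1 / s n) * ennreal (L (s n) u w)" for n u w
  have [measurable]: "(\<lambda>(u, w). Q n u w) \<in> borel_measurable (M \<Otimes>\<^sub>M M)" for n
    unfolding Q_def by measurable
  have Qint: "dint M (\<lambda>u w. Q n u w) \<le> 2 + ennreal (s n / 2) * B" for n
  proof -
    have "dint M (\<lambda>u w. Q n u w) = ennreal (1 / s n) * (dint M (\<lambda>u w. ennreal (L (s n) u w)))"
      unfolding Q_def by (simp add: nn_integral_cmult)
    also have "\<dots> \<le> ennreal (1 / s n) * (ennreal (2 * s n) + ennreal ((s n)\<^sup>2 / 2) * B)"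
      by (intro mult_left_mono step s) auto
    also have "\<dots> = ennreal (1 / s n) * ennreal (2 * s n) + (ennreal (1 / s n) * ennreal ((s n)\<^sup>2 / 2)) * B"
      by (simp only: distrib_left mult.assoc)
    also have "\<dots> = ennreal (1 / s n * (2 * s n)) + ennreal (1 / s n * ((s n)\<^sup>2 / 2)) * B"
      using s(1)[of n] by (subst (1 2) ennreal_mult[symmetric]) auto
    also have "\<dots> = 2 + ennreal (s n / 2) * B"
      using s(1)[of n] by (simp add: power2_eq_square)
    finally show ?thesis .
  qed
  \<comment> \<open>The two slopes add up to the increment of \<open>H\<close> over
    \<open>h\<close>, since \<open>1 / h = 1 / x + 1 / y\<close>. The extra 1 is 2 from the added
    \<open>2 * t\<close> less 1 from the factor \<open>1 - t\<close>.\<close>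
  have lim: "(\<lambda>n. Q n u w) \<longlonglongrightarrow> ennreal ((H u - H w) / h u w) + 1"
    if pos: "0 < (X u - X w) * (Y u - Y w)" for u w
  proof -
    define a where "a = (H u - H w) / (X u - X w)"
    define b where "b = (H u - H w) / (Y u - Y w)"
    have ab: "0 \<le> a" "0 \<le> b"
      using H_diff_mult(1,2)[of u w] by (auto simp: a_def b_def zero_le_mult_iff zero_le_divide_iff)
    have nz: "X u - X w \<noteq> 0" "Y u - Y w \<noteq> 0" "(X u - X w) + (Y u - Y w) \<noteq> 0"
      using same_sign_cases[OF pos] by auto
    have hab: "(H u - H w) / h u w = a + b"
      unfolding h_def par_def a_def b_def using nz by (simp add: field_simps)
    have d1: "((\<lambda>t. ln (1 - t + t * a) + ln (1 + t * b) + 2 * t) has_real_derivative (a + b + 1)) (at 0)"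
      by (auto intro!: derivative_eq_intros)
    then have "((\<lambda>t. (ln (1 - t + t * a) + ln (1 + t * b) + 2 * t) / t) \<longlongrightarrow> a + b + 1) (at 0)"
      by (simp add: has_field_derivative_iff)
    moreover have "filterlim s (at 0) sequentially"
      using s0 s(1) by (intro filterlim_atI) (auto simp: less_imp_neq[THEN not_sym])
    ultimately have "(\<lambda>n. L (s n) u w / s n) \<longlonglongrightarrow> a + b + 1"
      unfolding L_def a_def[symmetric] b_def[symmetric] by (rule filterlim_compose)
    then have "(\<lambda>n. ennreal (L (s n) u w / s n)) \<longlonglongrightarrow> ennreal (a + b + 1)"
      by (rule tendsto_ennrealI)
    moreover have "Q n u w = ennreal (L (s n) u w / s n)" for n
      unfolding Q_def using s(1)[of n] by (simp add: ennreal_mult'[symmetric])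
    ultimately show ?thesis
      using ab by (simp add: hab)
  qed
  have "dint M (\<lambda>u w. ennreal ((H u - H w) / h u w) + 1) = dint M (\<lambda>u w. liminf (\<lambda>n. Q n u w))"
    using AEpos
    by (intro dint_cong_AE) (auto elim!: eventually_mono intro!: lim_imp_Liminf[symmetric] lim)
  also have "\<dots> \<le> liminf (\<lambda>n. dint M (Q n))"
    by (rule dint_liminf) measurable
  also have "\<dots> \<le> liminf (\<lambda>n. 2 + ennreal (s n / 2) * B)"
    by (intro Liminf_mono always_eventually allI Qint)
  also have "\<dots> = 2"
  proof (rule lim_imp_Liminf)
    have "(\<lambda>n. B * ennreal (s n / 2)) \<longlonglongrightarrow> B * ennreal (0 / 2)"
      using Bfin unfolding B_def[symmetric] infinity_ennreal_def
      by (intro ennreal_tendsto_cmult tendsto_ennrealI tendsto_divide s0 tendsto_const) auto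
    then have "(\<lambda>n. 2 + B * ennreal (s n / 2)) \<longlonglongrightarrow> 2 + B * ennreal (0 / 2)"
      by (intro tendsto_add tendsto_const)
    then show "(\<lambda>n. 2 + ennreal (s n / 2) * B) \<longlonglongrightarrow> 2" by (simp add: mult.commute)
  qed simp
  finally have "1 + (dint M (\<lambda>u w. ennreal ((H u - H w) / h u w))) \<le> 1 + 1"
    by (simp add: nn_integral_add add.commute)
  then show ?thesis
    unfolding ennreal_add_left_cancel_le by simp
qed

end

section \<open>From the variation inequality to collinearity of minimisers\<close>

context reference_measure begin

lemma AE_obtain:
  assumes "AE u in M. P u" obtains u where "P u"
  using AE_contr[of P] assms by (metis AE_I2)

lemma AE_nested_mp:
  assumes "AE u in M. AE w in M. AE z in M. P u w z" "AE u in M. AE w in M. AE z in M. Q u w z"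
    and "\<And>u w z. P u w z \<Longrightarrow> Q u w z \<Longrightarrow> R u w z"
  shows "AE u in M. AE w in M. AE z in M. R u w z"
  using assms(1,2)
proof eventually_elim
  case (elim u)
  then show ?case
  proof eventually_elim
    case (elim w)
    then show ?case by eventually_elim (rule assms(3))
  qed
qed

lemma bilinear_finite:
  assumes [measurable]: "X \<in> borel_measurable borel" "Y \<in> borel_measurable borel" and fin: "energy X Y < \<infinity>"
  shows "(dint M (\<lambda>u w. ennreal ((X u - X w) * (Y u - Y w)))) < \<infinity>"
proof -
  have "ennreal p \<le> 4 * pair_cost p + 4" for p
  proof (cases "p \<le> 0")
    case True
    then show ?thesis by (simp add: ennreal_neg)
  next
    case False
    then have p: "0 < p" by simp
    have "4 * pair_cost p + 4 = ennreal (4 * (p / 2 - ln p) + 4)"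
      using p pair_cost_nonneg[OF p] ennreal_mult[of 4 "p / 2 - ln p"] ennreal_plus[of "4 * (p / 2 - ln p)" 4]
      by (simp add: pair_cost_def)
    then show ?thesis
      using ln_le_quarter[OF p] by (simp add: ennreal_leI)
  qed
  then have "dint M (\<lambda>u w. ennreal ((X u - X w) * (Y u - Y w)))
    \<le> dint M (\<lambda>u w. 4 * pair_cost ((X u - X w) * (Y u - Y w)) + 4)"
    by (intro nn_integral_mono)
  also have "\<dots> = 4 * energy X Y + 4"
    unfolding energy_def by (simp add: nn_integral_add nn_integral_cmult)
  also have "\<dots> < \<infinity>" using fin by (simp add: ennreal_mult_less_top)
  finally show ?thesis .
qed

end

context mono_pair begin

lemma h_nonneg: "w \<le> u \<Longrightarrow> 0 \<le> h u w" and h_nonpos: "u \<le> w \<Longrightarrow> h u w \<le> 0"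
  using h_bounds(1)[of w u w] h_bounds(1)[of u w w] by (auto simp: h_def[of w w] par_def)

lemma AE_collinear:
  assumes pos: "AE u in M. AE w in M. 0 < (X u - X w) * (Y u - Y w)"
    and var: "dint M (\<lambda>u w. ennreal ((H u - H w) / h u w)) \<le> 1"
  shows "AE u in M. AE w in M. AE z in M. (X u - X w) * (Y w - Y z) = (X w - X z) * (Y u - Y w)"
proof -
  define f where "f = (\<lambda>(u, w, z). (h u z - h w z) / h u w)"
  define q where "q = (\<lambda>(u, w, z). f (u, w, z) + f (w, z, u) + f (u, z, w))"
  have [measurable]: "f \<in> borel_measurable (M \<Otimes>\<^sub>M M \<Otimes>\<^sub>M M)" unfolding f_def by measurable
  have [measurable]: "q \<in> borel_measurable (M \<Otimes>\<^sub>M M \<Otimes>\<^sub>M M)" unfolding q_def by measurable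
  have f0: "0 \<le> f (u, w, z)" for u w z
  proof (cases "w \<le> u")
    case True
    then show ?thesis unfolding f_def using h_bounds(1)[of w u z] h_nonneg by auto
  next
    case False
    then show ?thesis unfolding f_def using h_bounds(1)[of u w z] h_nonpos[of u w]
      by (auto intro: divide_nonpos_nonpos)
  qed
  have "ennreal ((H u - H w) / h u w) = (\<integral>\<^sup>+z. ennreal (f (u, w, z)) \<partial>M)" for u w
    using H_diff_nn_integral[of w u "1 / h u w"] h_nonneg[of w u] h_nonpos[of u w] by (simp add: f_def)
  then have "dint M (\<lambda>u w. \<integral>\<^sup>+z. ennreal (f (u, w, z)) \<partial>M) \<le> 1" using var by simp
  then have "3 * (dint M (\<lambda>u w. \<integral>\<^sup>+z. ennreal (f (u, w, z)) \<partial>M)) \<le> 3 * 1"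
    by (intro mult_left_mono) auto
  then have q3: "dint M (\<lambda>u w. \<integral>\<^sup>+z. ennreal (q (u, w, z)) \<partial>M) \<le> 3"
    using nn_integral_cyclic_sum[of "\<lambda>p. ennreal (f p)"] f0 by (simp add: q_def ennreal_plus)
  have pos3: "AE u in M. AE w in M. AE z in M. 0 < (X u - X w) * (Y u - Y w) \<and> 0 < (X u - X z) * (Y u - Y z) \<and> 0 < (X w - X z) * (Y w - Y z)"
  proof -
    have "AE u in M. (AE w in M. 0 < (X u - X w) * (Y u - Y w)) \<and> (AE w in M. AE z in M. 0 < (X w - X z) * (Y w - Y z))"
      using pos by auto
    then show ?thesis
    proof eventually_elim
      case (elim u)
      then have "AE w in M. 0 < (X u - X w) * (Y u - Y w) \<and> (AE z in M. 0 < (X w - X z) * (Y w - Y z)) \<and> (AE z in M. 0 < (X u - X z) * (Y u - Y z))"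
        by auto
      then show ?case by eventually_elim auto
    qed
  qed
  have qr: "\<exists>r>0. q (u, w, z) = 3 + ((X u - X w) * (Y w - Y z) - (X w - X z) * (Y u - Y w))\<^sup>2 * r"
    if p: "0 < (X u - X w) * (Y u - Y w)" "0 < (X u - X z) * (Y u - Y z)" "0 < (X w - X z) * (Y w - Y z)" for u w z
  proof -
    have p': "0 < ((X u - X w) + (X w - X z)) * ((Y u - Y w) + (Y w - Y z))" using p(2) by simp
    have *: "(X u - X w) + (X w - X z) = X u - X z" "(Y u - Y w) + (Y w - Y z) = Y u - Y z" by simp_all
    obtain r where "(h u z - h w z) / h u w + (h u z - h u w) / h w z + (h u w + h w z) / h u z
        = 3 + ((X u - X w) * (Y w - Y z) - (X w - X z) * (Y u - Y w))\<^sup>2 * r" "0 < r"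
      using par_cyclic_identity[OF p(1) p(3) p'] unfolding * h_def[symmetric] by blast
    then show ?thesis
      unfolding q_def f_def by (auto simp: h_skew[of w u] h_skew[of z u] h_skew[of z w])
  qed
  \<comment> \<open>Almost every triple has \<open>q \<ge> 3\<close>, so the integral of
    \<open>q\<close> splits into 3 and a nonnegative excess. The bound \<open>q3\<close> leaves no
    room for the excess, which is a positive multiple of the squared determinant.\<close>
  have "AE u in M. AE w in M. AE z in M. ennreal (q (u, w, z)) = 3 + ennreal (q (u, w, z) - 3)"
  proof (rule AE_nested_mp[OF pos3 pos3], elim conjE)
    fix u w z assume "0 < (X u - X w) * (Y u - Y w)" "0 < (X u - X z) * (Y u - Y z)" "0 < (X w - X z) * (Y w - Y z)"
    then obtain r where "0 < r" "q (u, w, z) = 3 + ((X u - X w) * (Y w - Y z) - (X w - X z) * (Y u - Y w))\<^sup>2 * r"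
      using qr by blast
    then have "0 \<le> q (u, w, z) - 3" by simp
    then have "ennreal (3 + (q (u, w, z) - 3)) = ennreal 3 + ennreal (q (u, w, z) - 3)"
      by (intro ennreal_plus) auto
    then show "ennreal (q (u, w, z)) = 3 + ennreal (q (u, w, z) - 3)" by simp
  qed
  then have "dint M (\<lambda>u w. \<integral>\<^sup>+z. ennreal (q (u, w, z)) \<partial>M) = dint M (\<lambda>u w. \<integral>\<^sup>+z. 3 + ennreal (q (u, w, z) - 3) \<partial>M)"
    by (intro dint_cong_AE) (auto elim!: eventually_mono intro!: nn_integral_cong_AE)
  also have "\<dots> = 3 + (dint M (\<lambda>u w. \<integral>\<^sup>+z. ennreal (q (u, w, z) - 3) \<partial>M))"
    by (simp add: nn_integral_add)
  finally have "3 + (dint M (\<lambda>u w. \<integral>\<^sup>+z. ennreal (q (u, w, z) - 3) \<partial>M)) \<le> 3 + 0"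
    using q3 by simp
  then have "dint M (\<lambda>u w. \<integral>\<^sup>+z. ennreal (q (u, w, z) - 3) \<partial>M) = 0"
    by (subst (asm) ennreal_add_left_cancel_le) auto
  then have "AE u in M. AE w in M. AE z in M. q (u, w, z) \<le> 3"
    by (simp add: nn_integral_0_iff_AE ennreal_eq_0_iff)
  then show ?thesis
  proof (rule AE_nested_mp[OF _ pos3], elim conjE)
    fix u w z assume q: "q (u, w, z) \<le> 3"
      and "0 < (X u - X w) * (Y u - Y w)" "0 < (X u - X z) * (Y u - Y z)" "0 < (X w - X z) * (Y w - Y z)"
    then obtain r where "0 < r" "q (u, w, z) = 3 + ((X u - X w) * (Y w - Y z) - (X w - X z) * (Y u - Y w))\<^sup>2 * r"
      using qr by blast
    with q have "((X u - X w) * (Y w - Y z) - (X w - X z) * (Y u - Y w))\<^sup>2 \<le> 0"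
      by (simp add: mult_le_0_iff)
    then show "(X u - X w) * (Y w - Y z) = (X w - X z) * (Y u - Y w)" by simp
  qed
qed

text \<open>Fix two generic points u and w, which have distinct images. Almost every third point is
  collinear with them, so the slope of this single chord serves for all.\<close>

lemma minimiser_affine:
  assumes fin: "energy X Y < \<infinity>"
    and min: "\<And>X' Y'. mono X' \<Longrightarrow> mono Y' \<Longrightarrow> energy X Y \<le> energy X' Y'"
  shows "\<exists>l>0. \<exists>c. AE u in M. Y u = l * X u + c"
proof -
  note pos = energy_finite_AE[OF measX measY fin]
  have "AE u in M. AE w in M. AE z in M. (X u - X w) * (Y w - Y z) = (X w - X z) * (Y u - Y w)"
    using min by (intro AE_collinear[OF pos] minimiser_variation[OF fin _ bilinear_finite[OF measX measY fin]])
  with pos have "AE u in M. AE w in M. 0 < (X u - X w) * (Y u - Y w) \<and> (AE z in M. (X u - X w) * (Y w - Y z) = (X w - X z) * (Y u - Y w))"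
    by eventually_elim auto
  then obtain u where "AE w in M. 0 < (X u - X w) * (Y u - Y w) \<and> (AE z in M. (X u - X w) * (Y w - Y z) = (X w - X z) * (Y u - Y w))"
    by (rule AE_obtain)
  then obtain w where p: "0 < (X u - X w) * (Y u - Y w)" and ae: "AE z in M. (X u - X w) * (Y w - Y z) = (X w - X z) * (Y u - Y w)"
    by (rule AE_obtain) auto
  define l where "l = (Y u - Y w) / (X u - X w)"
  have "0 < l" using same_sign_cases[OF p] unfolding l_def by (auto simp: zero_less_divide_iff)
  moreover have "AE z in M. Y z = l * X z + (Y w - l * X w)"
    using ae
  proof eventually_elim
    case (elim z)
    have nz: "X u - X w \<noteq> 0" using p by auto
    then have "Y w - Y z = (X w - X z) * l" unfolding l_def using elim by (simp add: field_simps)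
    then show ?case by (simp add: algebra_simps)
  qed
  ultimately show ?thesis by blast
qed

end

section \<open>Existence of minimisers\<close>

text \<open>Needed also at \<open>q \<le> 0\<close>: a limit of nondecreasing functions may become
  flat, and the cost must then blow up along the sequence.\<close>

lemma pair_cost_lsc:
  assumes lim: "p \<longlonglongrightarrow> q"
  shows "pair_cost q \<le> liminf (\<lambda>n. pair_cost (p n))"
proof (cases "0 < q")
  case True
  then have "(\<lambda>n. p n / 2 - ln (p n)) \<longlonglongrightarrow> q / 2 - ln q"
    using lim by (intro tendsto_diff tendsto_divide tendsto_const tendsto_ln) auto
  then have "(\<lambda>n. ennreal (p n / 2 - ln (p n))) \<longlonglongrightarrow> ennreal (q / 2 - ln q)"
    by (rule tendsto_ennrealI)
  moreover have "\<forall>\<^sub>F n in sequentially. 0 < p n"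
    using order_tendstoD(1)[OF lim True] .
  then have "\<forall>\<^sub>F n in sequentially. ennreal (p n / 2 - ln (p n)) = pair_cost (p n)"
    by eventually_elim (simp add: pair_cost_def)
  ultimately have "(\<lambda>n. pair_cost (p n)) \<longlonglongrightarrow> ennreal (q / 2 - ln q)"
    by (rule Lim_transform_eventually)
  then show ?thesis
    using True lim_imp_Liminf[of sequentially "\<lambda>n. pair_cost (p n)"] by (simp add: pair_cost_def)
next
  case False
  show ?thesis
    unfolding le_Liminf_iff
  proof (intro allI impI)
    fix y assume "y < pair_cost q"
    then obtain r where r: "0 \<le> r" "y = ennreal r" by (cases y) auto
    \<comment> \<open>Below this threshold, either \<open>p n \<le> 0\<close> and the cost is
      infinite, or \<open>- ln (p n)\<close> alone exceeds \<open>r + 1\<close>.\<close>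
    have "q < exp (- (r + 1))" using False by (intro le_less_trans[OF _ exp_gt_zero]) simp
    then have "\<forall>\<^sub>F n in sequentially. p n < exp (- (r + 1))"
      by (rule order_tendstoD(2)[OF lim])
    then show "\<forall>\<^sub>F n in sequentially. y < pair_cost (p n)"
    proof eventually_elim
      case (elim n)
      show ?case
      proof (cases "p n \<le> 0")
        case True
        then show ?thesis using r by (simp add: pair_cost_def)
      next
        case False
        then have "ln (p n) < - (r + 1)"
          using elim ln_less_cancel_iff[of "p n" "exp (- (r + 1))"] by simp
        then show ?thesis using False r by (simp add: pair_cost_def ennreal_less_iff)
      qed
    qed
  qed
qed

section \<open>A priori bounds and compactness for nondecreasing pairs\<close>

context reference_measure begin

lemma AE_countable: "countable D \<Longrightarrow> AE u in M. u \<notin> D"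
proof (rule AE_not_in)
  assume "countable D"
  then have "(\<Union>a\<in>D. {a}) \<in> null_sets M"
    by (intro null_sets_UN') (auto simp: no_atoms)
  then show "D \<in> null_sets M" by simp
qed

lemma AE_isCont: "mono f \<Longrightarrow> AE u in M. isCont f u" for f :: "real \<Rightarrow> real"
  using AE_countable[OF mono_ctble_discont, of f] by simp

text \<open>\<open>Helly_selection\<close> asks for right-continuous functions. Taking right limits
  changes X at most at its countably many discontinuities, a null set that the energy does not
  see.\<close>

lemma right_continuous_version:
  fixes X :: "real \<Rightarrow> real"
  assumes "mono X"
  shows "\<exists>X'. mono X' \<and> (\<forall>x. continuous (at_right x) X') \<and> (AE u in M. X' u = X u)"
proof -
  define X' where "X' x = Inf (X ` {x<..})" for x
  have bdd: "bdd_below (X ` {x<..})" for x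
    using monoD[OF assms] by (intro bdd_belowI2[of _ "X x"]) auto
  have le: "X' x \<le> X v" if "x < v" for x v
    unfolding X'_def using that by (intro cInf_lower bdd) auto
  have ge: "X x \<le> X' x" for x
    unfolding X'_def using monoD[OF assms] by (intro cInf_greatest) auto
  have mono: "mono X'"
    unfolding X'_def by (intro monoI cInf_superset_mono bdd image_mono) auto
  have "continuous (at_right x) X'" for x
    unfolding continuous_within
  proof (rule order_tendstoI)
    fix a assume "a < X' x"
    then show "\<forall>\<^sub>F y in at_right x. a < X' y"
      using monoD[OF mono] by (intro eventually_at_rightI[of x "x + 1"]) (auto intro: less_le_trans)
  next
    fix a assume "X' x < a"
    then obtain v where v: "x < v" "X v < a"
      unfolding X'_def using cInf_less_iff[of "X ` {x<..}" a] bdd by auto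
    show "\<forall>\<^sub>F y in at_right x. X' y < a"
      using v le by (intro eventually_at_rightI[of x v]) (auto intro: le_less_trans)
  qed
  moreover have "X' x = X x" if "isCont X x" for x
  proof (rule antisym[OF _ ge])
    have "(X \<longlongrightarrow> X x) (at_right x)"
      using that by (auto simp: continuous_at intro: filterlim_at_split[THEN iffD1, THEN conjunct2])
    moreover have "\<forall>\<^sub>F v in at_right x. X' x \<le> X v"
      using le by (intro eventually_at_rightI[of x "x + 1"]) auto
    ultimately show "X' x \<le> X x"
      by (rule tendsto_lowerbound) simp
  qed
  then have "AE u in M. X' u = X u"
    using AE_isCont[OF assms] by auto
  ultimately show ?thesis using mono by blast
qed

lemma energy_cong_AE:
  assumes "AE u in M. X u = X' u" "AE u in M. Y u = Y' u"
  shows "energy X Y = energy X' Y'"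
  unfolding energy_def
proof (rule dint_cong_AE)
  show "AE u in M. AE w in M. pair_cost ((X u - X w) * (Y u - Y w)) = pair_cost ((X' u - X' w) * (Y' u - Y' w))"
    using assms
  proof eventually_elim
    case (elim u)
    show ?case using assms by eventually_elim (simp add: elim)
  qed
qed

lemma energy_affine:
  assumes "r \<noteq> 0"
  shows "energy (\<lambda>u. r * (X u - a)) (\<lambda>u. (Y u - b) / r) = energy X Y"
proof -
  have "(r * (X u - a) - r * (X w - a)) * ((Y u - b) / r - (Y w - b) / r) = (X u - X w) * (Y u - Y w)" for u w
    using assms by (simp add: field_simps)
  then show ?thesis unfolding energy_def by simp
qed

lemma energy_commute: "energy X Y = energy Y X"
  unfolding energy_def by (simp add: mult.commute)

lemma energy_lower_bound:
  assumes [measurable]: "A \<in> sets borel" "B \<in> sets borel" and "0 \<le> c"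
    and le: "\<And>u w. u \<in> A \<Longrightarrow> w \<in> B \<Longrightarrow> ennreal c \<le> pair_cost ((X u - X w) * (Y u - Y w))"
  shows "ennreal (c * (prob A * prob B)) \<le> energy X Y"
proof -
  have "ennreal (c * (prob A * prob B)) = ennreal c * (emeasure M B * emeasure M A)"
    using \<open>0 \<le> c\<close> by (simp add: emeasure_eq_measure ennreal_mult' ac_simps)
  also have "\<dots> = dint M (\<lambda>u w. ennreal c * (indicator B w * indicator A u))"
    by (simp add: nn_integral_cmult nn_integral_multc)
  also have "\<dots> \<le> energy X Y"
    unfolding energy_def by (intro nn_integral_mono) (auto simp: indicator_def le)
  finally show ?thesis .
qed

lemma interval_prob_pos: "a < b \<Longrightarrow> 0 < prob {a<..<b}"
  using interval_pos[of a b] by (simp add: emeasure_eq_measure)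

lemma pair_cost_ge: "0 < c \<Longrightarrow> p \<le> exp (- c) \<Longrightarrow> ennreal c \<le> pair_cost p"
  using ln_le_cancel_iff[of p "exp (- c)"] by (auto simp: pair_cost_def intro!: ennreal_leI)

lemma pair_cost_ge_linear: "q \<le> p \<Longrightarrow> ennreal (q / 4 - 1) \<le> pair_cost p"
  using ln_le_quarter[of p] by (auto simp: pair_cost_def intro!: ennreal_leI)

text \<open>If the product of the increments over [-1, 1] were smaller, every pair of points in
  between would cost at least \<open>(C + 1) / g\<close>, with g the mass of those pairs, and the
  energy would reach \<open>C + 1\<close>.\<close>

lemma spread_lower_bound:
  fixes X Y :: "real \<Rightarrow> real"
  assumes mono: "mono X" "mono Y" and C: "energy X Y \<le> ennreal C" "0 \<le> C"
  shows "exp (- ((C + 1) / (prob {-1<..<1} * prob {-1<..<1}))) \<le> (X 1 - X (-1)) * (Y 1 - Y (-1))"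
proof (rule ccontr)
  define g where "g = prob {-1<..<1} * prob {-1<..<1}"
  have g: "0 < g" unfolding g_def using interval_prob_pos[of "-1" 1] by simp
  assume "\<not> ?thesis"
  then have ab: "(X 1 - X (-1)) * (Y 1 - Y (-1)) < exp (- ((C + 1) / g))" unfolding g_def by simp
  have "ennreal ((C + 1) / g * g) \<le> energy X Y"
    unfolding g_def
  proof (rule energy_lower_bound, goal_cases)
    case (4 u w)
    have "\<bar>X u - X w\<bar> \<le> X 1 - X (-1)" "\<bar>Y u - Y w\<bar> \<le> Y 1 - Y (-1)"
      using 4 monoD[OF mono(1), of u 1] monoD[OF mono(1), of w 1] monoD[OF mono(1), of "-1" u] monoD[OF mono(1), of "-1" w]
        monoD[OF mono(2), of u 1] monoD[OF mono(2), of w 1] monoD[OF mono(2), of "-1" u] monoD[OF mono(2), of "-1" w]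
      by auto
    then have "\<bar>X u - X w\<bar> * \<bar>Y u - Y w\<bar> \<le> (X 1 - X (-1)) * (Y 1 - Y (-1))"
      by (intro mult_mono) auto
    then have "(X u - X w) * (Y u - Y w) \<le> (X 1 - X (-1)) * (Y 1 - Y (-1))"
      by (metis abs_ge_self abs_mult order_trans)
    then have "(X u - X w) * (Y u - Y w) \<le> exp (- ((C + 1) / g))" using ab by simp
    then have "ennreal ((C + 1) / g) \<le> pair_cost ((X u - X w) * (Y u - Y w))"
      using g C by (intro pair_cost_ge) auto
    then show ?case unfolding g_def .
  qed (use g C in \<open>auto simp: g_def\<close>)
  with C(1) have "ennreal ((C + 1) / g * g) \<le> ennreal C" by (rule order_trans[rotated])
  then show False using g C by (simp add: ennreal_le_iff del: ennreal_plus)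
qed

text \<open>A point right of a and a point left of d are at least as far apart, under X and under Y,
  as a and d. Such pairs have positive mass and a cost that grows linearly in the product.\<close>

lemma spread_upper_bound:
  fixes X Y :: "real \<Rightarrow> real"
  assumes mono: "mono X" "mono Y" and C: "energy X Y \<le> ennreal C" "0 \<le> C" and "a < b" "c < d" "d \<le> a"
  shows "(X a - X d) * (Y a - Y d) \<le> 4 * (C / (prob {a<..<b} * prob {c<..<d}) + 1)"
proof (rule ccontr)
  define g where "g = prob {a<..<b} * prob {c<..<d}"
  have g: "0 < g" unfolding g_def using interval_prob_pos assms by simp
  define p where "p = (X a - X d) * (Y a - Y d)"
  assume "\<not> ?thesis"
  then have "4 * (C / g + 1) < p" unfolding g_def p_def by simp
  then have "C / g < p / 4 - 1" by simp
  moreover have "0 \<le> C / g" using g C by simp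
  ultimately have p: "0 \<le> p / 4 - 1" "C < (p / 4 - 1) * g" using g by (linarith, simp only: pos_divide_less_eq)
  have "ennreal ((p / 4 - 1) * g) \<le> energy X Y"
    unfolding g_def
  proof (rule energy_lower_bound, goal_cases)
    case (4 u w)
    have "X a - X d \<le> X u - X w" "Y a - Y d \<le> Y u - Y w" "X d \<le> X a" "Y d \<le> Y a"
      using 4 assms(7) monoD[OF mono(1), of a u] monoD[OF mono(1), of w d] monoD[OF mono(2), of a u] monoD[OF mono(2), of w d]
        monoD[OF mono(1), of d a] monoD[OF mono(2), of d a]
      by auto
    then have "p \<le> (X u - X w) * (Y u - Y w)"
      unfolding p_def by (intro mult_mono) auto
    then show ?case by (rule pair_cost_ge_linear)
  qed (use p in auto)
  with C(1) have "ennreal ((p / 4 - 1) * g) \<le> ennreal C" by simp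
  then show False using p C by (simp add: ennreal_le_iff)
qed


text \<open>The energy controls only products of increments. When X and Y have equal spread over
  [-1, 1], that spread is bounded below, and dividing by it bounds X alone. \<open>K\<close> depends
  on C and u only, hence is uniform along a minimising sequence.\<close>

lemma normalised_bounds:
  assumes C: "0 \<le> C"
  shows "\<exists>K. \<forall>X Y :: real \<Rightarrow> real. mono X \<longrightarrow> mono Y \<longrightarrow> X 0 = 0 \<longrightarrow> Y 0 = 0 \<longrightarrow> X 1 - X (-1) = Y 1 - Y (-1)
    \<longrightarrow> energy X Y \<le> ennreal C \<longrightarrow> (\<forall>u. \<bar>X u\<bar> \<le> K u)"
proof -
  define \<kappa> where "\<kappa> = exp (- ((C + 1) / (prob {-1<..<1} * prob {-1<..<1})))"
  have \<kappa>: "0 < \<kappa>" unfolding \<kappa>_def by simp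
  \<comment> \<open>\<open>K1 R\<close> bounds products of increments over \<open>[-1, R]\<close>,
    and \<open>K2 R\<close> those over \<open>[-R, 1]\<close>. Each range contains [-1, 1], so the
    factor belonging to Y is at least the common spread.\<close>
  define K1 where "K1 R = 4 * (C / (prob {R<..<R+1} * prob {-2<..<-1}) + 1)" for R
  define K2 where "K2 R = 4 * (C / (prob {1<..<2} * prob {-R-1<..<-R}) + 1)" for R
  define K where "K u = (K1 (max 1 \<bar>u\<bar>) + K2 (max 1 \<bar>u\<bar>)) / sqrt \<kappa>" for u
  have K0: "0 \<le> K1 R" "0 \<le> K2 R" for R
    unfolding K1_def K2_def using C by auto
  have "\<bar>X u\<bar> \<le> K u"
    if mono: "mono X" "mono Y" and n: "X 0 = 0" "Y 0 = 0" "X 1 - X (-1) = Y 1 - Y (-1)" and e: "energy X Y \<le> ennreal C"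
    for X Y :: "real \<Rightarrow> real" and u
  proof -
    define R where "R = max 1 \<bar>u\<bar>"
    have R: "1 \<le> R" "u \<le> R" "- R \<le> u" unfolding R_def by auto
    define \<delta> where "\<delta> = Y 1 - Y (-1)"
    have d0: "0 \<le> \<delta>" unfolding \<delta>_def using monoD[OF mono(2), of "-1" 1] by simp
    have "\<kappa> \<le> \<delta>\<^sup>2"
      using spread_lower_bound[OF mono e C] unfolding \<kappa>_def n(3) \<delta>_def power2_eq_square .
    then have \<delta>: "sqrt \<kappa> \<le> \<delta>" using d0 by (metis real_sqrt_le_iff real_sqrt_unique)
    have sgn: "0 \<le> X R" "X (- R) \<le> 0" "X (-1) \<le> 0" "0 \<le> X 1" "Y (-1) \<le> 0" "0 \<le> Y 1"
      "Y 1 \<le> Y R" "Y (- R) \<le> Y (-1)"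
      using monoD[OF mono(1), of 0 R] monoD[OF mono(1), of "-R" 0] monoD[OF mono(1), of "-1" 0] monoD[OF mono(1), of 0 1]
        monoD[OF mono(2), of "-1" 0] monoD[OF mono(2), of 0 1] monoD[OF mono(2), of 1 R] monoD[OF mono(2), of "-R" "-1"] R n
      by auto
    have "X R * \<delta> \<le> (X R - X (-1)) * (Y R - Y (-1))"
      using sgn d0 unfolding \<delta>_def by (intro mult_mono) auto
    also have "\<dots> \<le> K1 R"
      unfolding K1_def using R by (intro spread_upper_bound[OF mono e C]) auto
    finally have "X R * sqrt \<kappa> \<le> K1 R" using \<delta> sgn by (meson mult_left_mono order_trans)
    then have 1: "X R \<le> K1 R / sqrt \<kappa>" using \<kappa> by (simp add: field_simps)
    have "- X (- R) * \<delta> \<le> (X 1 - X (-R)) * (Y 1 - Y (-R))"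
      using sgn d0 unfolding \<delta>_def by (intro mult_mono) auto
    also have "\<dots> \<le> K2 R"
      unfolding K2_def using R by (intro spread_upper_bound[OF mono e C]) auto
    finally have "- X (- R) * sqrt \<kappa> \<le> K2 R" using \<delta> sgn(2) mult_left_mono[OF \<delta>, of "- X (- R)"] by simp
    then have 2: "- X (- R) \<le> K2 R / sqrt \<kappa>" using \<kappa> by (simp add: field_simps)
    have "X u \<le> X R" "X (- R) \<le> X u" using R monoD[OF mono(1)] by auto
    moreover have "0 \<le> K1 R / sqrt \<kappa>" "0 \<le> K2 R / sqrt \<kappa>" using K0 \<kappa> by simp_all
    ultimately show ?thesis
      using 1 2 unfolding K_def R_def[symmetric] add_divide_distrib by (auto simp: abs_le_iff)
  qed
  then show ?thesis by blast
qed

text \<open>Helly's theorem wants a uniform bound, but only a bound for each u is available.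
  Composing with arctan gives the uniform bound, and \<open>K\<close> keeps the limit away from the
  ends of the range, so that tan can undo it.\<close>

lemma locally_bounded_selection:
  fixes X :: "nat \<Rightarrow> real \<Rightarrow> real"
  assumes mono: "\<And>n. mono (X n)" and rc: "\<And>n x. continuous (at_right x) (X n)"
    and K: "\<And>n u. \<bar>X n u\<bar> \<le> K u"
  shows "\<exists>s X'. strict_mono (s :: nat \<Rightarrow> nat) \<and> mono X' \<and> (AE u in M. (\<lambda>n. X (s n) u) \<longlonglongrightarrow> X' u)"
proof -
  define f where "f n u = arctan (X n u)" for n u
  have fb: "\<bar>f n u\<bar> \<le> 2" for n u
    using arctan_bounded[of "X n u"] pi_less_4 unfolding f_def by auto
  have "continuous (at_right x) (f n)" for n x
    unfolding f_def by (rule continuous_arctan[OF rc])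
  moreover have "mono (f n)" for n
    using monoD[OF mono] unfolding f_def by (auto intro!: monoI arctan_monotone')
  ultimately obtain s F where s: "strict_mono (s :: nat \<Rightarrow> nat)" and F: "mono F"
    and lim: "\<And>x. isCont F x \<Longrightarrow> (\<lambda>n. f (s n) x) \<longlonglongrightarrow> F x"
    using Helly_selection[of f 2] fb by metis
  have Fb: "F u < pi / 2 \<and> - (pi / 2) < F u" if "isCont F u" for u
  proof -
    have "f (s n) u \<le> arctan (K u)" "arctan (- K u) \<le> f (s n) u" for n
      unfolding f_def using K[of "s n" u] by (auto intro!: arctan_monotone' simp: abs_le_iff)
    then have "F u \<le> arctan (K u)" "arctan (- K u) \<le> F u"
      using lim[OF that] by (auto intro: LIMSEQ_le_const LIMSEQ_le_const2)
    then show ?thesis using arctan_bounded[of "K u"] arctan_bounded[of "- K u"] by auto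
  qed
  \<comment> \<open>\<open>F\<close> is controlled only at its continuity points; every point lies
    between two of them and \<open>F\<close> is nondecreasing.\<close>
  have Fb': "F u < pi / 2" "- (pi / 2) < F u" for u
  proof -
    obtain v where "u < v" "isCont F v"
      using open_minus_countable[OF mono_ctble_discont[OF F], of "{u<..}"] by auto
    then show "F u < pi / 2" using Fb[of v] monoD[OF F, of u v] by simp
    obtain v where "v < u" "isCont F v"
      using open_minus_countable[OF mono_ctble_discont[OF F], of "{..<u}"] by auto
    then show "- (pi / 2) < F u" using Fb[of v] monoD[OF F, of v u] by simp
  qed
  define X' where "X' u = tan (F u)" for u
  have "mono X'"
  proof (rule monoI)
    fix u w :: real assume "u \<le> w"
    then have "F u \<le> F w" by (rule monoD[OF F])
    then show "X' u \<le> X' w"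
      unfolding X'_def using Fb'[of u] Fb'[of w] tan_monotone[of "F u" "F w"] by (cases "F u = F w") auto
  qed
  moreover have "(\<lambda>n. X (s n) u) \<longlonglongrightarrow> X' u" if "isCont F u" for u
  proof -
    have "cos (F u) \<noteq> 0" using Fb'[of u] cos_gt_zero_pi[of "F u"] by simp
    then have "(\<lambda>n. tan (f (s n) u)) \<longlonglongrightarrow> X' u"
      unfolding X'_def using lim[OF that] by (intro isCont_tendsto_compose[OF isCont_tan])
    then show ?thesis by (simp add: f_def tan_arctan)
  qed
  then have "AE u in M. (\<lambda>n. X (s n) u) \<longlonglongrightarrow> X' u"
    using AE_isCont[OF F] by auto
  ultimately show ?thesis using s by blast
qed

lemma energy_Fatou:
  fixes X Y :: "nat \<Rightarrow> real \<Rightarrow> real"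
  assumes [measurable]: "\<And>n. X n \<in> borel_measurable borel" "\<And>n. Y n \<in> borel_measurable borel"
    and "AE u in M. (\<lambda>n. X n u) \<longlonglongrightarrow> X' u" "AE u in M. (\<lambda>n. Y n u) \<longlonglongrightarrow> Y' u"
  shows "energy X' Y' \<le> liminf (\<lambda>n. energy (X n) (Y n))"
proof -
  have ae: "AE u in M. (\<lambda>n. X n u) \<longlonglongrightarrow> X' u \<and> (\<lambda>n. Y n u) \<longlonglongrightarrow> Y' u"
    using assms by auto
  have "energy X' Y' \<le> dint M (\<lambda>u w. liminf (\<lambda>n. pair_cost ((X n u - X n w) * (Y n u - Y n w))))"
    unfolding energy_def
  proof (intro dint_mono_AE)
    show "AE u in M. AE w in M. pair_cost ((X' u - X' w) * (Y' u - Y' w)) \<le> liminf (\<lambda>n. pair_cost ((X n u - X n w) * (Y n u - Y n w)))"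
      using ae
    proof eventually_elim
      case (elim u)
      note lim_u = elim
      show ?case using ae
      proof eventually_elim
        case (elim w)
        show ?case using lim_u elim by (intro pair_cost_lsc tendsto_mult tendsto_diff) auto
      qed
    qed
  qed
  also have "\<dots> \<le> liminf (\<lambda>n. energy (X n) (Y n))"
    unfolding energy_def by (rule dint_liminf) measurable
  finally show ?thesis .
qed

lemma covariance_mono:
  fixes X Y :: "real \<Rightarrow> real"
  assumes mono: "mono X" "mono Y" and iX: "integrable M X" "integrable M Y" and iXY: "integrable M (\<lambda>u. X u * Y u)"
  shows "dint M (\<lambda>u w. ennreal ((X u - X w) * (Y u - Y w) / 2)) = ennreal (expectation (\<lambda>u. X u * Y u) - expectation X * expectation Y)"
    and "0 \<le> expectation (\<lambda>u. X u * Y u) - expectation X * expectation Y"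
proof -
  have nn: "0 \<le> (X u - X w) * (Y u - Y w) / 2" for u w
    using cosigned_mono[OF mono, of u w] by (auto simp: cosigned_def intro: mult_nonpos_nonpos)
  define g where "g u = (X u * Y u - X u * expectation Y - expectation X * Y u + expectation (\<lambda>u. X u * Y u)) / 2" for u
  have eq: "(X u - X w) * (Y u - Y w) / 2 = (X u * Y u - X u * Y w - X w * Y u + X w * Y w) / 2" for u w
    by (simp add: algebra_simps)
  have i: "integrable M (\<lambda>w. (X u - X w) * (Y u - Y w) / 2)" for u
    unfolding eq using iX iXY by auto
  have g: "expectation (\<lambda>w. (X u - X w) * (Y u - Y w) / 2) = g u" for u
    unfolding eq g_def using iX iXY by simp
  have g0: "0 \<le> g u" for u unfolding g[symmetric] using nn by (intro integral_nonneg_AE) auto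
  have "(\<integral>\<^sup>+w. ennreal ((X u - X w) * (Y u - Y w) / 2) \<partial>M) = ennreal (g u)" for u
    using i nn unfolding g[symmetric] by (intro nn_integral_eq_integral) auto
  then have "dint M (\<lambda>u w. ennreal ((X u - X w) * (Y u - Y w) / 2)) = (\<integral>\<^sup>+u. ennreal (g u) \<partial>M)"
    by simp
  also have "\<dots> = ennreal (expectation g)"
  proof (rule nn_integral_eq_integral)
    show "integrable M g" unfolding g_def using iX iXY by auto
  qed (simp add: g0)
  finally have int: "dint M (\<lambda>u w. ennreal ((X u - X w) * (Y u - Y w) / 2)) = ennreal (expectation g)" .
  have val: "expectation g = expectation (\<lambda>u. X u * Y u) - expectation X * expectation Y"
    unfolding g_def using iX iXY by (simp add: field_simps)
  show "dint M (\<lambda>u w. ennreal ((X u - X w) * (Y u - Y w) / 2)) = ennreal (expectation (\<lambda>u. X u * Y u) - expectation X * expectation Y)"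
    using int unfolding val .
  show "0 \<le> expectation (\<lambda>u. X u * Y u) - expectation X * expectation Y"
    unfolding val[symmetric] using g0 by (intro integral_nonneg_AE) auto
qed

definition energy_inf :: ennreal where
  "energy_inf = Inf {energy X Y | X Y. mono X \<and> mono Y}"

lemma energy_inf_le: "mono X \<Longrightarrow> mono Y \<Longrightarrow> energy_inf \<le> energy X Y"
  unfolding energy_inf_def by (intro Inf_lower) auto

text \<open>The translations and the scaling in \<open>energy_affine\<close> form a noncompact
  symmetry group that would let a minimising sequence escape. Fixing both values at 0 and equalising
  the spreads uses it up.\<close>

lemma normalised_near_minimiser:
  assumes "energy_inf < c"
  shows "\<exists>X Y. mono X \<and> mono Y \<and> (\<forall>x. continuous (at_right x) X) \<and> (\<forall>x. continuous (at_right x) Y)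
    \<and> X 0 = 0 \<and> Y 0 = 0 \<and> X 1 - X (-1) = Y 1 - Y (-1) \<and> energy X Y \<le> c"
proof -
  obtain X0 Y0 where "mono X0" "mono Y0" and e0: "energy X0 Y0 < c"
    using assms unfolding energy_inf_def Inf_less_iff by auto
  then obtain X Y where mono: "mono X" "mono Y" and rc: "\<And>x. continuous (at_right x) X" "\<And>x. continuous (at_right x) Y"
    and "AE u in M. X u = X0 u" "AE u in M. Y u = Y0 u"
    using right_continuous_version[of X0] right_continuous_version[of Y0] by auto
  then have e: "energy X Y < c" using e0 energy_cong_AE[of X X0 Y Y0] by simp
  define a b where "a = X 1 - X (-1)" and "b = Y 1 - Y (-1)"
  obtain C where C: "energy X Y = ennreal C" "0 \<le> C" using e by (cases "energy X Y") auto
  have "0 < a * b"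
    using spread_lower_bound[OF mono, of C] C unfolding a_def b_def by (auto intro: less_le_trans[OF exp_gt_zero])
  moreover have "0 \<le> a" unfolding a_def using monoD[OF mono(1), of "-1" 1] by simp
  ultimately have ab: "0 < a" "0 < b" by (auto simp: zero_less_mult_iff)
  \<comment> \<open>The solution of \<open>r * a = b / r\<close>, which makes the two spreads over
    [-1, 1] agree.\<close>
  define r where "r = sqrt (b / a)"
  have r: "0 < r" "r * a = b / r"
  proof -
    show "0 < r" using ab by (simp add: r_def)
    have "r * r = b / a" using ab by (simp add: r_def)
    then show "r * a = b / r" using ab \<open>0 < r\<close> by (simp add: field_simps)
  qed
  define X' where "X' u = r * (X u - X 0)" for u
  define Y' where "Y' u = (Y u - Y 0) / r" for u
  have "mono X'" "mono Y'"
    unfolding X'_def Y'_def using r monoD[OF mono(1)] monoD[OF mono(2)]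
    by (auto intro!: monoI mult_left_mono divide_right_mono)
  moreover have "continuous (at_right x) X'" "continuous (at_right x) Y'" for x
    unfolding X'_def Y'_def using r by (auto intro!: continuous_intros rc)
  moreover have "X' 1 - X' (-1) = Y' 1 - Y' (-1)"
    using r(2) unfolding X'_def Y'_def a_def b_def by (simp add: algebra_simps diff_divide_distrib)
  moreover have "energy X' Y' \<le> c"
    using e energy_affine[of r X "X 0" Y "Y 0"] r(1) unfolding X'_def Y'_def by simp
  ultimately show ?thesis
    by (intro exI[of _ X'] exI[of _ Y']) (auto simp: X'_def Y'_def)
qed

theorem minimiser_exists:
  assumes "energy_inf < \<infinity>"
  obtains X Y where "mono X" "mono Y" "energy X Y = energy_inf"
proof -
  obtain m where m: "energy_inf = ennreal m" "0 \<le> m" using assms by (cases energy_inf) auto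
  have "energy_inf < ennreal (m + 1 / (real n + 1))" for n
    unfolding m(1) using m(2) by (subst ennreal_less_iff) auto
  then have "\<exists>X Y. mono X \<and> mono Y \<and> (\<forall>x. continuous (at_right x) X) \<and> (\<forall>x. continuous (at_right x) Y)
    \<and> X 0 = 0 \<and> Y 0 = 0 \<and> X 1 - X (-1) = Y 1 - Y (-1) \<and> energy X Y \<le> ennreal (m + 1 / (real n + 1))" for n
    by (rule normalised_near_minimiser)
  then obtain X Y where mono: "\<And>n. mono (X n)" "\<And>n. mono (Y n)"
    and rc: "\<And>n x. continuous (at_right x) (X n)" "\<And>n x. continuous (at_right x) (Y n)"
    and n: "\<And>n. X n 0 = 0" "\<And>n. Y n 0 = 0" "\<And>n. X n 1 - X n (-1) = Y n 1 - Y n (-1)"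
    and e: "\<And>n. energy (X n) (Y n) \<le> ennreal (m + 1 / (real n + 1))"
    by metis
  have e': "energy (X n) (Y n) \<le> ennreal (m + 1)" for n
    using e[of n] by (rule order_trans) (auto intro!: ennreal_leI)
  obtain K where "\<And>X Y u. mono X \<Longrightarrow> mono Y \<Longrightarrow> X 0 = 0 \<Longrightarrow> Y 0 = 0 \<Longrightarrow> X 1 - X (-1) = Y 1 - Y (-1)
    \<Longrightarrow> energy X Y \<le> ennreal (m + 1) \<Longrightarrow> \<bar>X u\<bar> \<le> K u"
    using normalised_bounds[of "m + 1"] m(2) by auto
  then have K: "\<bar>X n u\<bar> \<le> K u" "\<bar>Y n u\<bar> \<le> K u" for n u
    using mono n e' energy_commute by metis+
  obtain s1 X' where s1: "strict_mono (s1 :: nat \<Rightarrow> nat)" "mono X'" "AE u in M. (\<lambda>n. X (s1 n) u) \<longlonglongrightarrow> X' u"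
    using locally_bounded_selection[of X K] mono rc K by blast
  obtain s2 Y' where s2: "strict_mono (s2 :: nat \<Rightarrow> nat)" "mono Y'" "AE u in M. (\<lambda>n. Y (s1 (s2 n)) u) \<longlonglongrightarrow> Y' u"
    using locally_bounded_selection[of "\<lambda>n. Y (s1 n)" K] mono rc K by blast
  define s where "s n = s1 (s2 n)" for n
  have s: "strict_mono s" using s1(1) s2(1) unfolding s_def by (simp add: strict_mono_def)
  have "AE u in M. (\<lambda>n. X (s n) u) \<longlonglongrightarrow> X' u"
    using s1(3) unfolding s_def
    by eventually_elim (use LIMSEQ_subseq_LIMSEQ[OF _ s2(1)] in \<open>auto simp: o_def\<close>)
  then have "energy X' Y' \<le> liminf (\<lambda>n. energy (X (s n)) (Y (s n)))"
    using s2(3) unfolding s_def[symmetric] by (intro energy_Fatou borel_measurable_mono mono)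
  also have "\<dots> \<le> liminf (\<lambda>n. ennreal (m + 1 / (real n + 1)))"
  proof (intro Liminf_mono always_eventually allI)
    fix k
    have "k \<le> s k" using s by (rule strict_mono_imp_increasing)
    then show "energy (X (s k)) (Y (s k)) \<le> ennreal (m + 1 / (real k + 1))"
      by (intro order_trans[OF e] ennreal_leI add_left_mono divide_left_mono) auto
  qed
  also have "\<dots> = ennreal m"
  proof (rule lim_imp_Liminf)
    have "(\<lambda>n. m + 1 / (real n + 1)) \<longlonglongrightarrow> m" by real_asymp
    then show "(\<lambda>n. ennreal (m + 1 / (real n + 1))) \<longlonglongrightarrow> ennreal m" by (rule tendsto_ennrealI)
  qed simp
  finally show ?thesis
    using that[of X' Y'] s1(2) s2(2) energy_inf_le[of X' Y'] m(1) by simp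
qed

end

section \<open>The Cauchy transform and the potential of the semicircle law\<close>

text \<open>The semicircle law is the image of this density on \<open>[0, pi]\<close> under
  \<open>\<phi> \<mapsto> - 2 * cos \<phi>\<close>; the sign makes the substitution increasing. In
  the angle, Cauchy and logarithmic kernels become power series with cosine coefficients.\<close>

definition angle_density :: "real \<Rightarrow> real" where
  "angle_density \<phi> = 2 / pi * (sin \<phi>)\<^sup>2"

definition angle_measure :: "real measure" where
  "angle_measure = density lborel (\<lambda>\<phi>. ennreal (angle_density \<phi> * indicator {0..pi} \<phi>))"

lemma angle_density_measurable[measurable]: "angle_density \<in> borel_measurable borel"
  unfolding angle_density_def[abs_def] by measurable

lemma angle_density_nonneg: "0 \<le> angle_density \<phi>"
  by (simp add: angle_density_def)

lemma sets_angle_measure[measurable_cong, simp]: "sets angle_measure = sets borel"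
  and space_angle_measure[simp]: "space angle_measure = UNIV"
  by (simp_all add: angle_measure_def)

text \<open>The density is \<open>(1 - cos (2 * \<phi>)) / pi\<close>, so by orthogonality only the
  frequencies 0 and 2 contribute.\<close>

lemma integral_cos_multiple:
  fixes n :: nat
  shows "integrable lborel (\<lambda>\<phi>. angle_density \<phi> * indicator {0..pi} \<phi> * cos (real n * \<phi>))" (is ?int)
    and "(\<integral>\<phi>. angle_density \<phi> * indicator {0..pi} \<phi> * cos (real n * \<phi>) \<partial>lborel) = (if n = 0 then 1 else if n = 2 then - 1 / 2 else 0)" (is ?val)
proof -
  \<comment> \<open>The product formula produces the frequencies n - 2, n and n + 2, hence the
    integer index. At frequency 0 the antiderivative of the cosine is \<phi> itself.\<close>
  define A where "A m \<phi> = (if m = 0 then \<phi> else sin (of_int m * \<phi>) / of_int m)" for m :: int and \<phi> :: real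
  have dA: "(A m has_real_derivative cos (of_int m * \<phi>)) (at \<phi>)" for m \<phi>
    unfolding A_def by (cases "m = 0") (auto intro!: derivative_eq_intros)
  define F where "F \<phi> = (A (int n) \<phi> - A (int n + 2) \<phi> / 2 - A (int n - 2) \<phi> / 2) / pi" for \<phi>
  define f where "f \<phi> = angle_density \<phi> * cos (real n * \<phi>)" for \<phi>
  have f: "f \<phi> = (cos (of_int (int n) * \<phi>) - cos (of_int (int n + 2) * \<phi>) / 2 - cos (of_int (int n - 2) * \<phi>) / 2) / pi" for \<phi>
  proof -
    have "cos (of_int (int n + 2) * \<phi>) + cos (of_int (int n - 2) * \<phi>) = 2 * cos (real n * \<phi>) * cos (2 * \<phi>)"
      by (simp add: distrib_right left_diff_distrib cos_add cos_diff)
    moreover have "cos (2 * \<phi>) = 1 - 2 * (sin \<phi>)\<^sup>2" by (rule cos_double_sin)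
    moreover have "a / 2 + b / 2 = c - 2 * s * c" if "a + b = 2 * c * d" "d = 1 - 2 * s" for a b c d s :: real
      using that by (simp add: field_simps add_divide_distrib[symmetric])
    ultimately have "cos (of_int (int n + 2) * \<phi>) / 2 + cos (of_int (int n - 2) * \<phi>) / 2 = cos (real n * \<phi>) - 2 * (sin \<phi>)\<^sup>2 * cos (real n * \<phi>)"
      by blast
    then have "2 * (sin \<phi>)\<^sup>2 * cos (real n * \<phi>) = cos (of_int (int n) * \<phi>) - cos (of_int (int n + 2) * \<phi>) / 2 - cos (of_int (int n - 2) * \<phi>) / 2"
      by simp
    then show ?thesis
      unfolding f_def angle_density_def by (metis times_divide_eq_left)
  qed
  have dF: "(F has_real_derivative f \<phi>) (at \<phi>)" for \<phi>
    unfolding F_def f by (intro DERIV_cdivide DERIV_diff dA)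
  have cf: "isCont f \<phi>" for \<phi>
    unfolding f_def angle_density_def by (intro continuous_intros) auto
  have e: "angle_density \<phi> * indicator {0..pi} \<phi> * cos (real n * \<phi>) = f \<phi> * indicator {0..pi} \<phi>" for \<phi>
    by (simp add: f_def)
  have hb: "has_bochner_integral lborel (\<lambda>x. f x * indicator {0..pi} x) (F pi - F 0)"
    by (rule has_bochner_integral_FTC_Icc_real) (use dF cf in auto)
  then show ?int unfolding e by (rule integrable.intros)
  have "A m pi = (if m = 0 then pi else 0)" for m
    using sin_npi_int[of m] by (simp add: A_def mult.commute)
  moreover have "A m 0 = 0" for m by (simp add: A_def)
  ultimately have "F pi - F 0 = (if n = 0 then 1 else if n = 2 then - 1 / 2 else 0)"
    unfolding F_def by auto
  then show ?val unfolding e using hb by (simp add: has_bochner_integral_integral_eq)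
qed

lemma emeasure_angle_measure: "emeasure angle_measure UNIV = 1"
proof -
  have "emeasure angle_measure UNIV = (\<integral>\<^sup>+\<phi>. ennreal (angle_density \<phi> * indicator {0..pi} \<phi>) \<partial>lborel)"
    by (simp add: angle_measure_def emeasure_density)
  also have "\<dots> = ennreal (\<integral>\<phi>. angle_density \<phi> * indicator {0..pi} \<phi> \<partial>lborel)"
    using integral_cos_multiple(1)[of 0] by (intro nn_integral_eq_integral) (auto simp: angle_density_nonneg)
  also have "\<dots> = 1" using integral_cos_multiple(2)[of 0] by simp
  finally show ?thesis .
qed

lemma angle_prob_UNIV[simp]: "measure angle_measure UNIV = 1"
  by (simp add: measure_def emeasure_angle_measure)

interpretation angle: prob_space angle_measure
  by standard (simp add: emeasure_angle_measure)

lemma expectation_cos_multiple: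
  fixes n :: nat
  shows "angle.expectation (\<lambda>\<phi>. cos (real n * \<phi>)) = (if n = 0 then 1 else if n = 2 then - 1 / 2 else 0)"
proof -
  have "angle.expectation (\<lambda>\<phi>. cos (real n * \<phi>)) = (\<integral>\<phi>. (angle_density \<phi> * indicator {0..pi} \<phi>) *\<^sub>R cos (real n * \<phi>) \<partial>lborel)"
    unfolding angle_measure_def by (intro integral_density) (auto simp: angle_density_nonneg)
  then show ?thesis using integral_cos_multiple(2)[of n] by simp
qed

lemma expectation_cos_series:
  fixes a :: "nat \<Rightarrow> 'b :: {banach, second_countable_topology}"
  assumes a: "summable (\<lambda>n. norm (a n))" and s: "\<And>\<phi>. (\<lambda>n. cos (real n * \<phi>) *\<^sub>R a n) sums f \<phi>"
  shows "angle.expectation f = a 0 - (1 / 2) *\<^sub>R a 2" and "integrable angle_measure f"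
proof -
  have bnd: "norm (cos (real n * \<phi>) *\<^sub>R a n) \<le> norm (a n)" for n \<phi>
    using mult_right_mono[OF abs_cos_le_one, of "norm (a n)" "real n * \<phi>"] by simp
  have int: "integrable angle_measure (\<lambda>\<phi>. cos (real n * \<phi>) *\<^sub>R a n)" for n
    by (rule angle.integrable_const_bound[where B = "norm (a n)"]) (use bnd in auto)
  have 1: "AE \<phi> in angle_measure. summable (\<lambda>n. norm (cos (real n * \<phi>) *\<^sub>R a n))"
    using bnd by (intro AE_I2 summable_comparison_test'[OF a, of 0]) auto
  have 2: "summable (\<lambda>n. angle.expectation (\<lambda>\<phi>. norm (cos (real n * \<phi>) *\<^sub>R a n)))"
  proof (rule summable_comparison_test'[OF a, of 0])
    fix n :: nat
    have "angle.expectation (\<lambda>\<phi>. norm (cos (real n * \<phi>) *\<^sub>R a n)) \<le> angle.expectation (\<lambda>\<phi>. norm (a n))"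
      using bnd by (intro integral_mono integrable_norm int) auto
    then show "norm (angle.expectation (\<lambda>\<phi>. norm (cos (real n * \<phi>) *\<^sub>R a n))) \<le> norm (a n)"
      by (simp add: angle.prob_space)
  qed
  have f: "f = (\<lambda>\<phi>. \<Sum>n. cos (real n * \<phi>) *\<^sub>R a n)" using s by (auto simp: sums_iff)
  show "integrable angle_measure f" unfolding f by (rule integrable_suminf[OF int 1 2])
  have "angle.expectation f = (\<Sum>n. angle.expectation (\<lambda>\<phi>. cos (real n * \<phi>) *\<^sub>R a n))"
    unfolding f by (rule integral_suminf[OF int 1 2])
  also have "\<dots> = (\<Sum>n. (if n = 0 then 1 else if n = 2 then - 1 / 2 else 0 :: real) *\<^sub>R a n)"
  proof -
    have "angle.expectation (\<lambda>\<phi>. cos (real n * \<phi>) *\<^sub>R a n) = (if n = 0 then 1 else if n = 2 then - 1 / 2 else 0 :: real) *\<^sub>R a n" for n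
    proof -
      have "integrable angle_measure (\<lambda>\<phi>. cos (real n * \<phi>))"
        by (rule angle.integrable_const_bound[where B = 1]) auto
      then have "angle.expectation (\<lambda>\<phi>. cos (real n * \<phi>) *\<^sub>R a n) = angle.expectation (\<lambda>\<phi>. cos (real n * \<phi>)) *\<^sub>R a n"
        by (intro integral_scaleR_left) auto
      then show ?thesis unfolding expectation_cos_multiple .
    qed
    then show ?thesis by simp
  qed
  also have "\<dots> = (\<Sum>n\<in>{0, 2}. (if n = 0 then 1 else if n = 2 then - 1 / 2 else 0 :: real) *\<^sub>R a n)"
    by (rule suminf_finite) auto
  finally show "angle.expectation f = a 0 - (1 / 2) *\<^sub>R a 2" by simp
qed

lemma cos_as_cis: "2 * complex_of_real (cos x) = cis x + cis (- x)"
  by (simp add: complex_eq_iff)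

lemma cis_factor: "(1 - v * cis \<phi>) * (1 - v * cis (- \<phi>)) = 1 - 2 * v * of_real (cos \<phi>) + v\<^sup>2"
proof -
  have "(1 - v * cis \<phi>) * (1 - v * cis (- \<phi>)) = 1 - v * (cis \<phi> + cis (- \<phi>)) + v\<^sup>2 * (cis \<phi> * cis (- \<phi>))"
    by (simp add: algebra_simps power2_eq_square)
  also have "cis \<phi> * cis (- \<phi>) = 1" by (simp add: cis_mult)
  finally show ?thesis unfolding cos_as_cis[symmetric] by (simp add: mult_ac)
qed

lemma norm_cis_mult_less: "norm v < 1 \<Longrightarrow> norm (v * cis \<phi>) < 1"
  by (simp add: norm_mult)

lemma one_minus_cis_nonzero: "norm v < 1 \<Longrightarrow> 1 - v * cis \<phi> \<noteq> 0"
  using norm_cis_mult_less[of v \<phi>] by (metis norm_one order_less_irrefl right_minus_eq)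

text \<open>The cosine series \<open>c\<close> of the powers of v has mean
  \<open>1 - v^2 / 2\<close>, and the Poisson kernel is \<open>(2 * c - 1) / (1 - v^2)\<close>. The
  normalisation cancels exactly.\<close>

lemma expectation_poisson:
  fixes v :: complex
  assumes v: "norm v < 1"
  shows "angle.expectation (\<lambda>\<phi>. 1 / (1 - 2 * v * of_real (cos \<phi>) + v\<^sup>2)) = 1"
    and "integrable angle_measure (\<lambda>\<phi>. 1 / (1 - 2 * v * of_real (cos \<phi>) + v\<^sup>2))"
proof -
  define c where "c \<phi> = (1 / (1 - v * cis \<phi>) + 1 / (1 - v * cis (- \<phi>))) / 2" for \<phi>
  have s: "(\<lambda>n. cos (real n * \<phi>) *\<^sub>R v ^ n) sums c \<phi>" for \<phi>
  proof -
    have "(\<lambda>n. ((v * cis \<phi>) ^ n + (v * cis (- \<phi>)) ^ n) / 2) sums c \<phi>"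
      unfolding c_def using norm_cis_mult_less[OF v]
      by (intro sums_divide sums_add geometric_sums) auto
    moreover have "((v * cis \<phi>) ^ n + (v * cis (- \<phi>)) ^ n) / 2 = cos (real n * \<phi>) *\<^sub>R v ^ n" for n
    proof -
      have "(v * cis \<phi>) ^ n + (v * cis (- \<phi>)) ^ n = v ^ n * (cis (real n * \<phi>) + cis (- (real n * \<phi>)))"
        by (simp add: power_mult_distrib Complex.DeMoivre distrib_left)
      then show ?thesis unfolding cos_as_cis[symmetric] by (simp add: scaleR_conv_of_real)
    qed
    ultimately show ?thesis by simp
  qed
  have a: "summable (\<lambda>n. norm (v ^ n))" using v by (simp add: norm_power summable_geometric)
  have c: "angle.expectation c = 1 - v\<^sup>2 / 2" "integrable angle_measure c"
    using expectation_cos_series[OF a s] by (simp_all add: scaleR_conv_of_real)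
  have v2: "1 - v\<^sup>2 \<noteq> 0"
  proof
    assume "1 - v\<^sup>2 = 0"
    then have "norm v ^ 2 = 1" by (metis eq_iff_diff_eq_0 norm_one norm_power)
    then show False using v norm_ge_zero[of v] by (auto simp: power2_eq_1_iff)
  qed
  have eq: "1 / (1 - 2 * v * of_real (cos \<phi>) + v\<^sup>2) = (2 * c \<phi> - 1) / (1 - v\<^sup>2)" for \<phi>
  proof -
    define p q where "p = 1 - v * cis \<phi>" and "q = 1 - v * cis (- \<phi>)"
    have nz: "p \<noteq> 0" "q \<noteq> 0" unfolding p_def q_def using one_minus_cis_nonzero[OF v] by auto
    have "p + q = 2 - 2 * v * of_real (cos \<phi>)"
      unfolding p_def q_def using cos_as_cis[of \<phi>] by (simp add: algebra_simps)
    moreover have pq: "p * q = 1 - 2 * v * of_real (cos \<phi>) + v\<^sup>2"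
      unfolding p_def q_def by (rule cis_factor)
    ultimately have "p + q - p * q = 1 - v\<^sup>2" by simp
    moreover have "2 * c \<phi> - 1 = (p + q - p * q) / (p * q)"
      unfolding c_def p_def[symmetric] q_def[symmetric] using nz by (simp add: field_simps)
    ultimately show ?thesis unfolding pq[symmetric] using v2 by simp
  qed
  show "integrable angle_measure (\<lambda>\<phi>. 1 / (1 - 2 * v * of_real (cos \<phi>) + v\<^sup>2))"
    unfolding eq using c(2) by simp
  show "angle.expectation (\<lambda>\<phi>. 1 / (1 - 2 * v * of_real (cos \<phi>) + v\<^sup>2)) = 1"
    unfolding eq using c v2 by (simp add: angle.prob_space field_simps)
qed

text \<open>Each factor of \<open>cis_factor\<close> has a logarithm given by its power series.
  Passing to moduli before adding the two logarithms avoids any question of branches.\<close>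

lemma expectation_log_poisson:
  fixes v :: complex
  assumes v: "norm v < 1"
  shows "angle.expectation (\<lambda>\<phi>. ln (norm (1 - 2 * v * of_real (cos \<phi>) + v\<^sup>2))) = Re (v\<^sup>2) / 2"
    and "integrable angle_measure (\<lambda>\<phi>. ln (norm (1 - 2 * v * of_real (cos \<phi>) + v\<^sup>2)))"
proof -
  \<comment> \<open>At \<open>n = 0\<close> division by zero gives \<open>a 0 = 0\<close>, matching
    a logarithmic series that starts at 1. Only \<open>a 2 = - Re (v^2)\<close> then
    survives.\<close>
  define a where "a n = - 2 * Re (v ^ n) / real n" for n
  have ln1: "(\<lambda>n. - Re ((v * cis \<phi>) ^ n) / real n) sums ln (norm (1 - v * cis \<phi>))" for \<phi>
  proof -
    have "(\<lambda>n. - ((v * cis \<phi>) ^ n) / of_nat n) sums Ln (1 - v * cis \<phi>)"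
      using Ln_series'[of "- (v * cis \<phi>)"] norm_cis_mult_less[OF v, of \<phi>] by simp
    then have "(\<lambda>n. Re (- ((v * cis \<phi>) ^ n) / of_nat n)) sums Re (Ln (1 - v * cis \<phi>))"
      by (rule sums_Re)
    moreover have "Re (- ((v * cis \<phi>) ^ n) / of_nat n) = - Re ((v * cis \<phi>) ^ n) / real n" for n
      using Re_divide_of_nat[of "- ((v * cis \<phi>) ^ n)" n] by simp
    ultimately show ?thesis using one_minus_cis_nonzero[OF v] by (simp add: Re_Ln)
  qed
  have s: "(\<lambda>n. cos (real n * \<phi>) *\<^sub>R a n) sums ln (norm (1 - 2 * v * of_real (cos \<phi>) + v\<^sup>2))" for \<phi>
  proof -
    have "(\<lambda>n. - Re ((v * cis \<phi>) ^ n) / real n + - Re ((v * cis (- \<phi>)) ^ n) / real n) sums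
        (ln (norm (1 - v * cis \<phi>)) + ln (norm (1 - v * cis (- \<phi>))))"
      by (intro sums_add ln1)
    moreover have "- Re ((v * cis \<phi>) ^ n) / real n + - Re ((v * cis (- \<phi>)) ^ n) / real n = cos (real n * \<phi>) *\<^sub>R a n" for n
    proof -
      have "(v * cis \<phi>) ^ n + (v * cis (- \<phi>)) ^ n = v ^ n * (cis (real n * \<phi>) + cis (- (real n * \<phi>)))"
        by (simp add: power_mult_distrib Complex.DeMoivre distrib_left)
      then have "Re ((v * cis \<phi>) ^ n) + Re ((v * cis (- \<phi>)) ^ n) = 2 * cos (real n * \<phi>) * Re (v ^ n)"
        unfolding cos_as_cis[symmetric] plus_complex.simps(1)[symmetric] by simp
      moreover have "- p / real n + - q / real n = - (p + q) / real n" for p q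
        by (simp add: add_divide_distrib diff_divide_distrib)
      ultimately show ?thesis by (simp only: a_def) simp
    qed
    moreover have "ln (norm (1 - v * cis \<phi>)) + ln (norm (1 - v * cis (- \<phi>))) = ln (norm (1 - 2 * v * of_real (cos \<phi>) + v\<^sup>2))"
      using one_minus_cis_nonzero[OF v] unfolding cis_factor[symmetric] norm_mult by (simp add: ln_mult_pos)
    ultimately show ?thesis by simp
  qed
  have asum: "summable (\<lambda>n. norm (a n))"
  proof (rule summable_comparison_test'[of "\<lambda>n. 2 * norm v ^ n" 0])
    show "summable (\<lambda>n. 2 * norm v ^ n)" using v by (intro summable_mult summable_geometric) auto
    fix n :: nat
    have "\<bar>Re (v ^ n)\<bar> \<le> norm v ^ n" using abs_Re_le_cmod[of "v ^ n"] by (simp add: norm_power)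
    moreover have "\<bar>Re (v ^ n)\<bar> / real n \<le> \<bar>Re (v ^ n)\<bar>" by (cases n) (auto simp: divide_simps mult_le_cancel_left1)
    ultimately show "norm (norm (a n)) \<le> 2 * norm v ^ n" by (simp add: a_def abs_mult)
  qed
  show "integrable angle_measure (\<lambda>\<phi>. ln (norm (1 - 2 * v * of_real (cos \<phi>) + v\<^sup>2)))"
    by (rule expectation_cos_series(2)[OF asum s])
  show "angle.expectation (\<lambda>\<phi>. ln (norm (1 - 2 * v * of_real (cos \<phi>) + v\<^sup>2))) = Re (v\<^sup>2) / 2"
    using expectation_cos_series(1)[OF asum s] by (simp add: a_def)
qed

section \<open>The semicircle law in the angle variable\<close>

lemma semicircular_law_eq_distr:
  "\<sigma> = distr angle_measure borel (\<lambda>\<phi>. - 2 * cos \<phi>)"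
proof (rule measure_eqI)
  fix A assume "A \<in> sets \<sigma>"
  then have [measurable]: "A \<in> sets borel" by (simp add: semicircular_law_def)
  define f where "f x = 1 / (2 * pi) * sqrt (4 - x\<^sup>2) * indicator A x" for x :: real
  have "(\<lambda>\<phi> :: real. - 2 * cos \<phi>) \<in> borel_measurable borel" by measurable
  then have [measurable]: "(\<lambda>\<phi> :: real. - 2 * cos \<phi>) -` A \<in> sets borel"
    using \<open>A \<in> sets borel\<close> by (rule measurable_sets_borel)
  then have [measurable]: "(\<lambda>\<phi> :: real. - (2 * cos \<phi>)) -` A \<in> sets borel" by simp
  have "emeasure \<sigma> A = (\<integral>\<^sup>+x. ennreal (semicircular_density 0 1 x) * indicator A x \<partial>lborel)"
    unfolding semicircular_law_def semicircular_density_def by (intro emeasure_density) auto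
  also have "\<dots> = (\<integral>\<^sup>+x. ennreal (f x * indicator {- 2 * cos 0..- 2 * cos pi} x) \<partial>lborel)"
    by (intro nn_integral_cong) (auto simp: f_def semicircular_density_def indicator_def)
  also have "\<dots> = (\<integral>\<^sup>+\<phi>. ennreal (f (- 2 * cos \<phi>) * (2 * sin \<phi>) * indicator {0..pi} \<phi>) \<partial>lborel)"
  proof (rule nn_integral_substitution[where g = "\<lambda>\<phi>. - 2 * cos \<phi>"])
    show "set_borel_measurable borel {- 2 * cos 0..- 2 * cos pi} f"
      unfolding f_def[abs_def] set_borel_measurable_def by measurable
    show "((\<lambda>\<phi>. - 2 * cos \<phi>) has_real_derivative 2 * sin \<phi>) (at \<phi>)" for \<phi>
      by (auto intro!: derivative_eq_intros)
  qed (auto intro!: continuous_intros sin_ge_zero)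
  also have "\<dots> = (\<integral>\<^sup>+\<phi>. ennreal (angle_density \<phi> * indicator {0..pi} \<phi>) * indicator ((\<lambda>\<phi>. - 2 * cos \<phi>) -` A) \<phi> \<partial>lborel)"
  proof (rule nn_integral_cong)
    fix \<phi>
    show "ennreal (f (- 2 * cos \<phi>) * (2 * sin \<phi>) * indicator {0..pi} \<phi>)
      = ennreal (angle_density \<phi> * indicator {0..pi} \<phi>) * indicator ((\<lambda>\<phi>. - 2 * cos \<phi>) -` A) \<phi>"
    proof (cases "\<phi> \<in> {0..pi} \<and> - 2 * cos \<phi> \<in> A")
      case True
      then have "0 \<le> sin \<phi>" by (auto intro: sin_ge_zero)
      moreover have "4 - (- 2 * cos \<phi>)\<^sup>2 = (2 * sin \<phi>)\<^sup>2"
        by (simp add: power_mult_distrib cos_squared_eq)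
      ultimately have "sqrt (4 - (- 2 * cos \<phi>)\<^sup>2) = 2 * sin \<phi>"
        by (metis mult_nonneg_nonneg real_sqrt_unique zero_le_numeral)
      then have "f (- 2 * cos \<phi>) * (2 * sin \<phi>) = angle_density \<phi>"
        using True unfolding f_def angle_density_def by (simp add: power2_eq_square)
      then show ?thesis using True by simp
    qed (auto simp: f_def)
  qed
  also have "\<dots> = emeasure (distr angle_measure borel (\<lambda>\<phi>. - 2 * cos \<phi>)) A"
    unfolding angle_measure_def by (subst emeasure_distr; (subst emeasure_density)?) (auto simp del: mult_minus_left)
  finally show "emeasure \<sigma> A = emeasure (distr angle_measure borel (\<lambda>\<phi>. - 2 * cos \<phi>)) A" .
qed (simp add: semicircular_law_def)


lemma sets_semicircular_law[measurable_cong, simp]: "sets (semicircular_law m s) = sets borel"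
  and space_semicircular_law[simp]: "space (semicircular_law m s) = UNIV"
  by (simp_all add: semicircular_law_def)

interpretation semicircle: real_distribution "\<sigma>"
proof -
  have "prob_space \<sigma>"
    unfolding semicircular_law_eq_distr by (rule angle.prob_space_distr) auto
  then show "real_distribution \<sigma>"
    by (simp add: real_distribution_def real_distribution_axioms_def)
qed

lemma integral_semicircle:
  fixes f :: "real \<Rightarrow> 'b :: {banach, second_countable_topology}"
  assumes [measurable]: "f \<in> borel_measurable borel"
  shows "(\<integral>x. f x \<partial>\<sigma>) = angle.expectation (\<lambda>\<phi>. f (- 2 * cos \<phi>))"
    and "integrable \<sigma> f \<longleftrightarrow> integrable angle_measure (\<lambda>\<phi>. f (- 2 * cos \<phi>))"
  unfolding semicircular_law_eq_distr
  by (subst integral_distr) (auto simp: integrable_distr_eq)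

lemma AE_semicircle_bounded: "AE x in \<sigma>. \<bar>x\<bar> \<le> 2"
  unfolding semicircular_law_eq_distr by (subst AE_distr_iff) (auto simp: abs_mult)

lemma semicircle_moments:
  shows "(\<integral>x. x \<partial>\<sigma>) = 0" "(\<integral>x. x\<^sup>2 \<partial>\<sigma>) = 1"
    and "integrable \<sigma> (\<lambda>x. x)" "integrable \<sigma> (\<lambda>x. x\<^sup>2)"
proof -
  show "integrable \<sigma> (\<lambda>x. x)"
    by (rule semicircle.integrable_const_bound[where B = 2]) (use AE_semicircle_bounded in auto)
  have "AE x in \<sigma>. norm (x\<^sup>2) \<le> 2\<^sup>2"
    using AE_semicircle_bounded by eventually_elim (use abs_le_square_iff[of _ 2] in auto)
  then show "integrable \<sigma> (\<lambda>x. x\<^sup>2)"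
    by (rule semicircle.integrable_const_bound) auto
  show "(\<integral>x. x \<partial>\<sigma>) = 0"
    using expectation_cos_multiple[of 1] by (simp add: integral_semicircle)
  have i: "integrable angle_measure (\<lambda>\<phi>. cos (real n * \<phi>))" for n
    by (rule angle.integrable_const_bound[where B = 1]) auto
  have "(- 2 * cos \<phi>)\<^sup>2 = 2 + 2 * cos (real 2 * \<phi>)" for \<phi> :: real
    using cos_double_cos[of \<phi>] by (simp add: power_mult_distrib)
  then have "(\<integral>x. x\<^sup>2 \<partial>\<sigma>) = angle.expectation (\<lambda>\<phi>. 2 + 2 * cos (real 2 * \<phi>))"
    by (subst integral_semicircle) auto
  also have "\<dots> = 2 + 2 * angle.expectation (\<lambda>\<phi>. cos (real 2 * \<phi>))"
    using i[of 2] by (subst Bochner_Integration.integral_add) auto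
  finally show "(\<integral>x. x\<^sup>2 \<partial>\<sigma>) = 1"
    unfolding expectation_cos_multiple by simp
qed

text \<open>The inverse of the Joukowski map; \<open>w\<close> is the Cauchy transform of the semicircle law at \<open>x + \<i>\<epsilon>\<close>.\<close>
lemma joukowski_preimage:
  assumes "0 < \<epsilon>"
  obtains w where "w \<noteq> 0" "norm w < 1" "w + 1 / w = Complex x \<epsilon>"
proof -
  define z where "z = Complex x \<epsilon>"
  define w where "w = (z + csqrt (z\<^sup>2 - 4)) / 2"
  define w' where "w' = (z - csqrt (z\<^sup>2 - 4)) / 2"
  have prod: "w * w' = 1"
  proof -
    have "w * w' = (z\<^sup>2 - (csqrt (z\<^sup>2 - 4))\<^sup>2) / 4"
      unfolding w_def w'_def by (simp add: power2_eq_square algebra_simps)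
    then show ?thesis by simp
  qed
  have sum: "w + w' = z" unfolding w_def w'_def by (simp add: field_simps)
  have nz: "w \<noteq> 0" "w' \<noteq> 0" using prod by auto
  have inv: "1 / w = w'" "1 / w' = w" using prod nz by (auto simp: field_simps)
  have np: "norm w * norm w' = 1" using prod by (metis norm_mult norm_one)
  show ?thesis
  proof (cases "norm w" "1 :: real" rule: linorder_cases)
    case less
    then show ?thesis using that[of w] nz sum inv unfolding z_def by simp
  next
    case greater
    moreover have "norm w' = 1 / norm w" using np nz by (simp add: field_simps)
    ultimately have "norm w' < 1" by (auto simp: divide_less_eq_1)
    then show ?thesis using that[of w'] nz sum inv unfolding z_def by (simp add: add.commute)
  next
    case equal
    then have "w * cnj w = 1" by (simp add: complex_norm_square[symmetric])
    then have "w' = cnj w" using prod nz by (metis mult_left_cancel)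
    then have "Im z = 0" unfolding sum[symmetric] by simp
    then show ?thesis using assms unfolding z_def by simp
  qed
qed

text \<open>Since \<open>1 / w\<close> is the conjugate of w divided by \<rho>, the Joukowski
  equation separates into real and imaginary parts, each linear once \<rho> is given.\<close>

lemma joukowski_real_part:
  assumes w: "w \<noteq> 0" "norm w < 1" "w + 1 / w = Complex x \<epsilon>"
  defines "\<rho> \<equiv> (norm w)\<^sup>2"
  shows "0 < \<rho>" "\<rho> < 1" "Re w = x * (\<rho> / (1 + \<rho>))" "Im w = - \<epsilon> * \<rho> / (1 - \<rho>)"
proof -
  show \<rho>: "0 < \<rho>" "\<rho> < 1" using w unfolding \<rho>_def by (auto simp: power_less_one_iff abs_square_less_1)
  have "1 / w = cnj w / of_real \<rho>"
    using w(1) complex_norm_square[of w] unfolding \<rho>_def by (simp add: field_simps)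
  then have "w + cnj w / of_real \<rho> = Complex x \<epsilon>" using w(3) by simp
  then have "Re w + Re w / \<rho> = x" "Im w - Im w / \<rho> = \<epsilon>"
    by (auto simp: complex_eq_iff)
  then show "Re w = x * (\<rho> / (1 + \<rho>))" "Im w = - \<epsilon> * \<rho> / (1 - \<rho>)"
    using \<rho> by (auto simp: field_simps)
qed

text \<open>Turns the denominator of the resolvent at \<open>y = - 2 * cos \<phi>\<close> into that
  of the Poisson kernel; the sign in y is the reason for the argument \<open>- w\<close>.\<close>

lemma joukowski_kernel:
  assumes w: "w \<noteq> 0" "w + 1 / w = Complex x \<epsilon>"
  shows "Complex (x - (- 2 * cos \<phi>)) \<epsilon> = (1 - 2 * (- w) * of_real (cos \<phi>) + (- w)\<^sup>2) / w"
proof -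
  have "Complex (x - (- 2 * cos \<phi>)) \<epsilon> = w + 1 / w + 2 * of_real (cos \<phi>)"
    unfolding w(2) by (simp add: complex_eq_iff)
  then show ?thesis using w(1) by (simp add: field_simps power2_eq_square)
qed

text \<open>The integral is the real part of the Cauchy transform w, so
  \<open>q = \<rho> / (1 + \<rho>)\<close>. The bound 1/2 holds at every height \<epsilon>, which
  spares computing the limit of q.\<close>

lemma expectation_resolvent:
  assumes "0 < \<epsilon>"
  shows "\<exists>q. 0 \<le> q \<and> q \<le> 1 / 2 \<and> (\<integral>y. (x - y) / ((x - y)\<^sup>2 + \<epsilon>\<^sup>2) \<partial>\<sigma>) = q * x"
proof -
  obtain w where w: "w \<noteq> 0" "norm w < 1" "w + 1 / w = Complex x \<epsilon>"
    using joukowski_preimage[OF assms] by blast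
  define \<rho> where "\<rho> = (norm w)\<^sup>2"
  define g where "g \<phi> = 1 / (1 - 2 * (- w) * of_real (cos \<phi>) + (- w)\<^sup>2)" for \<phi>
  have g: "angle.expectation g = 1" "integrable angle_measure g"
    using expectation_poisson[of "- w"] w(2) unfolding g_def by auto
  have "(x - (- 2 * cos \<phi>)) / ((x - (- 2 * cos \<phi>))\<^sup>2 + \<epsilon>\<^sup>2) = Re (w * g \<phi>)" for \<phi>
  proof -
    have "w * g \<phi> = 1 / Complex (x - (- 2 * cos \<phi>)) \<epsilon>"
      unfolding joukowski_kernel[OF w(1,3)] g_def by simp
    then show ?thesis by (simp add: Re_divide)
  qed
  then have "(\<integral>y. (x - y) / ((x - y)\<^sup>2 + \<epsilon>\<^sup>2) \<partial>\<sigma>) = angle.expectation (\<lambda>\<phi>. Re (w * g \<phi>))"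
    by (subst integral_semicircle) auto
  also have "\<dots> = Re (w * angle.expectation g)"
    using g(2) by (subst integral_Re) auto
  also have "\<dots> = \<rho> / (1 + \<rho>) * x"
    using joukowski_real_part(3)[OF w] g(1) unfolding \<rho>_def by simp
  finally show ?thesis
    using joukowski_real_part(1,2)[OF w] unfolding \<rho>_def[symmetric]
    by (intro exI[of _ "\<rho> / (1 + \<rho>)"]) (auto simp: field_simps)
qed

definition smoothed_potential :: "real \<Rightarrow> real \<Rightarrow> real" where
  "smoothed_potential \<epsilon> x = (\<integral>y. ln ((x - y)\<^sup>2 + \<epsilon>\<^sup>2) / 2 \<partial>\<sigma>)"

text \<open>The smoothed potential is exactly \<open>Re (w^2) / 2 - ln \<rho> / 2\<close>, and this
  becomes \<open>x^2 / 4 - 1 / 2\<close> at \<rho> = 1. The error is therefore governed by 1 -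
  \<rho>, uniformly over the support.\<close>

lemma smoothed_potential_bound:
  assumes "0 < \<epsilon>" "\<epsilon> < 1 / 2" "\<bar>x\<bar> \<le> 2"
  shows "\<bar>smoothed_potential \<epsilon> x - (x\<^sup>2 / 4 - 1 / 2)\<bar> \<le> 5 * sqrt (2 * \<epsilon>) - ln (1 - sqrt (2 * \<epsilon>)) / 2"
    and "integrable \<sigma> (\<lambda>y. ln ((x - y)\<^sup>2 + \<epsilon>\<^sup>2) / 2)"
proof -
  obtain w where w: "w \<noteq> 0" "norm w < 1" "w + 1 / w = Complex x \<epsilon>"
    using joukowski_preimage[OF assms(1)] by blast
  define \<rho> where "\<rho> = (norm w)\<^sup>2"
  note j = joukowski_real_part[OF w, folded \<rho>_def]
  define g where "g \<phi> = ln (norm (1 - 2 * (- w) * of_real (cos \<phi>) + (- w)\<^sup>2))" for \<phi>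
  have g: "angle.expectation g = Re (w\<^sup>2) / 2" "integrable angle_measure g"
    using expectation_log_poisson[of "- w"] w(2) unfolding g_def by auto
  have e: "ln ((x - (- 2 * cos \<phi>))\<^sup>2 + \<epsilon>\<^sup>2) / 2 = g \<phi> - ln \<rho> / 2" for \<phi>
  proof -
    define v where "v = 1 - 2 * (- w) * of_real (cos \<phi>) + (- w)\<^sup>2"
    have k: "Complex (x - (- 2 * cos \<phi>)) \<epsilon> = v / w"
      unfolding v_def by (rule joukowski_kernel[OF w(1,3)])
    then have v: "v \<noteq> 0" using assms(1) by (metis complex.sel(2) div_0 less_irrefl zero_complex.sel(2))
    have "(x - (- 2 * cos \<phi>))\<^sup>2 + \<epsilon>\<^sup>2 = (norm (v / w))\<^sup>2"
      unfolding k[symmetric] by (simp add: cmod_def)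
    then have "ln ((x - (- 2 * cos \<phi>))\<^sup>2 + \<epsilon>\<^sup>2) = 2 * (ln (norm v) - ln (norm w))"
      using v w(1) by (simp add: norm_divide ln_realpow ln_div)
    moreover have "ln \<rho> = 2 * ln (norm w)" unfolding \<rho>_def using w(1) by (simp add: ln_realpow)
    ultimately show ?thesis unfolding g_def v_def by simp
  qed
  have m: "(\<lambda>y. ln ((x - y)\<^sup>2 + \<epsilon>\<^sup>2) / 2) \<in> borel_measurable borel" by measurable
  show "integrable \<sigma> (\<lambda>y. ln ((x - y)\<^sup>2 + \<epsilon>\<^sup>2) / 2)"
    using integral_semicircle(2)[OF m] g(2) unfolding e by simp
  have "smoothed_potential \<epsilon> x = Re (w\<^sup>2) / 2 - ln \<rho> / 2"
    unfolding smoothed_potential_def integral_semicircle(1)[OF m] e using g by simp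
  moreover have "Re (w\<^sup>2) = 2 * (Re w)\<^sup>2 - \<rho>"
    unfolding \<rho>_def cmod_power2 by (simp add: power2_eq_square)
  moreover have "(Re w)\<^sup>2 = x\<^sup>2 * (\<rho> / (1 + \<rho>))\<^sup>2" unfolding j(3) by (rule power_mult_distrib)
  ultimately have sp: "smoothed_potential \<epsilon> x - (x\<^sup>2 / 4 - 1 / 2)
      = x\<^sup>2 * ((\<rho> / (1 + \<rho>))\<^sup>2 - 1 / 4) + (1 - \<rho>) / 2 - ln \<rho> / 2"
    by (simp only: right_diff_distrib) (simp add: diff_divide_distrib)
  define r where "r = \<rho> / (1 + \<rho>)"
  have r: "0 \<le> r" "1 / 2 - r \<le> (1 - \<rho>) / 2" "r \<le> 1 / 2"
    unfolding r_def using j(1,2) by (auto simp: field_simps)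
  have x4: "x\<^sup>2 \<le> 4" using assms(3) abs_le_square_iff[of x 2] by simp
  have "\<bar>r\<^sup>2 - 1 / 4\<bar> = (1 / 2 - r) * (1 / 2 + r)"
  proof -
    have "r\<^sup>2 - 1 / 4 = - ((1 / 2 - r) * (1 / 2 + r))" by (simp add: power2_eq_square algebra_simps)
    then show ?thesis using r by simp
  qed
  also have "\<dots> \<le> (1 - \<rho>) / 2 * 1" using r by (intro mult_mono) auto
  finally have "\<bar>x\<^sup>2 * (r\<^sup>2 - 1 / 4)\<bar> \<le> 4 * ((1 - \<rho>) / 2)"
    unfolding abs_mult using x4 by (intro mult_mono) auto
  moreover have "ln \<rho> \<le> 0" using j(1,2) by simp
  ultimately have b: "\<bar>smoothed_potential \<epsilon> x - (x\<^sup>2 / 4 - 1 / 2)\<bar> \<le> 5 / 2 * (1 - \<rho>) - ln \<rho> / 2"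
    unfolding sp r_def[symmetric] by linarith
  \<comment> \<open>Insert the real and imaginary parts of w into the formula for its squared
    modulus \<rho>. With \<open>x^2 \<le> 4\<close> this gives
    \<open>(1 - \<rho>)^4 \<le> (2 * \<epsilon>)^2\<close>.\<close>
  have "(1 - \<rho>)\<^sup>2 \<le> 2 * \<epsilon>"
  proof -
    have "(Re w)\<^sup>2 + (Im w)\<^sup>2 = \<rho>" unfolding \<rho>_def cmod_power2 ..
    moreover have "(Re w)\<^sup>2 = x\<^sup>2 * (\<rho> / (1 + \<rho>))\<^sup>2" unfolding j(3) by (rule power_mult_distrib)
    moreover have "(Im w)\<^sup>2 = (\<epsilon> * \<rho> / (1 - \<rho>))\<^sup>2" unfolding j(4) by simp
    ultimately have "x\<^sup>2 * (\<rho> / (1 + \<rho>))\<^sup>2 + (\<epsilon> * \<rho> / (1 - \<rho>))\<^sup>2 = \<rho>" by simp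
    moreover have "x\<^sup>2 * (\<rho> / (1 + \<rho>))\<^sup>2 \<le> 4 * (\<rho> / (1 + \<rho>))\<^sup>2" using x4 by (intro mult_right_mono) auto
    ultimately have "\<rho> - 4 * (\<rho> / (1 + \<rho>))\<^sup>2 \<le> (\<epsilon> * \<rho> / (1 - \<rho>))\<^sup>2" by simp
    moreover have "\<rho> - 4 * (\<rho> / (1 + \<rho>))\<^sup>2 = \<rho> * ((1 - \<rho>) / (1 + \<rho>))\<^sup>2"
    proof -
      have sq: "(1 - \<rho>)\<^sup>2 = (1 + \<rho>)\<^sup>2 - 4 * \<rho>" by (simp add: power2_eq_square algebra_simps)
      have nz: "(1 + \<rho>)\<^sup>2 \<noteq> 0" using j(1) by simp
      have "((1 - \<rho>) / (1 + \<rho>))\<^sup>2 = ((1 + \<rho>)\<^sup>2 - 4 * \<rho>) / (1 + \<rho>)\<^sup>2" by (simp only: power_divide sq)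
      also have "\<dots> = 1 - 4 * \<rho> / (1 + \<rho>)\<^sup>2" using nz by (simp add: diff_divide_distrib)
      finally show ?thesis by (simp add: power_divide right_diff_distrib power2_eq_square[of \<rho>])
    qed
    ultimately have "\<rho> * ((1 - \<rho>) / (1 + \<rho>))\<^sup>2 \<le> (\<epsilon> * \<rho> / (1 - \<rho>))\<^sup>2" by simp
    also have "(\<epsilon> * \<rho> / (1 - \<rho>))\<^sup>2 = \<rho> * (\<epsilon>\<^sup>2 * \<rho> / (1 - \<rho>)\<^sup>2)"
      by (simp add: power_mult_distrib power_divide power2_eq_square)
    finally have "((1 - \<rho>) / (1 + \<rho>))\<^sup>2 \<le> \<epsilon>\<^sup>2 * \<rho> / (1 - \<rho>)\<^sup>2"
      by (simp only: mult_le_cancel_left_pos[OF j(1)])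
    then have "(1 - \<rho>)\<^sup>2 * (1 - \<rho>)\<^sup>2 \<le> \<epsilon>\<^sup>2 * \<rho> * (1 + \<rho>)\<^sup>2"
      using j(1,2) by (simp add: power_divide divide_simps mult_ac)
    also have "\<dots> \<le> \<epsilon>\<^sup>2 * 1 * 2\<^sup>2"
      using j(1,2) assms(1) by (intro mult_mono power_mono) auto
    finally have "((1 - \<rho>)\<^sup>2)\<^sup>2 \<le> (2 * \<epsilon>)\<^sup>2" by (simp add: power2_eq_square)
    then show ?thesis by (rule power2_le_imp_le) (use assms in simp)
  qed
  then have d: "1 - \<rho> \<le> sqrt (2 * \<epsilon>)" by (rule real_le_rsqrt)
  have s0: "0 \<le> sqrt (2 * \<epsilon>)" using assms(1) by simp
  have s1: "sqrt (2 * \<epsilon>) < 1" using assms by (simp add: real_sqrt_lt_1_iff)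
  have lnb: "ln (1 - sqrt (2 * \<epsilon>)) \<le> ln \<rho>" using d s1 j(1) by (subst ln_le_cancel_iff) auto
  have "5 / 2 * (1 - \<rho>) \<le> 5 / 2 * sqrt (2 * \<epsilon>)" using d by (intro mult_left_mono) auto
  also have "\<dots> \<le> 5 * sqrt (2 * \<epsilon>)" using s0 by simp
  finally have "5 / 2 * (1 - \<rho>) - ln \<rho> / 2 \<le> 5 * sqrt (2 * \<epsilon>) - ln (1 - sqrt (2 * \<epsilon>)) / 2"
    using lnb by (intro diff_mono divide_right_mono) auto
  then show "\<bar>smoothed_potential \<epsilon> x - (x\<^sup>2 / 4 - 1 / 2)\<bar> \<le> 5 * sqrt (2 * \<epsilon>) - ln (1 - sqrt (2 * \<epsilon>)) / 2"
    by (rule order_trans[OF b])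
qed

lemma semicircle_prob_UNIV[simp]: "measure \<sigma> UNIV = 1"
  using semicircle.prob_space by simp

lemma AE_semicircle_neq: "AE y in \<sigma>. y \<noteq> x"
  unfolding semicircular_law_def
  by (subst AE_density) (auto simp: semicircular_density_def intro!: AE_I'[OF emeasure_lborel_singleton[THEN null_setsI, of x]])

text \<open>\<open>ln t \<le> t - 1\<close> with \<open>t \<le> 17\<close>. The constant 8 is the
  shift that makes the logarithms one-signed in the integrals below.\<close>

lemma ln_add_le: "\<bar>x\<bar> \<le> 2 \<Longrightarrow> \<bar>y\<bar> \<le> 2 \<Longrightarrow> 0 < \<epsilon> \<Longrightarrow> \<epsilon> < 1 / 2 \<Longrightarrow> ln ((x - y)\<^sup>2 + \<epsilon>\<^sup>2) / 2 \<le> 8"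
  for x y \<epsilon> :: real
proof -
  assume a: "\<bar>x\<bar> \<le> 2" "\<bar>y\<bar> \<le> 2" "0 < \<epsilon>" "\<epsilon> < 1 / 2"
  have "(x - y)\<^sup>2 \<le> 4\<^sup>2" using a by (subst abs_le_square_iff[symmetric]) auto
  moreover have "\<epsilon>\<^sup>2 \<le> 1\<^sup>2" using a by (intro power_mono) auto
  moreover have p: "0 < (x - y)\<^sup>2 + \<epsilon>\<^sup>2" using a by (intro add_nonneg_pos) auto
  moreover have "ln ((x - y)\<^sup>2 + \<epsilon>\<^sup>2) \<le> (x - y)\<^sup>2 + \<epsilon>\<^sup>2 - 1" using p by (rule ln_le_minus_one)
  ultimately show ?thesis by simp
qed

text \<open>The limiting potential \<open>x^2 / 4 - 1 / 2\<close> has mean -1/4, because the second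
  moment is 1. The condition \<open>b \<le> 7\<close> keeps the comparison integrands nonnegative
  when \<open>x^2 \<le> 4\<close>.\<close>

lemma nn_integral_smoothed:
  assumes e: "0 < \<epsilon>" "\<epsilon> < 1 / 2"
  defines "b \<equiv> 5 * sqrt (2 * \<epsilon>) - ln (1 - sqrt (2 * \<epsilon>)) / 2"
  assumes b: "b \<le> 7"
  defines "I \<equiv> (dint \<sigma> (\<lambda>x y. ennreal (8 - ln ((x - y)\<^sup>2 + \<epsilon>\<^sup>2) / 2)))"
  shows "ennreal (8 + 1 / 4 - b) \<le> I" "I \<le> ennreal (8 + 1 / 4 + b)"
proof -
  have bd: "AE x in \<sigma>. \<bar>smoothed_potential \<epsilon> x - (x\<^sup>2 / 4 - 1 / 2)\<bar> \<le> b \<and> x\<^sup>2 \<le> 4 \<and>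
      (\<integral>\<^sup>+y. ennreal (8 - ln ((x - y)\<^sup>2 + \<epsilon>\<^sup>2) / 2) \<partial>\<sigma>) = ennreal (8 - smoothed_potential \<epsilon> x)"
    using AE_semicircle_bounded
  proof eventually_elim
    case (elim x)
    note sp = smoothed_potential_bound[OF e elim]
    have "(\<integral>\<^sup>+y. ennreal (8 - ln ((x - y)\<^sup>2 + \<epsilon>\<^sup>2) / 2) \<partial>\<sigma>)
      = ennreal (\<integral>y. 8 - ln ((x - y)\<^sup>2 + \<epsilon>\<^sup>2) / 2 \<partial>\<sigma>)"
    proof (rule nn_integral_eq_integral)
      show "AE y in \<sigma>. 0 \<le> 8 - ln ((x - y)\<^sup>2 + \<epsilon>\<^sup>2) / 2"
        using AE_semicircle_bounded
      proof eventually_elim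
        case (elim y)
        show ?case using ln_add_le[OF \<open>\<bar>x\<bar> \<le> 2\<close> elim e] by simp
      qed
    qed (use sp(2) in auto)
    also have "\<dots> = ennreal (8 - smoothed_potential \<epsilon> x)"
      unfolding smoothed_potential_def using sp(2) by (subst Bochner_Integration.integral_diff) auto
    finally show ?case using sp(1) elim abs_le_square_iff[of x 2] unfolding b_def by simp
  qed
  have I: "I = (\<integral>\<^sup>+x. ennreal (8 - smoothed_potential \<epsilon> x) \<partial>\<sigma>)"
    unfolding I_def by (rule nn_integral_cong_AE) (use bd in eventually_elim, blast)
  have val: "(\<integral>\<^sup>+x. ennreal (8 - x\<^sup>2 / 4 + 1 / 2 + d) \<partial>\<sigma>) = ennreal (8 + 1 / 4 + d)" if "- 7 \<le> d" for d
  proof -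
    have "(\<integral>\<^sup>+x. ennreal (8 - x\<^sup>2 / 4 + 1 / 2 + d) \<partial>\<sigma>) = ennreal (\<integral>x. 8 - x\<^sup>2 / 4 + 1 / 2 + d \<partial>\<sigma>)"
    proof (rule nn_integral_eq_integral)
      show "AE x in \<sigma>. 0 \<le> 8 - x\<^sup>2 / 4 + 1 / 2 + d"
        using bd by eventually_elim (use that in simp)
    qed (use semicircle_moments in auto)
    then show ?thesis
      using semicircle_moments by simp
  qed
  have "(\<integral>\<^sup>+x. ennreal (8 - x\<^sup>2 / 4 + 1 / 2 + - b) \<partial>\<sigma>) \<le> I"
    unfolding I
  proof (rule nn_integral_mono_AE)
    show "AE x in \<sigma>. ennreal (8 - x\<^sup>2 / 4 + 1 / 2 + - b) \<le> ennreal (8 - smoothed_potential \<epsilon> x)"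
      using bd by eventually_elim (intro ennreal_leI, linarith)
  qed
  then show "ennreal (8 + 1 / 4 - b) \<le> I" using val[of "- b"] b by simp
  have "I \<le> (\<integral>\<^sup>+x. ennreal (8 - x\<^sup>2 / 4 + 1 / 2 + b) \<partial>\<sigma>)"
    unfolding I
  proof (rule nn_integral_mono_AE)
    show "AE x in \<sigma>. ennreal (8 - smoothed_potential \<epsilon> x) \<le> ennreal (8 - x\<^sup>2 / 4 + 1 / 2 + b)"
      using bd by eventually_elim (intro ennreal_leI, linarith)
  qed
  moreover have "0 \<le> b"
  proof -
    have "\<bar>smoothed_potential \<epsilon> 0 - (0\<^sup>2 / 4 - 1 / 2)\<bar> \<le> b"
      unfolding b_def using smoothed_potential_bound(1)[OF e, of 0] by simp
    then show ?thesis by linarith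
  qed
  ultimately show "I \<le> ennreal (8 + 1 / 4 + b)" using val[of b] by simp
qed

text \<open>The logarithmic energy of the semicircle law is -1/4. The shifted integrands increase as
  the smoothing height decreases, so monotone convergence applies.\<close>

lemma nn_integral_log_semicircle:
  "dint \<sigma> (\<lambda>x y. ennreal (8 - ln \<bar>x - y\<bar>)) = ennreal (8 + 1 / 4)"
proof -
  define e where "e n = 1 / (real n + 3)" for n
  have e: "0 < e n" "e n < 1 / 2" for n by (auto simp: e_def field_simps)
  define f where "f n x y = ennreal (8 - ln ((x - y)\<^sup>2 + (e n)\<^sup>2) / 2)" for n x y
  have [measurable]: "(\<lambda>(x, y). f n x y) \<in> borel_measurable (borel \<Otimes>\<^sub>M borel)" for n unfolding f_def by measurable
  \<comment> \<open>The pointwise limit, infinite on the diagonal where \<open>ln 0 = 0\<close>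
    would give a finite value. The diagonal is null, so \<open>u\<close> is exchanged for the stated
    integrand at the end.\<close>
  define u where "u x y = (if x = y then \<infinity> else ennreal (8 - ln \<bar>x - y\<bar>))" for x y :: real
  have e0: "e \<longlonglongrightarrow> 0" unfolding e_def by real_asymp
  have inc: "f m x y \<le> f n x y" if "m \<le> n" for m n x y
  proof -
    have "e n \<le> e m" using that by (auto simp: e_def field_simps)
    then have "(e n)\<^sup>2 \<le> (e m)\<^sup>2" using e by (intro power_mono) (auto intro: less_imp_le)
    moreover have "0 < (x - y)\<^sup>2 + (e n)\<^sup>2" using e[of n] by (intro add_nonneg_pos) auto
    ultimately have "ln ((x - y)\<^sup>2 + (e n)\<^sup>2) \<le> ln ((x - y)\<^sup>2 + (e m)\<^sup>2)" by (subst ln_le_cancel_iff) auto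
    then show ?thesis unfolding f_def by (intro ennreal_leI) auto
  qed
  have lim: "(\<lambda>n. f n x y) \<longlonglongrightarrow> u x y" for x y
  proof (cases "x = y")
    case True
    have "(\<lambda>n. ennreal (8 - ln ((e n)\<^sup>2) / 2)) \<longlonglongrightarrow> \<infinity>"
    proof -
      have "filterlim (\<lambda>n. 8 - ln ((e n)\<^sup>2) / 2) at_top sequentially"
        unfolding e_def by real_asymp
      then show ?thesis unfolding infinity_ennreal_def by (simp add: ennreal_tendsto_top_eq_at_top)
    qed
    then show ?thesis using True by (simp add: f_def u_def)
  next
    case False
    then have "(\<lambda>n. 8 - ln ((x - y)\<^sup>2 + (e n)\<^sup>2) / 2) \<longlonglongrightarrow> 8 - ln ((x - y)\<^sup>2 + 0\<^sup>2) / 2"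
      by (intro tendsto_intros e0) auto
    moreover have "ln ((x - y)\<^sup>2 + 0\<^sup>2) / 2 = ln \<bar>x - y\<bar>"
      using False ln_realpow[of "\<bar>x - y\<bar>" 2] by simp
    ultimately show ?thesis using False by (auto simp: f_def u_def intro!: tendsto_ennrealI)
  qed
  have lim1: "(\<lambda>n. \<integral>\<^sup>+y. f n x y \<partial>\<sigma>) \<longlonglongrightarrow> (\<integral>\<^sup>+y. u x y \<partial>\<sigma>)" for x
    by (rule nn_integral_LIMSEQ) (use inc lim in \<open>auto simp: incseq_def le_fun_def\<close>)
  have "(\<lambda>n. \<integral>\<^sup>+x. \<integral>\<^sup>+y. f n x y \<partial>\<sigma> \<partial>\<sigma>)
    \<longlonglongrightarrow> (dint \<sigma> (\<lambda>x y. u x y))"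
    by (rule nn_integral_LIMSEQ) (use inc lim1 in \<open>auto simp: incseq_def le_fun_def intro!: nn_integral_mono\<close>)
  moreover define b where "b n = 5 * sqrt (2 * e n) - ln (1 - sqrt (2 * e n)) / 2" for n
  have b0: "b \<longlonglongrightarrow> 0" unfolding b_def e_def by real_asymp
  then have "\<forall>\<^sub>F n in sequentially. b n < 7" by (rule order_tendstoD) simp
  then have ev: "\<forall>\<^sub>F n in sequentially. b n \<le> 7" by eventually_elim simp
  have "(\<lambda>n. \<integral>\<^sup>+x. \<integral>\<^sup>+y. f n x y \<partial>\<sigma> \<partial>\<sigma>) \<longlonglongrightarrow> ennreal (8 + 1 / 4)"
  proof (rule tendsto_sandwich)
    show "\<forall>\<^sub>F n in sequentially. ennreal (8 + 1 / 4 - b n) \<le> dint \<sigma> (\<lambda>x y. f n x y)"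
      using ev by eventually_elim (use nn_integral_smoothed(1)[OF e] in \<open>simp add: f_def b_def\<close>)
    show "\<forall>\<^sub>F n in sequentially. (dint \<sigma> (\<lambda>x y. f n x y)) \<le> ennreal (8 + 1 / 4 + b n)"
      using ev by eventually_elim (use nn_integral_smoothed(2)[OF e] in \<open>simp add: f_def b_def\<close>)
    show "(\<lambda>n. ennreal (8 + 1 / 4 - b n)) \<longlonglongrightarrow> ennreal (8 + 1 / 4)"
      by (rule tendsto_ennrealI) (use tendsto_diff[OF tendsto_const b0, of "8 + 1 / 4"] in simp)
    show "(\<lambda>n. ennreal (8 + 1 / 4 + b n)) \<longlonglongrightarrow> ennreal (8 + 1 / 4)"
      by (rule tendsto_ennrealI) (use tendsto_add[OF tendsto_const b0, of "8 + 1 / 4"] in simp)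
  qed
  ultimately have "dint \<sigma> (\<lambda>x y. u x y) = ennreal (8 + 1 / 4)"
    by (rule LIMSEQ_unique)
  moreover have "(\<integral>\<^sup>+y. u x y \<partial>\<sigma>) = (\<integral>\<^sup>+y. ennreal (8 - ln \<bar>x - y\<bar>) \<partial>\<sigma>)" for x
    by (rule nn_integral_cong_AE) (use AE_semicircle_neq[of x] in eventually_elim, auto simp: u_def)
  ultimately show ?thesis by simp
qed

lemma nn_integral_square_semicircle:
  "dint \<sigma> (\<lambda>x y. ennreal ((x - y)\<^sup>2)) = 2"
proof -
  have eq: "(x - y)\<^sup>2 = x\<^sup>2 - 2 * x * y + y\<^sup>2" for x y :: real by (simp add: power2_eq_square algebra_simps)
  have i: "integrable \<sigma> (\<lambda>y. (x - y)\<^sup>2)" for x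
    unfolding eq using semicircle_moments by auto
  have "(\<integral>\<^sup>+y. ennreal ((x - y)\<^sup>2) \<partial>\<sigma>) = ennreal (\<integral>y. (x - y)\<^sup>2 \<partial>\<sigma>)" for x
    using i by (intro nn_integral_eq_integral) auto
  moreover have "(\<integral>y. (x - y)\<^sup>2 \<partial>\<sigma>) = x\<^sup>2 + 1" for x
    unfolding eq using semicircle_moments semicircle.prob_space by simp
  ultimately have "dint \<sigma> (\<lambda>x y. ennreal ((x - y)\<^sup>2)) = (\<integral>\<^sup>+x. ennreal (x\<^sup>2 + 1) \<partial>\<sigma>)"
    by simp
  also have "\<dots> = ennreal (\<integral>x. x\<^sup>2 + 1 \<partial>\<sigma>)"
    using semicircle_moments by (intro nn_integral_eq_integral) auto
  also have "\<dots> = 2" using semicircle_moments semicircle.prob_space by simp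
  finally show ?thesis .
qed

text \<open>The quadratic part contributes 1/2 times 2 and the logarithm 2 times 1/4; adding 16 pays
  for two shifts by 8.\<close>

lemma pair_cost_semicircle:
  "dint \<sigma> (\<lambda>x y. pair_cost ((x - y) * (x - y))) = ennreal (3 / 2)" (is "?E = _")
proof -
  have "AE x in \<sigma>. AE y in \<sigma>. pair_cost ((x - y) * (x - y)) + 16 = ennreal (1 / 2) * ennreal ((x - y)\<^sup>2) + 2 * ennreal (8 - ln \<bar>x - y\<bar>)"
    using AE_semicircle_bounded
  proof eventually_elim
    case (elim x)
    show ?case
      using AE_semicircle_bounded AE_semicircle_neq[of x]
    proof eventually_elim
      case (elim y)
      define d where "d = \<bar>x - y\<bar>"
      have d: "0 < d" "d \<le> 4" using \<open>\<bar>x\<bar> \<le> 2\<close> elim unfolding d_def by auto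
      have dd: "(x - y) * (x - y) = d\<^sup>2" unfolding d_def by (simp add: power2_eq_square)
      have "ln d \<le> d - 1" using d(1) by (rule ln_le_minus_one)
      then have l: "0 \<le> 8 - ln d" using d by simp
      have p: "0 \<le> d\<^sup>2 / 2 - ln (d\<^sup>2)" using d by (intro pair_cost_nonneg) auto
      have "ennreal (d\<^sup>2 / 2 - ln (d\<^sup>2)) + ennreal 16 = ennreal (d\<^sup>2 / 2 - ln (d\<^sup>2) + 16)"
        using p by (intro ennreal_plus[symmetric]) auto
      also have "d\<^sup>2 / 2 - ln (d\<^sup>2) + 16 = 1 / 2 * d\<^sup>2 + 2 * (8 - ln d)"
        using d by (simp add: ln_realpow)
      also have "ennreal (1 / 2 * d\<^sup>2 + 2 * (8 - ln d)) = ennreal (1 / 2 * d\<^sup>2) + ennreal (2 * (8 - ln d))"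
        using l by (intro ennreal_plus) auto
      also have "\<dots> = ennreal (1 / 2) * ennreal (d\<^sup>2) + ennreal 2 * ennreal (8 - ln d)"
        using l by (simp only: ennreal_mult'[symmetric] zero_le_numeral zero_le_divide_1_iff)
      finally show ?case using d unfolding pair_cost_def dd power2_eq_square[of "x - y"] d_def[symmetric]
        by (simp add: not_le)
    qed
  qed
  then have "dint \<sigma> (\<lambda>x y. pair_cost ((x - y) * (x - y)) + 16)
      = dint \<sigma> (\<lambda>x y. ennreal (1 / 2) * ennreal ((x - y)\<^sup>2) + 2 * ennreal (8 - ln \<bar>x - y\<bar>))"
    by (rule dint_cong_AE)
  then have "?E + 16 = ennreal (1 / 2) * 2 + 2 * ennreal (8 + 1 / 4)"
    unfolding nn_integral_square_semicircle[symmetric] nn_integral_log_semicircle[symmetric]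
    using semicircle.emeasure_space_1
    by (simp add: nn_integral_add nn_integral_cmult)
  also have "\<dots> = ennreal (3 / 2) + 16"
  proof -
    have "ennreal (1 / 2) * 2 = ennreal 1"
      using ennreal_mult'[of "1 / 2" 2] by (simp only: ennreal_numeral zero_le_divide_1_iff zero_le_numeral) simp
    moreover have "2 * ennreal (8 + 1 / 4) = ennreal (33 / 2)"
      using ennreal_mult'[of 2 "8 + 1 / 4"] by (simp only: ennreal_numeral zero_le_numeral) simp
    moreover have "ennreal 1 + ennreal (33 / 2) = ennreal (3 / 2) + ennreal 16"
      by (simp only: ennreal_plus[symmetric]) simp
    ultimately show ?thesis by (simp only: ennreal_numeral zero_le_numeral)
  qed
  finally have "16 + ?E = 16 + ennreal (3 / 2)" by (simp add: add.commute)
  then show ?thesis by (simp add: ennreal_add_left_cancel)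
qed

section \<open>Minimality of the semicircle law\<close>

locale semicircle_reference = reference_measure +
  fixes S :: "real \<Rightarrow> real"
  assumes monoS: "mono S" and distrS: "distr M borel S = \<sigma>"
begin

lemma measS[measurable]: "S \<in> borel_measurable borel"
  using monoS by (rule borel_measurable_mono)

lemma integral_S:
  fixes f :: "real \<Rightarrow> real"
  assumes [measurable]: "f \<in> borel_measurable borel"
  shows "expectation (\<lambda>u. f (S u)) = (\<integral>x. f x \<partial>\<sigma>)"
    and "integrable M (\<lambda>u. f (S u)) \<longleftrightarrow> integrable \<sigma> f"
  unfolding distrS[symmetric] by (simp_all add: integral_distr integrable_distr_eq)

lemma nn_integral_S:
  assumes [measurable]: "f \<in> borel_measurable borel"
  shows "(\<integral>\<^sup>+u. f (S u) \<partial>M) = (\<integral>\<^sup>+x. f x \<partial>\<sigma>)"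
  unfolding distrS[symmetric] by (simp add: nn_integral_distr)

lemma nn_integral_S_pair:
  assumes [measurable]: "F \<in> borel_measurable (borel \<Otimes>\<^sub>M borel)"
  shows "dint M (\<lambda>u w. F (S u, S w)) = dint \<sigma> (\<lambda>x y. F (x, y))"
proof -
  have "(\<integral>\<^sup>+w. F (x, S w) \<partial>M) = (\<integral>\<^sup>+y. F (x, y) \<partial>\<sigma>)" for x
    by (rule nn_integral_S[where f = "\<lambda>y. F (x, y)"]) measurable
  moreover have "(\<lambda>x. \<integral>\<^sup>+y. F (x, y) \<partial>\<sigma>) \<in> borel_measurable borel" by measurable
  ultimately show ?thesis
    using nn_integral_S[of "\<lambda>x. \<integral>\<^sup>+y. F (x, y) \<partial>\<sigma>"] by (simp only:)
qed

lemma energy_S: "energy S S = ennreal (3 / 2)"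
  using nn_integral_S_pair[of "\<lambda>(x, y). pair_cost ((x - y) * (x - y))"]
  unfolding energy_def pair_cost_semicircle[symmetric] by simp

lemma AE_S_bounded: "AE u in M. \<bar>S u\<bar> \<le> 2"
proof -
  have "AE x in distr M borel S. \<bar>x\<bar> \<le> 2" unfolding distrS by (rule AE_semicircle_bounded)
  then show ?thesis by (subst (asm) AE_distr_iff) auto
qed

lemma S_moments: "integrable M S" "expectation S = 0"
proof -
  have m: "(\<lambda>x :: real. x) \<in> borel_measurable borel" by simp
  show "integrable M S" "expectation S = 0"
    using integral_S[OF m] semicircle_moments by simp_all
qed

lemma AE_S_distinct: "AE u in M. AE w in M. 0 < (S u - S w) * (S u - S w)"
  by (rule energy_finite_AE[OF measS measS]) (simp add: energy_S)

lemma S_takes_both_signs: "\<exists>u. S u < 0" "\<exists>u. 0 < S u"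
proof -
  have False if "(\<forall>u. 0 \<le> S u) \<or> (\<forall>u. S u \<le> 0)"
  proof -
    have "AE u in M. S u = 0"
    proof (cases "\<forall>u. 0 \<le> S u")
      case True
      then show ?thesis
        using integral_nonneg_eq_0_iff_AE[of M S] S_moments by simp
    next
      case False
      then have "\<forall>u. S u \<le> 0" using that by blast
      then show ?thesis
        using integral_nonneg_eq_0_iff_AE[of M "\<lambda>u. - S u"] S_moments by simp
    qed
    then have zero: "AE u in M. S u = 0" .
    have "AE u in M. S u = 0 \<and> (AE w in M. 0 < (S u - S w) * (S u - S w))"
      using zero AE_S_distinct by eventually_elim simp
    then obtain u where "S u = 0 \<and> (AE w in M. 0 < (S u - S w) * (S u - S w))"
      by (rule AE_obtain)
    then have u: "S u = 0" "AE w in M. 0 < (S u - S w) * (S u - S w)" by blast+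
    have "AE w in M. False" using zero u(2) by eventually_elim (simp add: u(1))
    then show False by simp
  qed
  then show "\<exists>u. S u < 0" "\<exists>u. 0 < S u" by (meson not_le)+
qed

text \<open>\<open>expectation_resolvent\<close> bounds the Hilbert transform by half of S only up
  to sign. Shifting Z so that it changes sign together with S lets that bound be multiplied by
  Z.\<close>

lemma center_at_sign_change:
  fixes Z :: "real \<Rightarrow> real"
  assumes "mono Z"
  obtains c where "\<And>u. 0 \<le> (Z u - c) * S u"
proof -
  define c where "c = Sup (Z ` {u. S u < 0})"
  obtain p where p: "0 < S p" using S_takes_both_signs by auto
  have lt: "u < v" if "S u < 0" "0 < S v" for u v
    using that monoD[OF monoS, of v u] by (meson leI less_trans not_less)
  have bdd: "bdd_above (Z ` {u. S u < 0})"
    using lt[OF _ p] monoD[OF assms] by (intro bdd_aboveI2[of _ _ "Z p"]) (auto intro: less_imp_le)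
  have "0 \<le> (Z u - c) * S u" for u
  proof (cases "S u" "0 :: real" rule: linorder_cases)
    case less
    then have "Z u \<le> c" unfolding c_def using bdd by (intro cSup_upper) auto
    then show ?thesis using less by (intro mult_nonpos_nonpos) auto
  next
    case greater
    then have "c \<le> Z u"
      unfolding c_def using S_takes_both_signs lt[OF _ greater] monoD[OF assms]
      by (intro cSup_least) (auto intro: less_imp_le)
    then show ?thesis using greater by simp
  qed simp
  then show ?thesis by (rule that)
qed

lemma integrable_mult_S:
  assumes "integrable M Z"
  shows "integrable M (\<lambda>u. Z u * S u)"
proof (rule Bochner_Integration.integrable_bound)
  show "integrable M (\<lambda>u. 2 * Z u)" using assms by simp
  show "AE u in M. norm (Z u * S u) \<le> norm (2 * Z u)"
    using AE_S_bounded
  proof eventually_elim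
    case (elim u)
    then have "\<bar>S u\<bar> * \<bar>Z u\<bar> \<le> 2 * \<bar>Z u\<bar>" by (rule mult_right_mono) simp
    then show ?case by (simp add: abs_mult mult.commute)
  qed
qed (use assms in measurable)

lemma nn_integral_bilinear_S:
  fixes Z :: "real \<Rightarrow> real"
  assumes "mono Z" and Z: "integrable M Z"
  shows "dint M (\<lambda>u w. ennreal ((Z u - Z w) * (S u - S w))) = ennreal (2 * expectation (\<lambda>u. Z u * S u))"
proof -
  have "ennreal ((Z u - Z w) * (S u - S w)) = 2 * ennreal ((Z u - Z w) * (S u - S w) / 2)" for u w
    using ennreal_mult'[of 2 "(Z u - Z w) * (S u - S w) / 2"] by simp
  moreover have [measurable]: "Z \<in> borel_measurable borel" using assms(1) by (rule borel_measurable_mono)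
  ultimately have "dint M (\<lambda>u w. ennreal ((Z u - Z w) * (S u - S w))) = 2 * dint M (\<lambda>u w. ennreal ((Z u - Z w) * (S u - S w) / 2))"
    by (simp add: nn_integral_cmult)
  also have "\<dots> = 2 * ennreal (expectation (\<lambda>u. Z u * S u))"
    using covariance_mono(1)[OF assms(1) monoS Z S_moments(1) integrable_mult_S[OF Z]] S_moments(2) by simp
  finally show ?thesis using ennreal_mult'[of 2 "expectation (\<lambda>u. Z u * S u)"] by simp
qed

text \<open>The kernel \<open>k\<close> is bounded for fixed \<epsilon>, so the terms with
  \<open>Z u\<close> and \<open>Z w\<close> can be integrated separately. By Fubini and skew
  symmetry both give the mean of \<open>Z u * \<kappa> u\<close>, where
  \<open>\<kappa> u = q * S u\<close> with q in [0, 1/2].\<close>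

lemma nn_integral_smoothed_slope:
  fixes Z :: "real \<Rightarrow> real"
  assumes "mono Z" and Z: "integrable M Z" and sgn: "\<And>u. 0 \<le> Z u * S u" and e: "0 < \<epsilon>"
  shows "dint M (\<lambda>u w. ennreal ((Z u - Z w) * ((S u - S w) / ((S u - S w)\<^sup>2 + \<epsilon>\<^sup>2)))) \<le> ennreal (expectation (\<lambda>u. Z u * S u))"
proof -
  define k where "k u w = (S u - S w) / ((S u - S w)\<^sup>2 + \<epsilon>\<^sup>2)" for u w
  have [measurable]: "Z \<in> borel_measurable borel" using assms(1) by (rule borel_measurable_mono)
  have [measurable]: "(\<lambda>(u, w). k u w) \<in> borel_measurable (borel \<Otimes>\<^sub>M borel)" unfolding k_def by measurable
  have [measurable]: "k u \<in> borel_measurable borel" "(\<lambda>u. k u w) \<in> borel_measurable borel" for u w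
    unfolding k_def by measurable
  have kb: "\<bar>k u w\<bar> \<le> 1 / \<epsilon>" for u w
  proof -
    define d where "d = \<bar>S u - S w\<bar>"
    have "0 \<le> (d - \<epsilon>)\<^sup>2 + d * \<epsilon>" using e unfolding d_def by simp
    then have "d * \<epsilon> \<le> d\<^sup>2 + \<epsilon>\<^sup>2" by (simp add: power2_eq_square algebra_simps)
    moreover have "0 < d\<^sup>2 + \<epsilon>\<^sup>2" using e by (intro add_nonneg_pos) auto
    ultimately have "d / (d\<^sup>2 + \<epsilon>\<^sup>2) \<le> 1 / \<epsilon>" using e by (simp add: field_simps)
    then show ?thesis unfolding k_def d_def by (simp add: abs_mult)
  qed
  have skew: "k w u = - k u w" for u w
    unfolding k_def by (metis minus_diff_eq minus_divide_left power2_commute)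
  have nn: "0 \<le> (Z u - Z w) * k u w" for u w
  proof -
    have "0 \<le> (Z u - Z w) * (S u - S w)"
      using cosigned_mono[OF assms(1) monoS, of u w] by (auto simp: cosigned_def intro: mult_nonpos_nonpos)
    then show ?thesis unfolding k_def times_divide_eq_right by (rule divide_nonneg_nonneg) simp
  qed
  have ik: "integrable M (k u)" for u
    by (rule integrable_const_bound[where B = "1 / \<epsilon>"]) (use kb in auto)
  have Zk: "\<bar>Z w * k u w\<bar> \<le> 1 / \<epsilon> * \<bar>Z w\<bar>" for u w
    using mult_right_mono[OF kb[of u w], of "\<bar>Z w\<bar>"] by (simp add: abs_mult mult.commute)
  have iZk: "integrable M (\<lambda>w. Z w * k u w)" for u
  proof (rule Bochner_Integration.integrable_bound)
    show "integrable M (\<lambda>w. 1 / \<epsilon> * \<bar>Z w\<bar>)" using Z by simp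
    show "AE w in M. norm (Z w * k u w) \<le> norm (1 / \<epsilon> * \<bar>Z w\<bar>)"
      using Zk e by (intro AE_I2) (simp add: abs_mult)
  qed measurable
  define \<kappa> where "\<kappa> u = expectation (k u)" for u
  have \<kappa>: "\<exists>q. 0 \<le> q \<and> q \<le> 1 / 2 \<and> \<kappa> u = q * S u" for u
  proof -
    have "\<kappa> u = (\<integral>y. (S u - y) / ((S u - y)\<^sup>2 + \<epsilon>\<^sup>2) \<partial>\<sigma>)"
      unfolding \<kappa>_def k_def by (rule integral_S(1)) measurable
    then show ?thesis using expectation_resolvent[OF e, of "S u"] by simp
  qed
  have [measurable]: "\<kappa> \<in> borel_measurable borel" unfolding \<kappa>_def[abs_def] by measurable
  have Z\<kappa>: "Z u * \<kappa> u \<le> Z u * S u / 2" "0 \<le> Z u * \<kappa> u" for u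
  proof -
    obtain q where q: "0 \<le> q" "q \<le> 1 / 2" "\<kappa> u = q * S u" using \<kappa> by blast
    then have eq: "Z u * \<kappa> u = q * (Z u * S u)" by simp
    show "Z u * \<kappa> u \<le> Z u * S u / 2" "0 \<le> Z u * \<kappa> u"
      unfolding eq using sgn[of u] q(1) mult_right_mono[OF q(2) sgn[of u]] by (simp_all only: mult_nonneg_nonneg)
  qed
  have iZ\<kappa>: "integrable M (\<lambda>u. Z u * \<kappa> u)"
  proof (rule Bochner_Integration.integrable_bound[OF integrable_mult_S[OF Z]])
    have "\<bar>Z u * \<kappa> u\<bar> \<le> \<bar>Z u * S u\<bar>" for u using Z\<kappa>[of u] sgn[of u] by linarith
    then show "AE u in M. norm (Z u * \<kappa> u) \<le> norm (Z u * S u)" by (intro AE_I2) simp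
  qed measurable
  define T where "T u = expectation (\<lambda>w. Z w * k u w)" for u
  have pint: "integrable (M \<Otimes>\<^sub>M M) (\<lambda>(u, w). Z w * k u w)"
  proof (rule pair.Fubini_integrable)
    show "integrable M (\<lambda>u. \<integral>w. norm (case (u, w) of (u, w) \<Rightarrow> Z w * k u w) \<partial>M)"
    proof (rule integrable_const_bound[where B = "\<integral>w. 1 / \<epsilon> * \<bar>Z w\<bar> \<partial>M"])
      show "AE u in M. norm (\<integral>w. norm (case (u, w) of (u, w) \<Rightarrow> Z w * k u w) \<partial>M) \<le> (\<integral>w. 1 / \<epsilon> * \<bar>Z w\<bar> \<partial>M)"
      proof (rule AE_I2)
        fix u
        have "(\<integral>w. \<bar>Z w * k u w\<bar> \<partial>M) \<le> (\<integral>w. 1 / \<epsilon> * \<bar>Z w\<bar> \<partial>M)"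
        proof (intro integral_mono)
          show "\<bar>Z w * k u w\<bar> \<le> 1 / \<epsilon> * \<bar>Z w\<bar>" for w by (rule Zk)
        qed (use Z iZk in auto)
        then show "norm (\<integral>w. norm (case (u, w) of (u, w) \<Rightarrow> Z w * k u w) \<partial>M) \<le> (\<integral>w. 1 / \<epsilon> * \<bar>Z w\<bar> \<partial>M)"
          by simp
      qed
    qed measurable
  qed (use iZk in auto)
  have T: "integrable M T" "expectation T = - expectation (\<lambda>u. Z u * \<kappa> u)"
  proof -
    show "integrable M T" unfolding T_def using pair.integrable_fst'[OF pint] by simp
    have "expectation T = (\<integral>u. \<integral>w. Z w * k u w \<partial>M \<partial>M)" unfolding T_def ..
    also have "\<dots> = (\<integral>w. \<integral>u. Z w * k u w \<partial>M \<partial>M)"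
      by (rule pair.Fubini_integral[symmetric]) (rule pint)
    also have "\<dots> = (\<integral>w. - (Z w * \<kappa> w) \<partial>M)"
    proof (rule Bochner_Integration.integral_cong[OF refl])
      fix w
      have "Z w * k u w = - Z w * k w u" for u by (subst skew) simp
      then have "(\<integral>u. Z w * k u w \<partial>M) = (\<integral>u. - Z w * k w u \<partial>M)" by (simp only:)
      then show "(\<integral>u. Z w * k u w \<partial>M) = - (Z w * \<kappa> w)" unfolding \<kappa>_def by simp
    qed
    finally show "expectation T = - expectation (\<lambda>u. Z u * \<kappa> u)" by simp
  qed
  define g where "g u = Z u * \<kappa> u - T u" for u
  have eq: "(Z u - Z w) * k u w = Z u * k u w - Z w * k u w" for u w by (simp add: algebra_simps)
  have i: "integrable M (\<lambda>w. (Z u - Z w) * k u w)" for u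
    unfolding eq using ik iZk by auto
  have g: "expectation (\<lambda>w. (Z u - Z w) * k u w) = g u" for u
    unfolding eq g_def T_def \<kappa>_def using ik iZk by simp
  have "(\<integral>\<^sup>+w. ennreal ((Z u - Z w) * k u w) \<partial>M) = ennreal (g u)" for u
    using i nn unfolding g[symmetric] by (intro nn_integral_eq_integral) auto
  then have "dint M (\<lambda>u w. ennreal ((Z u - Z w) * k u w)) = (\<integral>\<^sup>+u. ennreal (g u) \<partial>M)"
    by simp
  also have "\<dots> = ennreal (expectation g)"
  proof (rule nn_integral_eq_integral)
    show "integrable M g" unfolding g_def using iZ\<kappa> T by auto
    show "AE u in M. 0 \<le> g u" unfolding g[symmetric] using nn by (intro AE_I2 integral_nonneg_AE) auto
  qed
  also have "expectation g = 2 * expectation (\<lambda>u. Z u * \<kappa> u)"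
    unfolding g_def using iZ\<kappa> T by simp
  also have "ennreal \<dots> \<le> ennreal (expectation (\<lambda>u. Z u * S u))"
  proof (rule ennreal_leI)
    have "expectation (\<lambda>u. Z u * \<kappa> u) \<le> expectation (\<lambda>u. Z u * S u / 2)"
      using Z\<kappa> iZ\<kappa> integrable_mult_S[OF Z] by (intro integral_mono) auto
    then show "2 * expectation (\<lambda>u. Z u * \<kappa> u) \<le> expectation (\<lambda>u. Z u * S u)" by simp
  qed
  finally show ?thesis unfolding k_def .
qed

end

lemma tangent_remainder_nonneg:
  fixes z s :: real
  assumes "0 < z * s"
  shows "0 \<le> (z - s)\<^sup>2 / 2 + 2 * (z / s - 1 - ln (z / s))"
proof -
  have "0 < z / s" using assms by (auto simp: zero_less_mult_iff zero_less_divide_iff)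
  then have "ln (z / s) \<le> z / s - 1" by (rule ln_le_minus_one)
  then show ?thesis by simp
qed

text \<open>The remainder of \<open>z^2 / 2 - 2 * ln z\<close> above its tangent at s is the sum of
  the convexity gaps of the square and of the logarithm. The linear terms are distributed over both
  sides to stay nonnegative.\<close>

lemma pair_cost_tangent:
  fixes z s :: real
  assumes zs: "0 < z * s"
  defines "rem \<equiv> (z - s)\<^sup>2 / 2 + 2 * (z / s - 1 - ln (z / s))"
  shows "pair_cost (z * z) + (2 * ennreal (z / s) + ennreal (s\<^sup>2)) = pair_cost (s * s) + (ennreal (z * s) + 2 + ennreal rem)"
proof -
  have nz: "z \<noteq> 0" "s \<noteq> 0" using zs by auto
  have p: "0 < z * z" "0 < s * s" using nz by (auto simp: zero_less_mult_iff)
  have q: "0 < z / s" using zs by (auto simp: zero_less_mult_iff zero_less_divide_iff)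
  have lzs: "ln (z * z) = ln (s * s) + 2 * ln (z / s)"
  proof -
    have "z * z = (s * s) * ((z / s) * (z / s))" using nz by simp
    then have "ln (z * z) = ln (s * s) + ln ((z / s) * (z / s))" using p q by (simp only: ln_mult_pos mult_pos_pos)
    then show ?thesis using q by (simp only: ln_mult_pos)
  qed
  have "rem = (z * z / 2 - z * s + s * s / 2) + 2 * (z / s - 1 - ln (z / s))"
    unfolding rem_def by (simp add: power2_eq_square algebra_simps add_divide_distrib diff_divide_distrib)
  then have id: "z * z / 2 - ln (z * z) + (2 * (z / s) + s\<^sup>2) = s * s / 2 - ln (s * s) + (z * s + 2 + rem)"
    unfolding lzs by (simp add: power2_eq_square)
  have r: "0 \<le> rem" unfolding rem_def by (rule tangent_remainder_nonneg[OF zs])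
  have "pair_cost (z * z) + (2 * ennreal (z / s) + ennreal (s\<^sup>2)) = ennreal (z * z / 2 - ln (z * z) + (2 * (z / s) + s\<^sup>2))"
  proof -
    have "2 * ennreal (z / s) = ennreal (2 * (z / s))" using ennreal_mult'[of 2 "z / s"] by (simp only: ennreal_numeral zero_le_numeral)
    moreover have "pair_cost (z * z) = ennreal (z * z / 2 - ln (z * z))" using p by (simp add: pair_cost_def)
    moreover have "0 \<le> 2 * (z / s)" using q by simp
    ultimately show ?thesis
      using pair_cost_nonneg[OF p(1)] by (simp only: ennreal_plus zero_le_power2 add_nonneg_nonneg)
  qed
  also have "\<dots> = pair_cost (s * s) + (ennreal (z * s) + 2 + ennreal rem)"
    unfolding id
  proof -
    have "pair_cost (s * s) = ennreal (s * s / 2 - ln (s * s))" using p by (simp add: pair_cost_def)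
    moreover have "2 = ennreal 2" by simp
    ultimately show "ennreal (s * s / 2 - ln (s * s) + (z * s + 2 + rem)) = pair_cost (s * s) + (ennreal (z * s) + 2 + ennreal rem)"
      using pair_cost_nonneg[OF p(2)] zs r by (simp only: ennreal_plus add_nonneg_nonneg less_imp_le zero_le_numeral)
  qed
  finally show ?thesis .
qed

context semicircle_reference begin

lemma nn_integral_slope:
  fixes Z :: "real \<Rightarrow> real"
  assumes mono: "mono Z" and Z: "integrable M Z"
  shows "2 * (dint M (\<lambda>u w. ennreal ((Z u - Z w) / (S u - S w)))) \<le> dint M (\<lambda>u w. ennreal ((Z u - Z w) * (S u - S w)))"
proof -
  \<comment> \<open>A shift leaves all increments unchanged and provides the sign hypothesis of
    \<open>nn_integral_smoothed_slope\<close>.\<close>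
  obtain c where c: "\<And>u. 0 \<le> (Z u - c) * S u" using center_at_sign_change[OF mono] by blast
  define Z' where "Z' u = Z u - c" for u
  have Z': "mono Z'" "integrable M Z'" "\<And>u. 0 \<le> Z' u * S u"
    unfolding Z'_def using monoD[OF mono] Z c by (auto intro!: monoI)
  have d: "Z u - Z w = Z' u - Z' w" for u w unfolding Z'_def by simp
  define e where "e n = 1 / (real n + 1)" for n
  have e: "0 < e n" for n by (simp add: e_def)
  have e0: "e \<longlonglongrightarrow> 0" unfolding e_def by real_asymp
  define f where "f n u w = ennreal ((Z' u - Z' w) * ((S u - S w) / ((S u - S w)\<^sup>2 + (e n)\<^sup>2)))" for n u w
  have [measurable]: "Z' \<in> borel_measurable borel" using Z'(1) by (rule borel_measurable_mono)
  have [measurable]: "(\<lambda>(u, w). f n u w) \<in> borel_measurable (M \<Otimes>\<^sub>M M)" for n unfolding f_def by measurable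
  have lim: "(\<lambda>n. f n u w) \<longlonglongrightarrow> ennreal ((Z' u - Z' w) / (S u - S w))" if "0 < (S u - S w) * (S u - S w)" for u w
  proof -
    have nz: "S u - S w \<noteq> 0" using that by auto
    then have "(S u - S w)\<^sup>2 + 0\<^sup>2 \<noteq> 0" by simp
    then have "(\<lambda>n. (Z' u - Z' w) * ((S u - S w) / ((S u - S w)\<^sup>2 + (e n)\<^sup>2))) \<longlonglongrightarrow> (Z' u - Z' w) * ((S u - S w) / ((S u - S w)\<^sup>2 + 0\<^sup>2))"
      by (intro tendsto_intros e0)
    then show ?thesis unfolding f_def using nz by (intro tendsto_ennrealI) (simp add: power2_eq_square)
  qed
  have "dint M (\<lambda>u w. ennreal ((Z' u - Z' w) / (S u - S w))) = dint M (\<lambda>u w. liminf (\<lambda>n. f n u w))"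
    using AE_S_distinct
    by (intro dint_cong_AE) (auto elim!: eventually_mono intro!: lim_imp_Liminf[symmetric] lim)
  also have "\<dots> \<le> liminf (\<lambda>n. dint M (f n))"
    by (rule dint_liminf) measurable
  also have "\<dots> \<le> liminf (\<lambda>n. ennreal (expectation (\<lambda>u. Z' u * S u)))"
    unfolding f_def by (intro Liminf_mono always_eventually allI nn_integral_smoothed_slope Z' e)
  also have "\<dots> = ennreal (expectation (\<lambda>u. Z' u * S u))" by (simp add: Liminf_const)
  finally have "2 * (dint M (\<lambda>u w. ennreal ((Z' u - Z' w) / (S u - S w)))) \<le> 2 * ennreal (expectation (\<lambda>u. Z' u * S u))"
    by (intro mult_left_mono) auto
  also have "\<dots> = ennreal (2 * expectation (\<lambda>u. Z' u * S u))"
    using ennreal_mult'[of 2 "expectation (\<lambda>u. Z' u * S u)"] by simp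
  finally show ?thesis
    unfolding d nn_integral_bilinear_S[OF Z'(1,2)] .
qed

text \<open>For one generic u the square of \<open>Z u - Z w\<close> is integrable in w, and it
  dominates Z up to constants.\<close>

lemma integrable_of_finite_energy:
  fixes Z :: "real \<Rightarrow> real"
  assumes mono: "mono Z" and fin: "energy Z Z < \<infinity>"
  shows "integrable M Z"
proof -
  have m[measurable]: "Z \<in> borel_measurable borel" using mono by (rule borel_measurable_mono)
  have "AE u in M. (\<integral>\<^sup>+w. ennreal ((Z u - Z w) * (Z u - Z w)) \<partial>M) \<noteq> \<infinity>"
  proof (rule nn_integral_PInf_AE)
    show "(dint M (\<lambda>u w. ennreal ((Z u - Z w) * (Z u - Z w)))) \<noteq> \<infinity>"
      using bilinear_finite[OF m m fin] by simp
  qed measurable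
  then obtain u where "(\<integral>\<^sup>+w. ennreal ((Z u - Z w) * (Z u - Z w)) \<partial>M) \<noteq> \<infinity>"
    by (rule AE_obtain)
  then have sq: "integrable M (\<lambda>w. (Z u - Z w) * (Z u - Z w))"
    by (intro integrableI_nonneg) (auto simp: less_top)
  have "integrable M (\<lambda>w. 1 + \<bar>Z u\<bar> + (Z u - Z w) * (Z u - Z w))" using sq by auto
  then show ?thesis
  proof (rule Bochner_Integration.integrable_bound)
    have "\<bar>Z w\<bar> \<le> 1 + \<bar>Z u\<bar> + (Z u - Z w) * (Z u - Z w)" for w
    proof -
      define d where "d = \<bar>Z u - Z w\<bar>"
      have "0 \<le> (d - 1)\<^sup>2 + d" unfolding d_def by simp
      then have "d \<le> 1 + d * d" by (simp add: power2_eq_square algebra_simps)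
      moreover have "d * d = (Z u - Z w) * (Z u - Z w)" unfolding d_def by simp
      moreover have "\<bar>Z w\<bar> \<le> \<bar>Z u\<bar> + d" unfolding d_def by linarith
      ultimately show ?thesis by linarith
    qed
    then show "AE w in M. norm (Z w) \<le> norm (1 + \<bar>Z u\<bar> + (Z u - Z w) * (Z u - Z w))"
      by (intro AE_I2) (metis abs_ge_self order_trans real_norm_def)
  qed measurable
qed

text \<open>Integrating the tangent identity leaves the linear terms \<open>2 * K\<close> and
  \<open>B\<close>. Since \<open>2 * K \<le> B\<close> and \<open>B\<close> is finite, the energy
  exceeds 3/2 by at least the mean remainder \<open>R\<close>, which must vanish in the equality
  case.\<close>

lemma energy_diagonal:
  fixes Z :: "real \<Rightarrow> real"
  assumes mono: "mono Z" and fin: "energy Z Z < \<infinity>"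
  shows "ennreal (3 / 2) \<le> energy Z Z"
    and "energy Z Z = ennreal (3 / 2) \<Longrightarrow> \<exists>c. AE u in M. Z u = S u + c"
proof -
  have m[measurable]: "Z \<in> borel_measurable borel" using mono by (rule borel_measurable_mono)
  have Z: "integrable M Z" by (rule integrable_of_finite_energy[OF mono fin])
  define rem where "rem u w = ((Z u - Z w) - (S u - S w))\<^sup>2 / 2 + 2 * ((Z u - Z w) / (S u - S w) - 1 - ln ((Z u - Z w) / (S u - S w)))" for u w
  have [measurable]: "(\<lambda>(u, w). rem u w) \<in> borel_measurable (M \<Otimes>\<^sub>M M)" unfolding rem_def by measurable
  define K where "K = dint M (\<lambda>u w. ennreal ((Z u - Z w) / (S u - S w)))"
  define B where "B = dint M (\<lambda>u w. ennreal ((Z u - Z w) * (S u - S w)))"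
  define R where "R = dint M (\<lambda>u w. ennreal (rem u w))"
  have pos: "AE u in M. AE w in M. 0 < (Z u - Z w) * (S u - S w)"
    using energy_finite_AE[OF m m fin] AE_S_distinct
  proof eventually_elim
    case (elim u)
    then show ?case
    proof eventually_elim
      case (elim w)
      then have "Z u - Z w \<noteq> 0" "S u - S w \<noteq> 0" by auto
      then show ?case
        using cosigned_mono[OF mono monoS, of u w] by (auto simp: cosigned_def zero_less_mult_iff)
    qed
  qed
  have "AE u in M. AE w in M. pair_cost ((Z u - Z w) * (Z u - Z w)) + (2 * ennreal ((Z u - Z w) / (S u - S w)) + ennreal ((S u - S w)\<^sup>2))
    = pair_cost ((S u - S w) * (S u - S w)) + (ennreal ((Z u - Z w) * (S u - S w)) + 2 + ennreal (rem u w))"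
    using pos
  proof eventually_elim
    case (elim u)
    then show ?case
      by eventually_elim (unfold rem_def, rule pair_cost_tangent)
  qed
  then have "dint M (\<lambda>u w. pair_cost ((Z u - Z w) * (Z u - Z w)) + (2 * ennreal ((Z u - Z w) / (S u - S w)) + ennreal ((S u - S w)\<^sup>2)))
    = dint M (\<lambda>u w. pair_cost ((S u - S w) * (S u - S w)) + (ennreal ((Z u - Z w) * (S u - S w)) + 2 + ennreal (rem u w)))"
    by (rule dint_cong_AE)
  moreover have "dint M (\<lambda>u w. ennreal ((S u - S w)\<^sup>2)) = 2"
    using nn_integral_S_pair[of "\<lambda>(x, y). ennreal ((x - y)\<^sup>2)"] nn_integral_square_semicircle by simp
  ultimately have eq: "energy Z Z + (2 * K + 2) = ennreal (3 / 2) + (B + 2 + R)"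
    unfolding K_def B_def R_def energy_S[symmetric]
    by (simp add: energy_def nn_integral_add nn_integral_cmult)
  have "2 * K \<le> B" unfolding K_def B_def by (rule nn_integral_slope[OF mono Z])
  then have "ennreal (3 / 2) + (B + 2 + R) \<le> energy Z Z + (B + 2)"
    unfolding eq[symmetric] by (intro add_mono order_refl)
  then have "(B + 2) + (ennreal (3 / 2) + R) \<le> (B + 2) + energy Z Z" by (simp add: ac_simps)
  moreover have "B + 2 \<noteq> \<infinity>" unfolding B_def nn_integral_bilinear_S[OF mono Z] by simp
  ultimately have ge: "ennreal (3 / 2) + R \<le> energy Z Z" by (subst (asm) ennreal_add_left_cancel_le) auto
  then show "ennreal (3 / 2) \<le> energy Z Z" by (rule order_trans[rotated]) simp
  assume "energy Z Z = ennreal (3 / 2)"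
  with ge have "ennreal (3 / 2) + R \<le> ennreal (3 / 2) + 0" by simp
  then have "R = 0" by (subst (asm) ennreal_add_left_cancel_le) auto
  then have "AE u in M. AE w in M. rem u w \<le> 0"
    unfolding R_def by (simp add: nn_integral_0_iff_AE ennreal_eq_0_iff)
  with pos have "AE u in M. (AE w in M. 0 < (Z u - Z w) * (S u - S w)) \<and> (AE w in M. rem u w \<le> 0)"
    by eventually_elim auto
  \<comment> \<open>One generic base point is enough: comparing almost every w with it determines Z
    - S up to a constant.\<close>
  then obtain u where u: "(AE w in M. 0 < (Z u - Z w) * (S u - S w)) \<and> (AE w in M. rem u w \<le> 0)"
    by (rule AE_obtain)
  have "AE w in M. Z w = S w + (Z u - S u)"
    using conjunct1[OF u] conjunct2[OF u]
  proof eventually_elim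
    case (elim w)
    define a b where "a = Z u - Z w" and "b = S u - S w"
    have "0 < a / b" using elim(1) unfolding a_def b_def by (auto simp: zero_less_mult_iff zero_less_divide_iff)
    then have "ln (a / b) \<le> a / b - 1" by (rule ln_le_minus_one)
    then have "0 \<le> a / b - 1 - ln (a / b)" by simp
    moreover have "(a - b)\<^sup>2 / 2 + 2 * (a / b - 1 - ln (a / b)) \<le> 0"
      using elim(2) unfolding rem_def a_def[symmetric] b_def[symmetric] .
    moreover have "p \<le> 0" if "0 \<le> q" "p + 2 * q \<le> 0" for p q :: real using that by linarith
    ultimately have "(a - b)\<^sup>2 / 2 \<le> 0" by blast
    then have "a = b" by simp
    then show ?case unfolding a_def b_def by simp
  qed
  then show "\<exists>c. AE u in M. Z u = S u + c" by blast
qed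

text \<open>If Y is l X + c, scaling X by the square root of l and dividing Y by it yields a
  diagonal pair of the same energy.\<close>

lemma minimiser_diagonal:
  fixes X Y :: "real \<Rightarrow> real"
  assumes mono: "mono X" "mono Y" and fin: "energy X Y < \<infinity>"
    and min: "\<And>X' Y'. mono X' \<Longrightarrow> mono Y' \<Longrightarrow> energy X Y \<le> energy X' Y'"
  obtains r b where "0 < r" "AE u in M. Y u = r * (r * X u) + b" "mono (\<lambda>u. r * X u)"
    "energy X Y = energy (\<lambda>u. r * X u) (\<lambda>u. r * X u)"
proof -
  interpret mono_pair M X Y by unfold_locales (use mono in auto)
  obtain l c where l: "0 < l" and Y: "AE u in M. Y u = l * X u + c"
    using minimiser_affine[OF fin min] by blast
  define r where "r = sqrt l"
  have r: "0 < r" "l = r * r" using l by (auto simp: r_def)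
  have "energy X Y = energy X (\<lambda>u. r * (r * X u) + c)"
    using Y unfolding r(2) by (intro energy_cong_AE) (auto simp: mult.assoc)
  also have "\<dots> = energy (\<lambda>u. r * (X u - 0)) (\<lambda>u. (r * (r * X u) + c - c) / r)"
    using r(1) by (intro energy_affine[symmetric]) simp
  also have "\<dots> = energy (\<lambda>u. r * X u) (\<lambda>u. r * X u)" using r(1) by simp
  finally have e: "energy X Y = energy (\<lambda>u. r * X u) (\<lambda>u. r * X u)" .
  have "mono (\<lambda>u. r * X u)"
    using r(1) by (intro monoI mult_left_mono monoD[OF mono(1)]) auto
  moreover have "AE u in M. Y u = r * (r * X u) + c" using Y unfolding r(2) by (simp only: mult.assoc)
  ultimately show ?thesis using that r(1) e by blast
qed

theorem energy_lower_bound_semicircle: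
  fixes X Y :: "real \<Rightarrow> real"
  assumes "mono X" "mono Y"
  shows "ennreal (3 / 2) \<le> energy X Y"
proof -
  have "energy_inf < \<infinity>"
    using energy_inf_le[OF monoS monoS] unfolding energy_S by (rule le_less_trans) simp
  then obtain X0 Y0 where m0: "mono X0" "mono Y0" "energy X0 Y0 = energy_inf"
    by (rule minimiser_exists)
  have fin: "energy X0 Y0 < \<infinity>" using m0(3) \<open>energy_inf < \<infinity>\<close> by simp
  obtain r b where r: "mono (\<lambda>u. r * X0 u)" "energy X0 Y0 = energy (\<lambda>u. r * X0 u) (\<lambda>u. r * X0 u)"
    by (rule minimiser_diagonal[OF m0(1,2) fin]) (use m0(3) energy_inf_le in auto)
  have "ennreal (3 / 2) \<le> energy X0 Y0"
    using energy_diagonal(1)[OF r(1)] fin unfolding r(2) by simp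
  also have "\<dots> \<le> energy X Y" unfolding m0(3) using assms by (rule energy_inf_le)
  finally show ?thesis .
qed

text \<open>A pair that attains 3/2 is itself a minimiser, so the variational argument applies to it
  and not just to the pair supplied by compactness.\<close>

theorem energy_equality_case:
  fixes X Y :: "real \<Rightarrow> real"
  assumes mono: "mono X" "mono Y" and eq: "energy X Y = ennreal (3 / 2)"
  obtains r a b where "0 < r" "AE u in M. X u = S u / r + a" "AE u in M. Y u = r * S u + b"
proof -
  have fin: "energy X Y < \<infinity>" using eq by simp
  obtain r b where r: "0 < r" "AE u in M. Y u = r * (r * X u) + b" "mono (\<lambda>u. r * X u)"
    "energy X Y = energy (\<lambda>u. r * X u) (\<lambda>u. r * X u)"
    by (rule minimiser_diagonal[OF mono fin]) (use eq energy_lower_bound_semicircle in auto)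
  have eq': "energy (\<lambda>u. r * X u) (\<lambda>u. r * X u) = ennreal (3 / 2)" using r(4) eq by (rule trans[OF sym])
  then have "energy (\<lambda>u. r * X u) (\<lambda>u. r * X u) < \<infinity>" by (simp only: ennreal_less_top infinity_ennreal_def)
  then obtain c where c: "AE u in M. r * X u = S u + c"
    using energy_diagonal(2)[OF r(3) _ eq'] by blast
  have "AE u in M. X u = S u / r + c / r"
    using c by eventually_elim (use r(1) in \<open>simp add: field_simps\<close>)
  moreover have "AE u in M. Y u = r * S u + (r * c + b)"
    using c r(2) by eventually_elim (simp add: algebra_simps)
  ultimately show ?thesis using r(1) that by blast
qed

end

section \<open>Quantiles and free entropy\<close>

definition logistic :: "real \<Rightarrow> real" where "logistic t = 1 / (1 + exp (- t))"

definition logit :: "real \<Rightarrow> real" where "logit p = ln (p / (1 - p))"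

lemma logistic_strict_mono: "s < t \<Longrightarrow> logistic s < logistic t"
  unfolding logistic_def by (intro divide_strict_left_mono mult_pos_pos add_pos_pos) auto

lemma logistic_bounds: "0 < logistic t" "logistic t < 1"
  by (auto simp: logistic_def add_pos_pos)

lemma logistic_logit: "0 < p \<Longrightarrow> p < 1 \<Longrightarrow> logistic (logit p) = p"
  by (simp add: logistic_def logit_def exp_minus field_simps)

text \<open>The uniform law on (0, 1) transported to the whole line by an increasing map; composing
  a quantile function with \<open>logistic\<close> keeps it monotone.\<close>

definition logistic_measure :: "real measure" where
  "logistic_measure = distr (restrict_space lborel {0<..<1}) borel logit"

lemma logit_measurable[measurable]: "logit \<in> borel_measurable borel"
  unfolding logit_def by measurable

lemma logit_measurable_unit: "logit \<in> restrict_space lborel {0<..<1} \<rightarrow>\<^sub>M borel"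
  by (intro measurable_restrict_space1) simp

lemma emeasure_logistic_measure:
  assumes [measurable]: "A \<in> sets borel"
  shows "emeasure logistic_measure A = emeasure lborel {p \<in> {0<..<1}. logit p \<in> A}"
proof -
  have "emeasure logistic_measure A = emeasure (restrict_space lborel {0<..<1}) (logit -` A \<inter> {0<..<1})"
    unfolding logistic_measure_def by (subst emeasure_distr[OF logit_measurable_unit]) (auto simp: space_restrict_space)
  also have "\<dots> = emeasure lborel (logit -` A \<inter> {0<..<1})"
    by (subst emeasure_restrict_space) auto
  also have "logit -` A \<inter> {0<..<1} = {p \<in> {0<..<1}. logit p \<in> A}" by auto
  finally show ?thesis .
qed

lemma reference_measure_logistic: "reference_measure logistic_measure"
proof -
  have "prob_space (restrict_space lborel {0<..<1::real})"
    by (auto simp: space_restrict_space emeasure_restrict_space intro!: prob_spaceI)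
  then have "prob_space logistic_measure"
    unfolding logistic_measure_def by (rule prob_space.prob_space_distr[OF _ logit_measurable_unit])
  then have "real_distribution logistic_measure"
    by (simp add: real_distribution_def real_distribution_axioms_def logistic_measure_def)
  moreover have "emeasure logistic_measure {x} = 0" for x
  proof -
    have "{p \<in> {0<..<1}. logit p \<in> {x}} \<subseteq> {logistic x}" using logistic_logit by auto
    moreover have "{p \<in> {0<..<1}. logit p \<in> {x}} \<in> sets lborel" by measurable
    ultimately show ?thesis
      using emeasure_mono[of "{p \<in> {0<..<1}. logit p \<in> {x}}" "{logistic x}" lborel]
      by (simp add: emeasure_logistic_measure)
  qed
  moreover have "0 < emeasure logistic_measure {a<..<b}" if "a < b" for a b
  proof -
    have "{logistic a<..<logistic b} \<subseteq> {p \<in> {0<..<1}. logit p \<in> {a<..<b}}"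
    proof
      fix p assume p: "p \<in> {logistic a<..<logistic b}"
      then have p01: "0 < p" "p < 1" using logistic_bounds[of a] logistic_bounds[of b] by auto
      then have "logistic a < logistic (logit p)" "logistic (logit p) < logistic b"
        using p by (auto simp: logistic_logit)
      then have "a < logit p" "logit p < b"
        using logistic_strict_mono by (metis not_less_iff_gr_or_eq)+
      then show "p \<in> {p \<in> {0<..<1}. logit p \<in> {a<..<b}}" using p01 by auto
    qed
    then have "emeasure lborel {logistic a<..<logistic b} \<le> emeasure logistic_measure {a<..<b}"
      unfolding emeasure_logistic_measure[OF borel_open[OF open_greaterThanLessThan]] by (intro emeasure_mono) measurable
    moreover have "0 < emeasure lborel {logistic a<..<logistic b}"
      using logistic_strict_mono[OF that] by simp
    ultimately show ?thesis by simp
  qed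
  ultimately show "reference_measure logistic_measure"
    by (simp add: reference_measure_def reference_measure_axioms_def)
qed

lemma quantile_exists:
  assumes "real_distribution \<mu>"
  obtains X where "mono X" "distr logistic_measure borel X = \<mu>"
proof -
  interpret cdf_distribution \<mu> using assms by (simp add: cdf_distribution_def)
  define X where "X t = I (logistic t)" for t
  have "mono X"
  proof (rule monoI)
    fix s t :: real assume "s \<le> t"
    then have "logistic s \<le> logistic t" using logistic_strict_mono[of s t] by (cases "s = t") auto
    then show "X s \<le> X t" unfolding X_def using logistic_bounds by (intro mono_onD[OF mono_I]) auto
  qed
  moreover have "distr logistic_measure borel X = distr (restrict_space lborel {0<..<1}) borel (X \<circ> logit)"
    unfolding logistic_measure_def using borel_measurable_mono[OF \<open>mono X\<close>]
    by (intro distr_distr logit_measurable_unit)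
  moreover have "\<dots> = distr (restrict_space lborel {0<..<1}) borel I"
    by (rule distr_cong) (auto simp: space_restrict_space X_def logistic_logit)
  ultimately show ?thesis using that distr_I_eq_M by simp
qed

lemma semicircular_law_affine:
  assumes s: "0 < s"
  shows "semicircular_law m s = distr \<sigma> borel (\<lambda>x. m + s * x)"
proof (rule measure_eqI)
  fix A assume "A \<in> sets (semicircular_law m s)"
  then have A[measurable]: "A \<in> sets borel" by simp
  have [measurable]: "(\<lambda>x. semicircular_density m s x) \<in> borel_measurable borel" for m s
    unfolding semicircular_density_def by measurable
  have [measurable]: "(\<lambda>x. m + s * x) -` A \<in> sets borel"
    by (rule measurable_sets_borel[OF _ A]) measurable
  have dens: "s * semicircular_density m s (m + s * x) = semicircular_density 0 1 x" for x
  proof -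
    have "sqrt (4 * s\<^sup>2 - (s * x)\<^sup>2) = s * sqrt (4 - x\<^sup>2)"
    proof -
      have "4 * s\<^sup>2 - (s * x)\<^sup>2 = s\<^sup>2 * (4 - x\<^sup>2)" by (simp add: power_mult_distrib algebra_simps)
      then show ?thesis using s by (simp add: real_sqrt_mult)
    qed
    moreover have "(m + s * x \<in> {m - 2 * s..m + 2 * s}) = (x \<in> {- 2..2})"
      using s mult_le_cancel_left_pos[OF s, of "- 2" x] mult_le_cancel_left_pos[OF s, of x 2] by auto
    ultimately show ?thesis
      using s by (simp add: semicircular_density_def indicator_def power2_eq_square field_simps)
  qed
  have "emeasure (semicircular_law m s) A = (\<integral>\<^sup>+x. ennreal (semicircular_density m s x) * indicator A x \<partial>lborel)"
    unfolding semicircular_law_def by (intro emeasure_density) auto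
  also have "\<dots> = ennreal \<bar>s\<bar> * (\<integral>\<^sup>+x. ennreal (semicircular_density m s (m + s * x)) * indicator A (m + s * x) \<partial>lborel)"
    using s by (intro nn_integral_real_affine) auto
  also have "\<dots> = (\<integral>\<^sup>+x. ennreal (semicircular_density 0 1 x) * indicator ((\<lambda>x. m + s * x) -` A) x \<partial>lborel)"
  proof (subst nn_integral_cmult[symmetric])
    show "(\<integral>\<^sup>+x. ennreal \<bar>s\<bar> * (ennreal (semicircular_density m s (m + s * x)) * indicator A (m + s * x)) \<partial>lborel)
      = (\<integral>\<^sup>+x. ennreal (semicircular_density 0 1 x) * indicator ((\<lambda>x. m + s * x) -` A) x \<partial>lborel)"
    proof (rule nn_integral_cong)
      fix x
      have "ennreal \<bar>s\<bar> * ennreal (semicircular_density m s (m + s * x)) = ennreal (semicircular_density 0 1 x)"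
        using s by (simp add: ennreal_mult'[symmetric] dens)
      then show "ennreal \<bar>s\<bar> * (ennreal (semicircular_density m s (m + s * x)) * indicator A (m + s * x))
        = ennreal (semicircular_density 0 1 x) * indicator ((\<lambda>x. m + s * x) -` A) x"
        by (simp add: mult.assoc[symmetric] indicator_def)
    qed
  qed measurable
  also have "\<dots> = emeasure \<sigma> ((\<lambda>x. m + s * x) -` A)"
    unfolding semicircular_law_def by (intro emeasure_density[symmetric]) auto
  also have "\<dots> = emeasure (distr \<sigma> borel (\<lambda>x. m + s * x)) A"
    by (subst emeasure_distr) auto
  finally show "emeasure (semicircular_law m s) A = emeasure (distr \<sigma> borel (\<lambda>x. m + s * x)) A" .
qed simp

text \<open>For C above the logarithms on the support, this is the logarithm made one-signed. The
  explicit value at 0 replaces \<open>ln 0 = 0\<close>, as in \<open>log_dist\<close>.\<close>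

definition log_deficit :: "real \<Rightarrow> real \<Rightarrow> ennreal" where
  "log_deficit C d = (if d = 0 then \<infinity> else ennreal (C - ln \<bar>d\<bar>))"

lemma log_deficit_measurable[measurable]: "log_deficit C \<in> borel_measurable borel"
  unfolding log_deficit_def[abs_def] by measurable

lemma log_dist_measurable[measurable]: "(\<lambda>p. log_dist (fst p) (snd p)) \<in> borel_measurable (borel \<Otimes>\<^sub>M borel)"
  unfolding log_dist_def by measurable

text \<open>A number is its positive part less its negative part, written without subtraction. The
  bound on the positive part ensures that the difference defining \<open>log_energy\<close> is never
  \<infinity> - \<infinity>.\<close>

lemma log_deficit_split:
  assumes "\<bar>x\<bar> \<le> R" "\<bar>y\<bar> \<le> R" "2 * R \<le> C" "0 \<le> C"
  shows "log_deficit C (x - y) + e2ennreal (log_dist x y) = ennreal C + e2ennreal (- log_dist x y)"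
    and "e2ennreal (log_dist x y) \<le> ennreal C"
proof -
  have l: "ln \<bar>y - x\<bar> \<le> C" if "x \<noteq> y"
  proof -
    have "ln \<bar>y - x\<bar> \<le> \<bar>y - x\<bar> - 1" using that by (intro ln_le_minus_one) auto
    then show ?thesis using assms by linarith
  qed
  show "log_deficit C (x - y) + e2ennreal (log_dist x y) = ennreal C + e2ennreal (- log_dist x y)"
  proof (cases "x = y")
    case True
    then show ?thesis by (simp add: log_deficit_def log_dist_def e2ennreal_infty)
  next
    case False
    define t where "t = ln \<bar>y - x\<bar>"
    have t: "ln \<bar>x - y\<bar> = t" "t \<le> C" unfolding t_def using l[OF False] by (simp_all add: abs_minus_commute)
    have "ennreal (C - t) + ennreal t = ennreal C + ennreal (- t)"
    proof (cases "0 \<le> t")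
      case True
      then show ?thesis using t assms(4) by (simp add: ennreal_plus[symmetric] ennreal_neg del: ennreal_plus)
    next
      case False
      then show ?thesis using t assms(4) by (simp add: ennreal_plus[symmetric] ennreal_neg del: ennreal_plus)
    qed
    then show ?thesis
      using False t(1) by (simp add: log_deficit_def log_dist_def t_def[symmetric] e2ennreal_ereal)
  qed
  show "e2ennreal (log_dist x y) \<le> ennreal C"
    using l by (cases "x = y") (auto simp: log_dist_def e2ennreal_ereal e2ennreal_neg intro!: ennreal_leI)
qed

context reference_measure begin

definition log_deficit_energy :: "real \<Rightarrow> (real \<Rightarrow> real) \<Rightarrow> ennreal" where
  "log_deficit_energy C X = dint M (\<lambda>u w. log_deficit C (X u - X w))"

lemma nn_integral_distr_pair:
  assumes [measurable]: "X \<in> borel_measurable borel" and F[measurable]: "F \<in> borel_measurable (borel \<Otimes>\<^sub>M borel)"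
  shows "(\<integral>\<^sup>+p. F p \<partial>(distr M borel X \<Otimes>\<^sub>M distr M borel X)) = dint M (\<lambda>u w. F (X u, X w))"
proof -
  interpret D: prob_space "distr M borel X" by (rule prob_space_distr) simp
  have "(\<integral>\<^sup>+p. F p \<partial>(distr M borel X \<Otimes>\<^sub>M distr M borel X)) = (\<integral>\<^sup>+x. \<integral>\<^sup>+y. F (x, y) \<partial>distr M borel X \<partial>distr M borel X)"
    by (rule D.nn_integral_fst[symmetric]) simp
  also have "\<dots> = (\<integral>\<^sup>+u. \<integral>\<^sup>+y. F (X u, y) \<partial>distr M borel X \<partial>M)"
    by (rule nn_integral_distr) measurable
  also have "\<dots> = dint M (\<lambda>u w. F (X u, X w))"
    by (intro nn_integral_cong nn_integral_distr) measurable
  finally show ?thesis .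
qed

lemma log_energy_distr:
  assumes [measurable]: "X \<in> borel_measurable borel" and R: "AE u in M. \<bar>X u\<bar> \<le> R" "2 * R \<le> C" "0 \<le> C"
  shows "log_energy (distr M borel X) = ereal C - enn2ereal (log_deficit_energy C X)"
proof -
  define P where "P = dint M (\<lambda>u w. e2ennreal (log_dist (X u) (X w)))"
  define N where "N = dint M (\<lambda>u w. e2ennreal (- log_dist (X u) (X w)))"
  define A where "A = log_deficit_energy C X"
  have [measurable]: "(\<lambda>p. log_dist (X (fst p)) (X (snd p))) \<in> borel_measurable (M \<Otimes>\<^sub>M M)"
    unfolding log_dist_def by measurable
  have [measurable]: "(\<lambda>w. log_dist (X u) (X w)) \<in> borel_measurable M" for u
    unfolding log_dist_def by measurable
  have [measurable]: "(\<lambda>(u, w). e2ennreal (log_dist (X u) (X w))) \<in> borel_measurable (M \<Otimes>\<^sub>M M)"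
    "(\<lambda>(u, w). e2ennreal (- log_dist (X u) (X w))) \<in> borel_measurable (M \<Otimes>\<^sub>M M)"
    unfolding split_beta' by measurable
  have le: "log_energy (distr M borel X) = enn2ereal P - enn2ereal N"
    unfolding log_energy_def ereal_integral_def P_def N_def
    using nn_integral_distr_pair[of X "\<lambda>p. e2ennreal (log_dist (fst p) (snd p))"]
      nn_integral_distr_pair[of X "\<lambda>p. e2ennreal (- log_dist (fst p) (snd p))"]
    by (simp add: split_beta')
  have ae: "AE u in M. AE w in M. log_deficit C (X u - X w) + e2ennreal (log_dist (X u) (X w)) = ennreal C + e2ennreal (- log_dist (X u) (X w))
      \<and> e2ennreal (log_dist (X u) (X w)) \<le> ennreal C"
    using R(1)
  proof eventually_elim
    case (elim u)
    note xu = elim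
    show ?case using R(1)
    proof eventually_elim
      case (elim w)
      show ?case using log_deficit_split[OF xu elim R(2,3)] by blast
    qed
  qed
  have "AE u in M. AE w in M. log_deficit C (X u - X w) + e2ennreal (log_dist (X u) (X w)) = ennreal C + e2ennreal (- log_dist (X u) (X w))"
    using ae by (auto elim!: eventually_mono)
  then have "dint M (\<lambda>u w. log_deficit C (X u - X w) + e2ennreal (log_dist (X u) (X w)))
      = dint M (\<lambda>u w. ennreal C + e2ennreal (- log_dist (X u) (X w)))"
    by (rule dint_cong_AE)
  then have sum: "A + P = ennreal C + N"
    unfolding A_def P_def N_def log_deficit_energy_def by (simp add: nn_integral_add)
  have "AE u in M. AE w in M. e2ennreal (log_dist (X u) (X w)) \<le> ennreal C"
    using ae by (auto elim!: eventually_mono)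
  then have "P \<le> dint M (\<lambda>u w. ennreal C)" unfolding P_def by (rule dint_mono_AE)
  then have "P \<le> ennreal C" by simp
  then obtain p where p: "P = ennreal p" "0 \<le> p" by (cases P) (auto simp: top_unique)
  have "enn2ereal P - enn2ereal N = ereal C - enn2ereal A"
  proof (cases N)
    case (real n)
    then have AC: "A + P = ennreal (C + n)" using sum R(3) by simp
    then have "A \<noteq> \<infinity>" by auto
    then obtain a where a: "A = ennreal a" "0 \<le> a" by (cases A) auto
    have "ennreal (a + p) = ennreal (C + n)" using AC a p by simp
    then have "a + p = C + n" using a p R(3) real by (subst (asm) ennreal_inj) auto
    then show ?thesis using a p real by (simp add: enn2ereal_ennreal)
  next
    case top
    then have "A = \<infinity>" using sum p by (metis ennreal_add_eq_top ennreal_neq_top infinity_ennreal_def)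
    then show ?thesis using top p by (simp add: enn2ereal_ennreal)
  qed
  then show ?thesis unfolding le A_def .
qed

lemma bounded_integrable: "X \<in> borel_measurable borel \<Longrightarrow> AE u in M. \<bar>X u\<bar> \<le> R \<Longrightarrow> integrable M X" for X :: "real \<Rightarrow> real"
  by (rule integrable_const_bound[where B = R]) auto

lemma integrable_products:
  fixes X Y :: "real \<Rightarrow> real"
  assumes [measurable]: "X \<in> borel_measurable borel" "Y \<in> borel_measurable borel"
    and R: "AE u in M. \<bar>X u\<bar> \<le> R" "AE u in M. \<bar>Y u\<bar> \<le> R"
  shows "integrable M (\<lambda>u. X u * Y u)"
proof -
  have "AE u in M. norm (X u * Y u) \<le> R * R"
    using R by eventually_elim (auto simp: abs_mult intro!: mult_mono)
  then show ?thesis by (rule integrable_const_bound) measurable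
qed

text \<open>The logarithm of the product splits into two, and \<open>2 * C\<close> pays for both
  deficits; if an increment vanishes, both sides are infinite. Half of the mean product of
  increments is the covariance.\<close>

lemma energy_log_deficit:
  assumes mono: "mono X" "mono Y" and R: "AE u in M. \<bar>X u\<bar> \<le> R" "AE u in M. \<bar>Y u\<bar> \<le> R" "2 * R \<le> C" "0 \<le> C"
  shows "energy X Y + ennreal (2 * C)
    = ennreal (expectation (\<lambda>u. X u * Y u) - expectation X * expectation Y) + log_deficit_energy C X + log_deficit_energy C Y"
proof -
  have [measurable]: "X \<in> borel_measurable borel" "Y \<in> borel_measurable borel"
    using mono by (auto intro: borel_measurable_mono)
  have pw: "pair_cost ((X u - X w) * (Y u - Y w)) + ennreal (2 * C)
    = ennreal ((X u - X w) * (Y u - Y w) / 2) + log_deficit C (X u - X w) + log_deficit C (Y u - Y w)"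
    if b: "\<bar>X u\<bar> \<le> R" "\<bar>Y u\<bar> \<le> R" "\<bar>X w\<bar> \<le> R" "\<bar>Y w\<bar> \<le> R" for u w
  proof -
    define x y where "x = X u - X w" and "y = Y u - Y w"
    have cs: "cosigned x y" unfolding x_def y_def by (rule cosigned_mono[OF mono])
    have ln: "ln \<bar>d\<bar> \<le> C" if "d \<noteq> 0" "\<bar>d\<bar> \<le> C" for d :: real
      using that ln_le_minus_one[of "\<bar>d\<bar>"] by simp
    have xy: "\<bar>x\<bar> \<le> C" "\<bar>y\<bar> \<le> C" unfolding x_def y_def using b R(3) by linarith+
    show ?thesis
      unfolding x_def[symmetric] y_def[symmetric]
    proof (cases "x = 0 \<or> y = 0")
      case True
      then show "pair_cost (x * y) + ennreal (2 * C) = ennreal (x * y / 2) + log_deficit C x + log_deficit C y"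
        by (auto simp: pair_cost_def log_deficit_def)
    next
      case False
      then have p: "0 < x * y" using cs by (auto simp: cosigned_def zero_less_mult_iff)
      have l: "ln (x * y) = ln \<bar>x\<bar> + ln \<bar>y\<bar>"
        using p False ln_mult_pos[of "\<bar>x\<bar>" "\<bar>y\<bar>"] by (simp add: abs_mult[symmetric])
      have "pair_cost (x * y) + ennreal (2 * C) = ennreal (x * y / 2 - ln (x * y) + 2 * C)"
        using p pair_cost_nonneg[OF p] R(4) by (simp add: pair_cost_def)
      also have "x * y / 2 - ln (x * y) + 2 * C = x * y / 2 + (C - ln \<bar>x\<bar>) + (C - ln \<bar>y\<bar>)" unfolding l by simp
      also have "ennreal \<dots> = ennreal (x * y / 2) + ennreal (C - ln \<bar>x\<bar>) + ennreal (C - ln \<bar>y\<bar>)"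
        using p ln[of x] ln[of y] xy False by (subst ennreal_plus; (subst ennreal_plus)?) auto
      finally show "pair_cost (x * y) + ennreal (2 * C) = ennreal (x * y / 2) + log_deficit C x + log_deficit C y"
        using False by (simp add: log_deficit_def)
    qed
  qed
  have "AE u in M. AE w in M. pair_cost ((X u - X w) * (Y u - Y w)) + ennreal (2 * C)
    = ennreal ((X u - X w) * (Y u - Y w) / 2) + log_deficit C (X u - X w) + log_deficit C (Y u - Y w)"
    using R(1,2)
  proof eventually_elim
    case (elim u)
    note b = elim
    show ?case using R(1,2) by eventually_elim (rule pw[OF b])
  qed
  then have "dint M (\<lambda>u w. pair_cost ((X u - X w) * (Y u - Y w)) + ennreal (2 * C))
    = dint M (\<lambda>u w. ennreal ((X u - X w) * (Y u - Y w) / 2) + log_deficit C (X u - X w) + log_deficit C (Y u - Y w))"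
    by (rule dint_cong_AE)
  then have "energy X Y + ennreal (2 * C) = (dint M (\<lambda>u w. ennreal ((X u - X w) * (Y u - Y w) / 2)))
      + log_deficit_energy C X + log_deficit_energy C Y"
    unfolding energy_def log_deficit_energy_def by (simp add: nn_integral_add)
  also have "dint M (\<lambda>u w. ennreal ((X u - X w) * (Y u - Y w) / 2)) = ennreal (expectation (\<lambda>u. X u * Y u) - expectation X * expectation Y)"
    by (rule covariance_mono(1)[OF mono bounded_integrable[OF _ R(1)] bounded_integrable[OF _ R(2)] integrable_products[OF _ _ R(1,2)]]) measurable
  finally show ?thesis .
qed

end

section \<open>The quantile coupling and the sum of free entropies\<close>

context reference_measure begin

lemma coupling_of_quantiles:
  fixes X Y :: "real \<Rightarrow> real"
  assumes [measurable]: "X \<in> borel_measurable borel" "Y \<in> borel_measurable borel"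
  shows "distr M (borel \<Otimes>\<^sub>M borel) (\<lambda>u. (X u, Y u)) \<in> couplings (distr M borel X) (distr M borel Y)"
proof -
  have "prob_space (distr M (borel \<Otimes>\<^sub>M borel) (\<lambda>u. (X u, Y u)))" by (rule prob_space_distr) simp
  moreover have "distr (distr M (borel \<Otimes>\<^sub>M borel) (\<lambda>u. (X u, Y u))) (distr M borel X) fst = distr M borel X"
    by (subst distr_distr) (auto simp: o_def intro!: distr_cong)
  moreover have "distr (distr M (borel \<Otimes>\<^sub>M borel) (\<lambda>u. (X u, Y u))) (distr M borel Y) snd = distr M borel Y"
    by (subst distr_distr) (auto simp: o_def intro!: distr_cong)
  moreover have "sets (distr M borel X \<Otimes>\<^sub>M distr M borel Y) = sets (borel \<Otimes>\<^sub>M borel)"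
    by (intro sets_pair_measure_cong) auto
  ultimately show ?thesis unfolding couplings_def by simp
qed

lemma expectation_square_diff:
  fixes X Y :: "real \<Rightarrow> real"
  assumes m: "X \<in> borel_measurable borel" "Y \<in> borel_measurable borel"
    and R: "AE u in M. \<bar>X u\<bar> \<le> R" "AE u in M. \<bar>Y u\<bar> \<le> R"
  shows "integrable M (\<lambda>u. (X u - Y u)\<^sup>2)"
    and "expectation (\<lambda>u. (X u - Y u)\<^sup>2) = expectation (\<lambda>u. (X u)\<^sup>2) + expectation (\<lambda>u. (Y u)\<^sup>2) - 2 * expectation (\<lambda>u. X u * Y u)"
proof -
  note i = integrable_products[OF m R] integrable_products[OF m(1,1) R(1,1)] integrable_products[OF m(2,2) R(2,2)]
  have sq: "(X u - Y u)\<^sup>2 = X u * X u + Y u * Y u - 2 * (X u * Y u)" for u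
    by (simp add: power2_eq_square algebra_simps)
  show "integrable M (\<lambda>u. (X u - Y u)\<^sup>2)" unfolding sq using i by simp
  show "expectation (\<lambda>u. (X u - Y u)\<^sup>2) = expectation (\<lambda>u. (X u)\<^sup>2) + expectation (\<lambda>u. (Y u)\<^sup>2) - 2 * expectation (\<lambda>u. X u * Y u)"
    unfolding sq power2_eq_square[of "X _"] power2_eq_square[of "Y _"] using i by simp
qed

lemma quadratic_cost_quantiles:
  fixes X Y :: "real \<Rightarrow> real"
  assumes [measurable]: "X \<in> borel_measurable borel" "Y \<in> borel_measurable borel"
    and R: "AE u in M. \<bar>X u\<bar> \<le> R" "AE u in M. \<bar>Y u\<bar> \<le> R"
  shows "quadratic_cost (distr M borel X) (distr M borel Y)
    \<le> ennreal (expectation (\<lambda>u. (X u)\<^sup>2) + expectation (\<lambda>u. (Y u)\<^sup>2) - 2 * expectation (\<lambda>u. X u * Y u))"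
proof -
  have "quadratic_cost (distr M borel X) (distr M borel Y)
    \<le> (\<integral>\<^sup>+p. ennreal (\<bar>fst p - snd p\<bar>\<^sup>2) \<partial>distr M (borel \<Otimes>\<^sub>M borel) (\<lambda>u. (X u, Y u)))"
    unfolding quadratic_cost_def by (rule INF_lower) (rule coupling_of_quantiles[OF assms(1,2)])
  also have "\<dots> = (\<integral>\<^sup>+u. ennreal ((X u - Y u)\<^sup>2) \<partial>M)"
    by (subst nn_integral_distr) auto
  also have "\<dots> = ennreal (expectation (\<lambda>u. (X u - Y u)\<^sup>2))"
    by (rule nn_integral_eq_integral[OF expectation_square_diff(1)[OF assms]]) simp
  also note expectation_square_diff(2)[OF assms]
  finally show ?thesis .
qed

lemma free_entropy_rel_distr:
  fixes X :: "real \<Rightarrow> real"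
  assumes [measurable]: "X \<in> borel_measurable borel" and R: "AE u in M. \<bar>X u\<bar> \<le> R" "2 * R \<le> C" "0 \<le> C"
  shows "log_deficit_energy C X = \<infinity> \<Longrightarrow> free_entropy_rel_semicircular (distr M borel X) = \<infinity>"
    and "log_deficit_energy C X = ennreal a \<Longrightarrow> 0 \<le> a \<Longrightarrow>
      free_entropy_rel_semicircular (distr M borel X) = ereal (expectation (\<lambda>u. (X u)\<^sup>2) / 2 - C + a - 3 / 4)"
proof -
  have "integrable M (\<lambda>u. (X u)\<^sup>2)"
    using integrable_products[OF assms(1,1) R(1,1)] by (simp add: power2_eq_square)
  then have "second_moment (distr M borel X) = ereal (expectation (\<lambda>u. (X u)\<^sup>2))"
    unfolding second_moment_def by (simp add: nn_integral_distr nn_integral_eq_integral enn2ereal_ennreal)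
  then show "log_deficit_energy C X = \<infinity> \<Longrightarrow> free_entropy_rel_semicircular (distr M borel X) = \<infinity>"
    and "log_deficit_energy C X = ennreal a \<Longrightarrow> 0 \<le> a \<Longrightarrow>
      free_entropy_rel_semicircular (distr M borel X) = ereal (expectation (\<lambda>u. (X u)\<^sup>2) / 2 - C + a - 3 / 4)"
    unfolding free_entropy_rel_semicircular_def free_entropy_def log_energy_distr[OF assms]
    by (simp_all add: enn2ereal_ennreal)
qed

text \<open>Centring identifies the covariance with the mean of X Y. The sum of entropies is then
  the cost of the quantile coupling plus twice the excess of the energy over 3/2.\<close>

lemma free_entropy_sum:
  fixes X Y :: "real \<Rightarrow> real"
  assumes mono: "mono X" "mono Y" and R: "AE u in M. \<bar>X u\<bar> \<le> R" "AE u in M. \<bar>Y u\<bar> \<le> R" and zero: "expectation X = 0"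
  shows "energy X Y = \<infinity> \<Longrightarrow>
      2 * free_entropy_rel_semicircular (distr M borel X) + 2 * free_entropy_rel_semicircular (distr M borel Y) = \<infinity>"
    and "energy X Y = ennreal e \<Longrightarrow> 0 \<le> e \<Longrightarrow>
      2 * free_entropy_rel_semicircular (distr M borel X) + 2 * free_entropy_rel_semicircular (distr M borel Y)
      = ereal (expectation (\<lambda>u. (X u)\<^sup>2) + expectation (\<lambda>u. (Y u)\<^sup>2) - 2 * expectation (\<lambda>u. X u * Y u) + (2 * e - 3))"
proof -
  define C where "C = 2 * \<bar>R\<bar>"
  have C: "2 * R \<le> C" "0 \<le> C" unfolding C_def by auto
  have m: "X \<in> borel_measurable borel" "Y \<in> borel_measurable borel"
    using mono by (auto intro: borel_measurable_mono)
  note HX = free_entropy_rel_distr[OF m(1) R(1) C] and HY = free_entropy_rel_distr[OF m(2) R(2) C]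
  define A A' where "A = log_deficit_energy C X" and "A' = log_deficit_energy C Y"
  define b where "b = expectation (\<lambda>u. X u * Y u)"
  have b: "0 \<le> b"
    using covariance_mono(2)[OF mono bounded_integrable[OF m(1) R(1)] bounded_integrable[OF m(2) R(2)] integrable_products[OF m R]] zero
    unfolding b_def by simp
  have eq: "energy X Y + ennreal (2 * C) = ennreal b + A + A'"
    using energy_log_deficit[OF mono R C] zero unfolding b_def A_def A'_def by simp
  \<comment> \<open>Excludes -\<infinity>, so the sum is \<infinity> as soon as one summand
    is.\<close>
  have H: "free_entropy_rel_semicircular (distr M borel X) \<noteq> - \<infinity>" "free_entropy_rel_semicircular (distr M borel Y) \<noteq> - \<infinity>"
  proof -
    show "free_entropy_rel_semicircular (distr M borel X) \<noteq> - \<infinity>"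
      by (cases "log_deficit_energy C X") (auto simp: HX)
    show "free_entropy_rel_semicircular (distr M borel Y) \<noteq> - \<infinity>"
      by (cases "log_deficit_energy C Y") (auto simp: HY)
  qed
  show "2 * free_entropy_rel_semicircular (distr M borel X) + 2 * free_entropy_rel_semicircular (distr M borel Y) = \<infinity>"
    if "energy X Y = \<infinity>"
  proof -
    have "ennreal b + A + A' = \<infinity>" unfolding eq[symmetric] that by simp
    then have "A = \<infinity> \<or> A' = \<infinity>" by simp
    then have "free_entropy_rel_semicircular (distr M borel X) = \<infinity> \<or> free_entropy_rel_semicircular (distr M borel Y) = \<infinity>"
      using HX(1) HY(1) unfolding A_def A'_def by blast
    then show ?thesis
      using H by (cases "free_entropy_rel_semicircular (distr M borel X)"; cases "free_entropy_rel_semicircular (distr M borel Y)") auto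
  qed
  assume e: "energy X Y = ennreal e" "0 \<le> e"
  have fin: "ennreal b + A + A' = ennreal (e + 2 * C)" unfolding eq[symmetric] e(1) using e(2) C(2) by simp
  then have "A \<noteq> \<infinity>" "A' \<noteq> \<infinity>" by auto
  then obtain a a' where a: "A = ennreal a" "0 \<le> a" "A' = ennreal a'" "0 \<le> a'"
    by (cases A; cases A') auto
  have "ennreal (b + a + a') = ennreal (e + 2 * C)" using fin a b by simp
  then have "b + a + a' = e + 2 * C" using a b e(2) C(2) by (subst (asm) ennreal_inj) auto
  then have id: "2 * (expectation (\<lambda>u. (X u)\<^sup>2) / 2 - C + a - 3 / 4) + 2 * (expectation (\<lambda>u. (Y u)\<^sup>2) / 2 - C + a' - 3 / 4)
    = expectation (\<lambda>u. (X u)\<^sup>2) + expectation (\<lambda>u. (Y u)\<^sup>2) - 2 * b + (2 * e - 3)" by simp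
  have "2 * free_entropy_rel_semicircular (distr M borel X) + 2 * free_entropy_rel_semicircular (distr M borel Y)
    = ereal (2 * (expectation (\<lambda>u. (X u)\<^sup>2) / 2 - C + a - 3 / 4) + 2 * (expectation (\<lambda>u. (Y u)\<^sup>2) / 2 - C + a' - 3 / 4))"
    unfolding HX(2)[OF a(1)[unfolded A_def] a(2)] HY(2)[OF a(3)[unfolded A'_def] a(4)]
    by (simp only: numeral_eq_ereal times_ereal.simps plus_ereal.simps)
  then show "2 * free_entropy_rel_semicircular (distr M borel X) + 2 * free_entropy_rel_semicircular (distr M borel Y)
      = ereal (expectation (\<lambda>u. (X u)\<^sup>2) + expectation (\<lambda>u. (Y u)\<^sup>2) - 2 * expectation (\<lambda>u. X u * Y u) + (2 * e - 3))"
    unfolding id b_def .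
qed

lemma compactly_supported_distr:
  fixes X :: "real \<Rightarrow> real"
  assumes [measurable]: "X \<in> borel_measurable borel" and "compactly_supported (distr M borel X)"
  obtains R where "AE u in M. \<bar>X u\<bar> \<le> R"
proof -
  obtain K where K: "compact K" "AE x in distr M borel X. x \<in> K"
    using assms(2) unfolding compactly_supported_def by blast
  obtain R where "\<forall>x\<in>K. norm x \<le> R"
    using compact_imp_bounded[OF K(1)] unfolding bounded_iff by blast
  then have "AE x in distr M borel X. \<bar>x\<bar> \<le> R"
    using K(2) by (auto elim!: eventually_mono)
  then have "AE u in M. \<bar>X u\<bar> \<le> R" by (subst (asm) AE_distr_iff) auto
  then show ?thesis by (rule that)
qed

end

context semicircle_reference begin

lemma distr_affine_S:
  assumes "0 < s"
  shows "distr M borel (\<lambda>u. m + s * S u) = semicircular_law m s"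
  unfolding semicircular_law_affine[OF assms] distrS[symmetric]
  by (subst distr_distr) (auto simp: o_def)

text \<open>The quantile coupling lies between: W is at most its cost \<open>q\<close>, and H is
  \<open>q\<close> plus the nonnegative \<open>2 * e - 3\<close>. Equality forces
  \<open>e = 3 / 2\<close>; it cannot hold with H infinite, since \<open>q\<close> is
  finite.\<close>

lemma transport_entropy_quantiles:
  fixes X Y :: "real \<Rightarrow> real"
  assumes mono: "mono X" "mono Y" and R: "AE u in M. \<bar>X u\<bar> \<le> R" "AE u in M. \<bar>Y u\<bar> \<le> R" and zero: "expectation X = 0"
  defines "H \<equiv> 2 * free_entropy_rel_semicircular (distr M borel X) + 2 * free_entropy_rel_semicircular (distr M borel Y)"
    and "W \<equiv> enn2ereal (quadratic_cost (distr M borel X) (distr M borel Y))"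
  shows "W \<le> H" and "W = H \<Longrightarrow> energy X Y = ennreal (3 / 2)"
proof -
  have m: "X \<in> borel_measurable borel" "Y \<in> borel_measurable borel"
    using mono by (auto intro: borel_measurable_mono)
  define q where "q = expectation (\<lambda>u. (X u)\<^sup>2) + expectation (\<lambda>u. (Y u)\<^sup>2) - 2 * expectation (\<lambda>u. X u * Y u)"
  have "0 \<le> q"
    unfolding q_def expectation_square_diff(2)[OF m R, symmetric] by simp
  then have W: "W \<le> ereal q"
    unfolding W_def using quadratic_cost_quantiles[OF m R] unfolding q_def[symmetric]
    by (metis enn2ereal_ennreal less_eq_ennreal.rep_eq)
  have "W \<le> H \<and> (W = H \<longrightarrow> energy X Y = ennreal (3 / 2))"
  proof (cases "energy X Y")
    case (real e)
    have "3 / 2 \<le> e"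
      using energy_lower_bound_semicircle[OF mono] real by simp
    moreover have "H = ereal (q + (2 * e - 3))"
      unfolding H_def q_def using free_entropy_sum(2)[OF mono R zero real(2,1)] .
    ultimately show ?thesis
      using W real by (cases W) auto
  next
    case top
    then have "H = \<infinity>"
      unfolding H_def using free_entropy_sum(1)[OF mono R zero] by simp
    then show ?thesis using W by auto
  qed
  then show "W \<le> H" and "W = H \<Longrightarrow> energy X Y = ennreal (3 / 2)" by auto
qed

end

text \<open>Kantorovich duality with quadratic potentials. The square of
  \<open>x / s - s * (y - m)\<close> is nonnegative and vanishes along the map
  \<open>y = m + x / s^2\<close>. It gives the minorant \<open>g\<close>, whose mean depends only on
  the first two moments of the marginals.\<close>

lemma quadratic_cost_semicircular_lower_bound:
  fixes \<mu> \<nu> :: "real measure"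
  assumes s: "0 < s" and sets[simp]: "sets \<mu> = sets borel" "sets \<nu> = sets borel"
    and \<mu>: "integrable \<mu> (\<lambda>x. x)" "integrable \<mu> (\<lambda>x. x\<^sup>2)" "(\<integral>x. x \<partial>\<mu>) = 0" "(\<integral>x. x\<^sup>2 \<partial>\<mu>) = s\<^sup>2"
    and \<nu>: "integrable \<nu> (\<lambda>y. y)" "integrable \<nu> (\<lambda>y. y\<^sup>2)" "(\<integral>y. y \<partial>\<nu>) = m" "(\<integral>y. y\<^sup>2 \<partial>\<nu>) = m\<^sup>2 + inverse (s\<^sup>2)"
  shows "ennreal (s\<^sup>2 + (m\<^sup>2 + inverse (s\<^sup>2)) - 2) \<le> quadratic_cost \<mu> \<nu>"
  unfolding quadratic_cost_def
proof (rule INF_greatest)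
  fix \<pi> assume \<pi>: "\<pi> \<in> couplings \<mu> \<nu>"
  then interpret prob_space \<pi> by (simp add: couplings_def)
  have sets_\<pi>[measurable_cong]: "sets \<pi> = sets (borel \<Otimes>\<^sub>M borel)"
    using \<pi> sets_pair_measure_cong[OF sets] by (simp add: couplings_def)
  have fst: "fst \<in> \<pi> \<rightarrow>\<^sub>M \<mu>" and snd: "snd \<in> \<pi> \<rightarrow>\<^sub>M \<nu>"
    using measurable_cong_sets[OF sets_\<pi> sets(1)] measurable_cong_sets[OF sets_\<pi> sets(2)] by auto
  have d: "distr \<pi> \<mu> fst = \<mu>" "distr \<pi> \<nu> snd = \<nu>" using \<pi> by (auto simp: couplings_def)
  note i = integrable_distr[OF fst, unfolded d(1), OF \<mu>(1)] integrable_distr[OF fst, unfolded d(1), OF \<mu>(2)]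
    integrable_distr[OF snd, unfolded d(2), OF \<nu>(1)] integrable_distr[OF snd, unfolded d(2), OF \<nu>(2)]
  note v = integral_distr[OF fst borel_measurable_integrable[OF \<mu>(1)], unfolded d(1) \<mu>(3), symmetric]
    integral_distr[OF fst borel_measurable_integrable[OF \<mu>(2)], unfolded d(1) \<mu>(4), symmetric]
    integral_distr[OF snd borel_measurable_integrable[OF \<nu>(1)], unfolded d(2) \<nu>(3), symmetric]
    integral_distr[OF snd borel_measurable_integrable[OF \<nu>(2)], unfolded d(2) \<nu>(4), symmetric]
  define g where "g p = (fst p)\<^sup>2 + (snd p)\<^sup>2 - inverse (s\<^sup>2) * (fst p)\<^sup>2 - s\<^sup>2 * ((snd p)\<^sup>2 - 2 * m * snd p + m\<^sup>2) - 2 * m * fst p" for p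
  have ge: "g p \<le> (fst p - snd p)\<^sup>2" for p
  proof -
    have "0 \<le> (fst p / s - s * (snd p - m))\<^sup>2" by simp
    also have "\<dots> = (fst p / s)\<^sup>2 - 2 * ((fst p / s) * (s * (snd p - m))) + (s * (snd p - m))\<^sup>2"
      by (simp only: power2_diff mult.assoc)
    also have "(fst p / s) * (s * (snd p - m)) = fst p * (snd p - m)" using s by simp
    also have "(fst p / s)\<^sup>2 = inverse (s\<^sup>2) * (fst p)\<^sup>2" by (simp add: divide_inverse power_mult_distrib power_inverse mult.commute)
    also have "(s * (snd p - m))\<^sup>2 = s\<^sup>2 * (snd p - m)\<^sup>2" by (rule power_mult_distrib)
    finally show ?thesis
      unfolding g_def by (simp add: power2_eq_square algebra_simps)
  qed
  have ig: "integrable \<pi> g" unfolding g_def using i by auto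
  have "expectation g = s\<^sup>2 + (m\<^sup>2 + inverse (s\<^sup>2)) - 2"
  proof -
    have "expectation g = s\<^sup>2 + (m\<^sup>2 + inverse (s\<^sup>2)) - inverse (s\<^sup>2) * s\<^sup>2 - s\<^sup>2 * ((m\<^sup>2 + inverse (s\<^sup>2)) - 2 * m * m + m\<^sup>2) - 2 * m * 0"
      unfolding g_def using i v prob_space by simp
    also have "\<dots> = s\<^sup>2 + (m\<^sup>2 + inverse (s\<^sup>2)) - 2"
    proof -
      have "(m\<^sup>2 + inverse (s\<^sup>2)) - 2 * m * m + m\<^sup>2 = inverse (s\<^sup>2)" by (simp add: power2_eq_square)
      moreover have "inverse (s\<^sup>2) * s\<^sup>2 = 1" "s\<^sup>2 * inverse (s\<^sup>2) = 1" using s by auto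
      ultimately show ?thesis by simp
    qed
    finally show ?thesis .
  qed
  moreover have isq: "integrable \<pi> (\<lambda>p. (fst p - snd p)\<^sup>2)"
  proof (rule Bochner_Integration.integrable_bound)
    show "integrable \<pi> (\<lambda>p. 2 * (fst p)\<^sup>2 + 2 * (snd p)\<^sup>2)" using i by auto
    have "(x - y)\<^sup>2 \<le> 2 * x\<^sup>2 + 2 * y\<^sup>2" for x y :: real
      using zero_le_power2[of "x + y"] by (simp add: power2_eq_square algebra_simps)
    then show "AE p in \<pi>. norm ((fst p - snd p)\<^sup>2) \<le> norm (2 * (fst p)\<^sup>2 + 2 * (snd p)\<^sup>2)"
      by (intro AE_I2) simp
  qed measurable
  ultimately have "s\<^sup>2 + (m\<^sup>2 + inverse (s\<^sup>2)) - 2 \<le> expectation (\<lambda>p. (fst p - snd p)\<^sup>2)"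
    using integral_mono[OF ig isq ge] by simp
  then have "ennreal (s\<^sup>2 + (m\<^sup>2 + inverse (s\<^sup>2)) - 2) \<le> ennreal (expectation (\<lambda>p. (fst p - snd p)\<^sup>2))"
    by (rule ennreal_leI)
  also have "\<dots> = (\<integral>\<^sup>+p. ennreal ((fst p - snd p)\<^sup>2) \<partial>\<pi>)"
    using isq by (intro nn_integral_eq_integral[symmetric]) auto
  finally show "ennreal (s\<^sup>2 + (m\<^sup>2 + inverse (s\<^sup>2)) - 2) \<le> (\<integral>\<^sup>+ p. ennreal (\<bar>fst p - snd p\<bar>\<^sup>2) \<partial>\<pi>)"
    by simp
qed

section \<open>The transport-entropy inequality\<close>

context semicircle_reference begin

text \<open>The pair is s S and m + S / s, so its energy equals that of S with itself. The entropy
  side is then the number delivered by the quadratic lower bound for the cost.\<close>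

lemma semicircular_pair_attains:
  fixes \<mu> \<nu> :: "real measure"
  assumes s: "0 < s" and \<mu>: "\<mu> = semicircular_law 0 s" and \<nu>: "\<nu> = semicircular_law m (1 / s)"
  shows "enn2ereal (quadratic_cost \<mu> \<nu>) = 2 * free_entropy_rel_semicircular \<mu> + 2 * free_entropy_rel_semicircular \<nu>"
proof -
  \<comment> \<open>The leading \<open>0 +\<close> matches the form of
    \<open>distr_affine_S\<close>.\<close>
  define X where "X u = 0 + s * S u" for u
  define Y where "Y u = m + 1 / s * S u" for u
  have mono: "mono X" "mono Y"
    unfolding X_def Y_def using s monoD[OF monoS] by (auto intro!: monoI mult_left_mono divide_right_mono)
  have m[measurable]: "X \<in> borel_measurable borel" "Y \<in> borel_measurable borel"
    using mono by (auto intro: borel_measurable_mono)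
  have d: "distr M borel X = \<mu>" "distr M borel Y = \<nu>"
    using distr_affine_S[OF s, of 0] distr_affine_S[of "1 / s" m] s
    unfolding X_def[abs_def] Y_def[abs_def] \<mu> \<nu> by (simp_all only: zero_less_divide_1_iff)
  define R where "R = s * 2 + \<bar>m\<bar> + 1 / s * 2"
  have "AE u in M. \<bar>X u\<bar> \<le> R \<and> \<bar>Y u\<bar> \<le> R"
    using AE_S_bounded
  proof eventually_elim
    case (elim u)
    have "\<bar>s * S u\<bar> \<le> s * 2" "\<bar>1 / s * S u\<bar> \<le> 1 / s * 2"
      using elim s by (auto simp: abs_mult divide_right_mono)
    moreover have "0 \<le> s * 2" "0 \<le> 1 / s * 2" using s by auto
    ultimately show ?case unfolding X_def Y_def R_def by linarith
  qed
  then have R: "AE u in M. \<bar>X u\<bar> \<le> R" "AE u in M. \<bar>Y u\<bar> \<le> R" by auto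
  have sq_measurable: "(\<lambda>x :: real. x\<^sup>2) \<in> borel_measurable borel" by simp
  have iS: "integrable M S" "expectation S = 0" "integrable M (\<lambda>u. (S u)\<^sup>2)" "expectation (\<lambda>u. (S u)\<^sup>2) = 1"
    using S_moments integral_S[OF sq_measurable] semicircle_moments by simp_all
  have sq: "(X u)\<^sup>2 = s\<^sup>2 * (S u)\<^sup>2" "(Y u)\<^sup>2 = m\<^sup>2 + 2 * m * (1 / s) * S u + inverse (s\<^sup>2) * (S u)\<^sup>2" "X u * Y u = s * m * S u + (S u)\<^sup>2" for u
  proof -
    show "(X u)\<^sup>2 = s\<^sup>2 * (S u)\<^sup>2" unfolding X_def by (simp add: power_mult_distrib)
    have "(Y u)\<^sup>2 = m\<^sup>2 + 2 * m * (1 / s * S u) + (1 / s * S u)\<^sup>2"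
      unfolding Y_def power2_sum by simp
    also have "(1 / s * S u)\<^sup>2 = inverse (s\<^sup>2) * (S u)\<^sup>2" by (simp add: power_mult_distrib power_inverse inverse_eq_divide power_divide)
    finally show "(Y u)\<^sup>2 = m\<^sup>2 + 2 * m * (1 / s) * S u + inverse (s\<^sup>2) * (S u)\<^sup>2" by simp
    show "X u * Y u = s * m * S u + (S u)\<^sup>2"
      unfolding X_def Y_def using s by (simp add: distrib_left power2_eq_square)
  qed
  have i: "integrable M X" "integrable M Y" "integrable M (\<lambda>u. (X u)\<^sup>2)" "integrable M (\<lambda>u. (Y u)\<^sup>2)"
  proof -
    show "integrable M X" "integrable M Y" unfolding X_def[abs_def] Y_def[abs_def] using iS by simp_all
    show "integrable M (\<lambda>u. (X u)\<^sup>2)" "integrable M (\<lambda>u. (Y u)\<^sup>2)" unfolding sq using iS by simp_all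
  qed
  have v: "expectation X = 0" "expectation Y = m" "expectation (\<lambda>u. (X u)\<^sup>2) = s\<^sup>2"
    "expectation (\<lambda>u. (Y u)\<^sup>2) = m\<^sup>2 + inverse (s\<^sup>2)" "expectation (\<lambda>u. X u * Y u) = 1"
  proof -
    show "expectation X = 0" "expectation Y = m" unfolding X_def[abs_def] Y_def[abs_def] using iS by simp_all
    show "expectation (\<lambda>u. (X u)\<^sup>2) = s\<^sup>2" "expectation (\<lambda>u. (Y u)\<^sup>2) = m\<^sup>2 + inverse (s\<^sup>2)"
      "expectation (\<lambda>u. X u * Y u) = 1"
      unfolding sq using iS by simp_all
  qed
  have "energy X Y = energy (\<lambda>u. s * (S u - 0)) (\<lambda>u. (S u - (- s * m)) / s)"
    unfolding X_def[abs_def] Y_def[abs_def] using s by (simp add: add_divide_distrib add.commute)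
  also have "\<dots> = ennreal (3 / 2)" using s by (subst energy_affine) (auto simp: energy_S)
  finally have e: "energy X Y = ennreal (3 / 2)" .
  have "2 * free_entropy_rel_semicircular \<mu> + 2 * free_entropy_rel_semicircular \<nu> = ereal (s\<^sup>2 + (m\<^sup>2 + inverse (s\<^sup>2)) - 2)"
    using free_entropy_sum(2)[OF mono R v(1) e] v unfolding d by simp
  moreover have "enn2ereal (quadratic_cost \<mu> \<nu>) \<le> 2 * free_entropy_rel_semicircular \<mu> + 2 * free_entropy_rel_semicircular \<nu>"
    using transport_entropy_quantiles(1)[OF mono R v(1)] unfolding d .
  moreover have "ereal (s\<^sup>2 + (m\<^sup>2 + inverse (s\<^sup>2)) - 2) \<le> enn2ereal (quadratic_cost \<mu> \<nu>)"
  proof -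
    have "ennreal (s\<^sup>2 + (m\<^sup>2 + inverse (s\<^sup>2)) - 2) \<le> quadratic_cost \<mu> \<nu>"
    proof (rule quadratic_cost_semicircular_lower_bound[OF s])
      show "sets \<mu> = sets borel" "sets \<nu> = sets borel" unfolding \<mu> \<nu> by simp_all
      show "integrable \<mu> (\<lambda>x. x)" "integrable \<mu> (\<lambda>x. x\<^sup>2)" "integrable \<nu> (\<lambda>x. x)" "integrable \<nu> (\<lambda>x. x\<^sup>2)"
        unfolding d[symmetric] using i by (simp_all add: integrable_distr_eq)
      show "(\<integral>x. x \<partial>\<mu>) = 0" "(\<integral>x. x\<^sup>2 \<partial>\<mu>) = s\<^sup>2" "(\<integral>y. y \<partial>\<nu>) = m" "(\<integral>y. y\<^sup>2 \<partial>\<nu>) = m\<^sup>2 + inverse (s\<^sup>2)"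
        unfolding d[symmetric] using v by (simp_all add: integral_distr)
    qed
    then have "enn2ereal (ennreal (s\<^sup>2 + (m\<^sup>2 + inverse (s\<^sup>2)) - 2)) \<le> enn2ereal (quadratic_cost \<mu> \<nu>)"
      by (simp only: less_eq_ennreal.rep_eq)
    moreover have "ereal (s\<^sup>2 + (m\<^sup>2 + inverse (s\<^sup>2)) - 2) \<le> enn2ereal (ennreal (s\<^sup>2 + (m\<^sup>2 + inverse (s\<^sup>2)) - 2))"
      by (simp add: ennreal.rep_eq)
    ultimately show ?thesis by (rule order_trans[rotated])
  qed
  ultimately show ?thesis by (metis antisym)
qed

end

lemma semicircular_law_mean:
  assumes "0 < s"
  shows "(\<integral>x. x \<partial>semicircular_law m s) = m"
proof -
  have "(\<integral>x. x \<partial>semicircular_law m s) = (\<integral>x. m + s * x \<partial>\<sigma>)"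
    unfolding semicircular_law_affine[OF assms, of m] by (rule integral_distr) measurable
  also have "\<dots> = m" using semicircle_moments(1,3) by simp
  finally show ?thesis .
qed

theorem theorem10:
  fixes \<mu> \<nu> :: "real measure"
  assumes "real_distribution \<mu>" and "compactly_supported \<mu>" and "(\<integral>x. x \<partial>\<mu>) = 0"
    and "real_distribution \<nu>" and "compactly_supported \<nu>"
  shows "enn2ereal ((wasserstein2 \<mu> \<nu>)\<^sup>2)
           \<le> 2 * free_entropy_rel_semicircular \<mu> + 2 * free_entropy_rel_semicircular \<nu> \<and>
         (enn2ereal ((wasserstein2 \<mu> \<nu>)\<^sup>2)
           = 2 * free_entropy_rel_semicircular \<mu> + 2 * free_entropy_rel_semicircular \<nu> \<longleftrightarrow>
          (\<exists>s>0. semicircular_with_variance \<mu> (s\<^sup>2) \<and>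
                 semicircular_with_variance \<nu> (inverse (s\<^sup>2))))"
proof -
  obtain S where S: "mono S" "distr logistic_measure borel S = \<sigma>"
    using quantile_exists[OF semicircle.real_distribution_axioms] by blast
  interpret semicircle_reference logistic_measure S
    using reference_measure_logistic S by (simp add: semicircle_reference_def semicircle_reference_axioms_def)
  obtain X where X: "mono X" "distr logistic_measure borel X = \<mu>"
    using quantile_exists[OF assms(1)] by blast
  obtain Y where Y: "mono Y" "distr logistic_measure borel Y = \<nu>"
    using quantile_exists[OF assms(4)] by blast
  note m = borel_measurable_mono[OF X(1)] borel_measurable_mono[OF Y(1)]
  obtain R1 where R1: "AE u in logistic_measure. \<bar>X u\<bar> \<le> R1"
    using compactly_supported_distr[OF m(1)] assms(2) X(2) by blast
  obtain R2 where R2: "AE u in logistic_measure. \<bar>Y u\<bar> \<le> R2"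
    using compactly_supported_distr[OF m(2)] assms(5) Y(2) by blast
  have R: "AE u in logistic_measure. \<bar>X u\<bar> \<le> max R1 R2" "AE u in logistic_measure. \<bar>Y u\<bar> \<le> max R1 R2"
    by (use R1 in eventually_elim, simp) (use R2 in eventually_elim, simp)
  have zero: "expectation X = 0"
    using assms(3) integral_distr[of X logistic_measure borel "\<lambda>x. x"] m(1) unfolding X(2) by simp
  note main = transport_entropy_quantiles[OF X(1) Y(1) R zero, unfolded X(2) Y(2)]
  show ?thesis
    unfolding wasserstein2_squared
  proof (intro conjI iffI)
    show "enn2ereal (quadratic_cost \<mu> \<nu>) \<le> 2 * free_entropy_rel_semicircular \<mu> + 2 * free_entropy_rel_semicircular \<nu>"
      by (rule main(1))
  next
    assume "enn2ereal (quadratic_cost \<mu> \<nu>) = 2 * free_entropy_rel_semicircular \<mu> + 2 * free_entropy_rel_semicircular \<nu>"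
    then have "energy X Y = ennreal (3 / 2)" by (rule main(2))
    then obtain r a b where r: "0 < r" and ae: "AE u in logistic_measure. X u = S u / r + a" "AE u in logistic_measure. Y u = r * S u + b"
      using energy_equality_case[OF X(1) Y(1)] by blast
    have "\<mu> = distr logistic_measure borel (\<lambda>u. a + 1 / r * S u)"
      unfolding X(2)[symmetric] using ae(1) m(1) by (intro distr_cong_AE) (auto simp: add.commute)
    then have \<mu>: "\<mu> = semicircular_law a (1 / r)" using r by (simp only: distr_affine_S zero_less_divide_1_iff)
    have "\<nu> = distr logistic_measure borel (\<lambda>u. b + r * S u)"
      unfolding Y(2)[symmetric] using ae(2) m(2) by (intro distr_cong_AE) (auto simp: add.commute)
    then have \<nu>: "\<nu> = semicircular_law b r" using r by (simp only: distr_affine_S)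
    show "\<exists>s>0. semicircular_with_variance \<mu> (s\<^sup>2) \<and> semicircular_with_variance \<nu> (inverse (s\<^sup>2))"
    \<comment> \<open>X is S / r and Y is r S, each up to a shift, so the witness is the scale of
      X.\<close>
    proof (intro exI[of _ "1 / r"] conjI)
      show "semicircular_with_variance \<mu> ((1 / r)\<^sup>2)"
        unfolding semicircular_with_variance_def \<mu> using r by (intro exI[of _ a] exI[of _ "1 / r"]) simp
      show "semicircular_with_variance \<nu> (inverse ((1 / r)\<^sup>2))"
        unfolding semicircular_with_variance_def \<nu> using r by (intro exI[of _ b] exI[of _ r]) (simp add: power_divide)
    qed (use r in simp)
  next
    assume "\<exists>s>0. semicircular_with_variance \<mu> (s\<^sup>2) \<and> semicircular_with_variance \<nu> (inverse (s\<^sup>2))"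
    then obtain s m1 s1 m2 s2 where s: "0 < s" "0 < s1" "s\<^sup>2 = s1\<^sup>2" "\<mu> = semicircular_law m1 s1"
      "0 < s2" "inverse (s\<^sup>2) = s2\<^sup>2" "\<nu> = semicircular_law m2 s2"
      unfolding semicircular_with_variance_def by blast
    have "s1 = s" using s by (metis less_imp_le power2_eq_imp_eq)
    moreover have "s2 = 1 / s"
      using s(1,5,6) power2_eq_imp_eq[of s2 "1 / s"] by (simp add: power_divide inverse_eq_divide)
    \<comment> \<open>Centring fixes the mean of \<mu>, while the mean of \<nu> stays
      arbitrary.\<close>
    moreover have "m1 = 0" using assms(3) semicircular_law_mean[OF s(2)] s(4) by simp
    ultimately show "enn2ereal (quadratic_cost \<mu> \<nu>) = 2 * free_entropy_rel_semicircular \<mu> + 2 * free_entropy_rel_semicircular \<nu>"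
      using s by (intro semicircular_pair_attains[OF s(1)]) auto
  qed
qed

end
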